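(* Let $M$ be a closed oriented hyperbolic surface, let $\Lambda=(\lambda,\nu)$ be an oriented measured geodesic lamination, where $\lambda$ is a disjoint union of finitely many minimal sublaminations, and let $v$ be the primitive (of locally bounded variation) of the Ruelle–Sullivan current $T_\Lambda$, $dv=T_\Lambda$. In the canonical decomposition $dv=(dv)_0+(dv)_{jump}+(dv)_{cantor}$ of the measure $dv$: (i) $(dv)_0=0$; (ii) $(dv)_{jump}$ is supported on the closed isolated leaves of $\lambda$; (iii) $(dv)_{cantor}$ is supported on the minimal sublaminations of $\lambda$ which are not closed isolated leaves.
   Context: A geodesic lamination $\lambda$ is a closed subset that is a disjoint union of simple complete geodesics (leaves); it is minimal if it is minimal with respect to inclusion among nonempty geodesic laminations. A leaf $\lambda_0$ is isolated if each $x\in\lambda_0$ has a neighborhood $U$ with $(U,U\cap\lambda)$ homeomorphic to (disc, diameter). A flow box is a bi-Lipschitz homeomorphism $F:[a,b]\times[c,d]\to R\subset M$, $F=F(t,s)$, with $F^{-1}(\lambda)=[a,b]\times K$, $K\subset(c,d)$ closed of Hausdorff dimension $0$ (chosen with $\partial F/\partial t$ Lipschitz). $\lambda$ is oriented if a neighborhood is covered by orientation-preserving flow boxes such that the orientation of leaves corresponds to increasing $t$. A transverse measure $\nu$ assigns to the leaf space $[c,d]$ of each flow box a finite nonnegative measure supported in $K$, preserved by coordinate changes. Ruelle–Sullivan current: with oriented flow boxes $F_i$ covering a neighborhood of $\lambda$ and $\phi=\sum\phi_i$, $\phi_i$ a smooth 1-form compactly supported in the image of $F_i$, $T_\Lambda(\phi)=\sum_i\int_{(c_i,d_i)}\big(\int_{[a_i,b_i]\times\{s\}}F_i^*\phi_i\big)d\nu(s)$,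 extended by zero to $M$; it is closed. Its primitive $v$ is a section of a flat real affine line bundle given by an equivariant function $\tilde v\in BV_{loc}(\tilde M)$ with $d\tilde v$ equal to the pullback of $T_\Lambda$ (where $dw(\phi)=\int w\,d\phi$); $v$ is unique up to an additive constant. Decomposition of a BV function $v$ on a ball in dimension $n$: $(dv)_0$ is the part of $dv$ absolutely continuous with respect to Lebesgue measure; the singular part is the sum of $(dv)_{jump}$, its restriction to the countably $(n-1)$-rectifiable jump set of $v$, and the remainder $(dv)_{cantor}$, which vanishes on every Borel set of $\sigma$-finite $(n-1)$-dimensional Hausdorff measure. *)

theory Defs
  imports "HOL-Analysis.Analysis"
begin

definition uhp :: "complex set" where
  "uhp = {z. 0 < Im z}"

definition hdist :: "complex \<Rightarrow> complex \<Rightarrow> real" where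
  "hdist z w = arcosh (1 + (cmod (z - w))\<^sup>2 / (2 * Im z * Im w))"

definition psl2r :: "(complex \<Rightarrow> complex) set" where
  "psl2r = {g. \<exists>a b c d :: real. a * d - b * c = 1 \<and>
     g = (\<lambda>z. (of_real a * z + of_real b) / (of_real c * z + of_real d))}"

definition deck_group :: "(complex \<Rightarrow> 'm) \<Rightarrow> (complex \<Rightarrow> complex) set" where
  "deck_group p = {g \<in> psl2r. \<forall>z\<in>uhp. p (g z) = p z}"

text \<open>
  A closed oriented hyperbolic surface \<open>M\<close> comes with its universal covering
  \<open>p\<close> from the upper half-plane.  By the Killing-Hopf theorem the universal
  cover of such a surface is the hyperbolic plane, with deck transformations acting by
  orientation-preserving isometries.  \<open>M\<close> carries the orientation that makes
  \<open>p\<close> orientation-preserving, and its metric is the Riemannian distance, which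
  is the quotient of the hyperbolic distance.
\<close>
definition closed_hyperbolic_surface :: "'m::metric_space set \<Rightarrow> (complex \<Rightarrow> 'm) \<Rightarrow> bool" where
  "closed_hyperbolic_surface M p \<longleftrightarrow>
     compact M \<and> covering_space uhp p M \<and>
     (\<forall>z\<in>uhp. \<forall>w\<in>uhp. p z = p w \<longrightarrow> (\<exists>g\<in>deck_group p. g z = w)) \<and>
     (\<forall>z\<in>uhp. \<forall>w\<in>uhp. dist (p z) (p w) =
        Inf {hdist z' w' | z' w'. z' \<in> uhp \<and> w' \<in> uhp \<and> p z' = p z \<and> p w' = p w})"

definition hyperbolic_line :: "(real \<Rightarrow> complex) \<Rightarrow> bool" where
  "hyperbolic_line g \<longleftrightarrow> range g \<subseteq> uhp \<and> (\<forall>s t. hdist (g s) (g t) = \<bar>s - t\<bar>)"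

definition complete_geodesic :: "(complex \<Rightarrow> 'm) \<Rightarrow> (real \<Rightarrow> 'm) \<Rightarrow> bool" where
  "complete_geodesic p c \<longleftrightarrow> (\<exists>g. hyperbolic_line g \<and> c = p \<circ> g)"

text \<open>A geodesic is simple if it is injective, or closed and injective modulo its period.\<close>
definition simple_geodesic :: "(real \<Rightarrow> 'm) \<Rightarrow> bool" where
  "simple_geodesic c \<longleftrightarrow> (\<forall>s t. c s = c t \<longrightarrow> (\<forall>u. c (s + u) = c (t + u)))"

text \<open>
  \<open>L\<close> is the set of leaves of the lamination with underlying closed set \<open>S\<close>.
\<close>
definition lamination_leaves ::
  "'m::metric_space set \<Rightarrow> (complex \<Rightarrow> 'm) \<Rightarrow> 'm set \<Rightarrow> 'm set set \<Rightarrow> bool" where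
  "lamination_leaves M p S L \<longleftrightarrow>
     S \<subseteq> M \<and> closed S \<and>
     (\<forall>l\<in>L. \<exists>c. complete_geodesic p c \<and> simple_geodesic c \<and> range c = l) \<and>
     disjoint L \<and> \<Union>L = S"

definition geodesic_lamination ::
  "'m::metric_space set \<Rightarrow> (complex \<Rightarrow> 'm) \<Rightarrow> 'm set \<Rightarrow> bool" where
  "geodesic_lamination M p S \<longleftrightarrow> (\<exists>L. lamination_leaves M p S L)"

definition minimal_lamination ::
  "'m::metric_space set \<Rightarrow> (complex \<Rightarrow> 'm) \<Rightarrow> 'm set \<Rightarrow> bool" where
  "minimal_lamination M p S \<longleftrightarrow>
     geodesic_lamination M p S \<and> S \<noteq> {} \<and>
     (\<forall>S'. geodesic_lamination M p S' \<and> S' \<noteq> {} \<and> S' \<subseteq> S \<longrightarrow> S' = S)"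

definition closed_leaf :: "(complex \<Rightarrow> 'm) \<Rightarrow> 'm set \<Rightarrow> bool" where
  "closed_leaf p l \<longleftrightarrow>
     (\<exists>c T. complete_geodesic p c \<and> range c = l \<and> 0 < T \<and> (\<forall>t. c (t + T) = c t))"

definition isolated_leaf :: "'m::metric_space set \<Rightarrow> 'm set \<Rightarrow> 'm set \<Rightarrow> bool" where
  "isolated_leaf M S l \<longleftrightarrow>
     (\<forall>x\<in>l. \<exists>U. openin (top_of_set M) U \<and> x \<in> U \<and>
        (\<exists>h k. homeomorphism U (ball (0::complex) 1) h k \<and>
               h ` (U \<inter> S) = {z \<in> ball 0 1. Im z = 0}))"

definition closed_isolated_leaves ::
  "'m::metric_space set \<Rightarrow> (complex \<Rightarrow> 'm) \<Rightarrow> 'm set \<Rightarrow> 'm set set \<Rightarrow> 'm set set" where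
  "closed_isolated_leaves M p S L = {l \<in> L. closed_leaf p l \<and> isolated_leaf M S l}"

definition hausdorff_premeasure :: "real \<Rightarrow> real \<Rightarrow> 'a::metric_space set \<Rightarrow> ennreal" where
  "hausdorff_premeasure \<alpha> \<delta> S =
     (INF U \<in> {U :: nat \<Rightarrow> 'a set. S \<subseteq> (\<Union>i. U i) \<and> (\<forall>i. bounded (U i) \<and> diameter (U i) \<le> \<delta>)}.
        (\<Sum>i. ennreal (diameter (U i) powr \<alpha>)))"

definition hausdorff_measure :: "real \<Rightarrow> 'a::metric_space set \<Rightarrow> ennreal" where
  "hausdorff_measure \<alpha> S = (SUP \<delta> \<in> {0<..}. hausdorff_premeasure \<alpha> \<delta> S)"

definition hausdorff_dim :: "'a::metric_space set \<Rightarrow> ennreal" where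
  "hausdorff_dim S = (INF \<alpha> \<in> {\<alpha>. 0 < \<alpha> \<and> hausdorff_measure \<alpha> S = 0}. ennreal \<alpha>)"

text \<open>
  \<open>chart\<close> is defined on \<open>[tmin, tmax] \<times> [smin, smax]\<close>, and
  \<open>leafset\<close> is the set of parameters \<open>s\<close> whose plaque lies in the lamination.
\<close>
record 'm flow_box =
  chart :: "real \<times> real \<Rightarrow> 'm"
  tmin :: real
  tmax :: real
  smin :: real
  smax :: real
  leafset :: "real set"

definition rect :: "'m flow_box \<Rightarrow> (real \<times> real) set" where
  "rect B = {tmin B..tmax B} \<times> {smin B..smax B}"

definition open_rect :: "'m flow_box \<Rightarrow> (real \<times> real) set" where
  "open_rect B = {tmin B<..<tmax B} \<times> {smin B<..<smax B}"

text \<open>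
  Derivatives of the chart are computed for a lift to the upper half-plane.  Any two lifts differ
  by a deck transformation, so the notions below do not depend on the lift.
\<close>
definition chart_lift :: "(complex \<Rightarrow> 'm) \<Rightarrow> 'm flow_box \<Rightarrow> (real \<times> real \<Rightarrow> complex) \<Rightarrow> bool" where
  "chart_lift p B G \<longleftrightarrow>
     continuous_on (rect B) G \<and> G ` rect B \<subseteq> uhp \<and> (\<forall>x\<in>rect B. p (G x) = chart B x)"

definition flow_box ::
  "'m::metric_space set \<Rightarrow> (complex \<Rightarrow> 'm) \<Rightarrow> 'm set \<Rightarrow> 'm flow_box \<Rightarrow> bool" where
  "flow_box M p S B \<longleftrightarrow>
     tmin B < tmax B \<and> smin B < smax B \<and>
     chart B ` rect B \<subseteq> M \<and>
     (\<exists>C>0. \<forall>x\<in>rect B. \<forall>y\<in>rect B.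
        dist x y / C \<le> dist (chart B x) (chart B y) \<and> dist (chart B x) (chart B y) \<le> C * dist x y) \<and>
     closed (leafset B) \<and> leafset B \<subseteq> {smin B<..<smax B} \<and> hausdorff_dim (leafset B) = 0 \<and>
     {x \<in> rect B. chart B x \<in> S} = {tmin B..tmax B} \<times> leafset B \<and>
     (\<exists>G G'. chart_lift p B G \<and>
        (\<forall>(t, s)\<in>rect B.
           ((\<lambda>\<tau>. G (\<tau>, s)) has_vector_derivative G' (t, s)) (at t within {tmin B..tmax B})) \<and>
        (\<exists>C. C-lipschitz_on (rect B) G'))"

text \<open>
  A bi-Lipschitz map is differentiable almost everywhere; \<open>Im (cnj u * w)\<close> is
  the determinant of the matrix with columns \<open>u\<close> and \<open>w\<close>.
\<close>
definition orientation_preserving :: "(complex \<Rightarrow> 'm) \<Rightarrow> 'm flow_box \<Rightarrow> bool" where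
  "orientation_preserving p B \<longleftrightarrow>
     (\<exists>G. chart_lift p B G \<and>
        (AE x in lebesgue. x \<in> open_rect B \<longrightarrow>
           (\<exists>D. (G has_derivative D) (at x) \<and> 0 < Im (cnj (D (1, 0)) * D (0, 1)))))"

text \<open>
  An orientation of the leaves is given by choosing, for each leaf \<open>l\<close>, a unit speed
  parametrization \<open>dir l\<close>.
\<close>
definition oriented_flow_box ::
  "'m::metric_space set \<Rightarrow> (complex \<Rightarrow> 'm) \<Rightarrow> 'm set \<Rightarrow> 'm set set \<Rightarrow> ('m set \<Rightarrow> real \<Rightarrow> 'm)
     \<Rightarrow> 'm flow_box \<Rightarrow> bool" where
  "oriented_flow_box M p S L dir B \<longleftrightarrow>
     flow_box M p S B \<and> orientation_preserving p B \<and>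
     (\<forall>s\<in>leafset B. \<exists>l\<in>L. \<exists>\<theta>. continuous_on {tmin B..tmax B} \<theta> \<and> strict_mono_on {tmin B..tmax B} \<theta> \<and>
        (\<forall>t\<in>{tmin B..tmax B}. chart B (t, s) = dir l (\<theta> t)))"

definition oriented_lamination ::
  "'m::metric_space set \<Rightarrow> (complex \<Rightarrow> 'm) \<Rightarrow> 'm set \<Rightarrow> 'm set set \<Rightarrow> ('m set \<Rightarrow> real \<Rightarrow> 'm)
     \<Rightarrow> bool" where
  "oriented_lamination M p S L dir \<longleftrightarrow>
     lamination_leaves M p S L \<and>
     (\<forall>l\<in>L. complete_geodesic p (dir l) \<and> simple_geodesic (dir l) \<and> range (dir l) = l) \<and>
     S \<subseteq> (\<Union>B\<in>{B. oriented_flow_box M p S L dir B}. chart B ` open_rect B)"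

text \<open>
  The action on leaf spaces of the coordinate change from \<open>B\<close> to \<open>B'\<close>,
  read off along the transversal \<open>{t} \<times> [smin B, smax B]\<close>.
\<close>
definition leaf_transition :: "'m flow_box \<Rightarrow> 'm flow_box \<Rightarrow> real \<Rightarrow> real \<Rightarrow> real" where
  "leaf_transition B B' t s = snd (the_inv_into (rect B') (chart B') (chart B (t, s)))"

definition transverse_measure ::
  "'m::metric_space set \<Rightarrow> (complex \<Rightarrow> 'm) \<Rightarrow> 'm set \<Rightarrow> ('m flow_box \<Rightarrow> real measure) \<Rightarrow> bool" where
  "transverse_measure M p S \<nu> \<longleftrightarrow>
     (\<forall>B. flow_box M p S B \<longrightarrow>
        sets (\<nu> B) = sets borel \<and> emeasure (\<nu> B) UNIV < \<infinity> \<and> emeasure (\<nu> B) (- leafset B) = 0) \<and>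
     (\<forall>B B' t A. flow_box M p S B \<and> flow_box M p S B' \<and> t \<in> {tmin B<..<tmax B} \<and>
        A \<in> sets borel \<and> A \<subseteq> leafset B \<and> (\<forall>s\<in>A. chart B (t, s) \<in> chart B' ` open_rect B') \<and>
        inj_on (leaf_transition B B' t) A \<and> leaf_transition B B' t ` A \<in> sets borel \<longrightarrow>
        emeasure (\<nu> B) A = emeasure (\<nu> B') (leaf_transition B B' t ` A))"

primrec Ck_on :: "nat \<Rightarrow> complex set \<Rightarrow> (complex \<Rightarrow> complex) \<Rightarrow> bool" where
  "Ck_on 0 S f \<longleftrightarrow> continuous_on S f"
| "Ck_on (Suc k) S f \<longleftrightarrow>
     (\<exists>fx fy. (\<forall>z\<in>S. (f has_derivative (\<lambda>h. of_real (Re h) * fx z + of_real (Im h) * fy z)) (at z)) \<and>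
              Ck_on k S fx \<and> Ck_on k S fy)"

definition smooth_on :: "complex set \<Rightarrow> (complex \<Rightarrow> complex) \<Rightarrow> bool" where
  "smooth_on S f \<longleftrightarrow> (\<forall>k. Ck_on k S f)"

text \<open>
  The 1-form \<open>P dx + Q dy\<close> on (an open subset of) the plane is encoded by the function
  \<open>\<eta> = P + i Q\<close>, so that \<open>\<eta>\<close> at \<open>z\<close> maps a tangent
  vector \<open>w\<close> to the inner product \<open>\<eta> z \<bullet> w\<close>.
\<close>
definition pullback :: "(complex \<Rightarrow> complex) \<Rightarrow> (complex \<Rightarrow> complex) \<Rightarrow> complex \<Rightarrow> complex" where
  "pullback g \<eta> z = cnj (deriv g z) * \<eta> (g z)"

text \<open>Smooth 1-forms on \<open>M\<close> are represented by their pullbacks under \<open>p\<close>.\<close>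
definition one_form :: "(complex \<Rightarrow> 'm) \<Rightarrow> (complex \<Rightarrow> complex) \<Rightarrow> bool" where
  "one_form p \<eta> \<longleftrightarrow>
     smooth_on uhp \<eta> \<and> (\<forall>z. z \<notin> uhp \<longrightarrow> \<eta> z = 0) \<and>
     (\<forall>g\<in>deck_group p. \<forall>z\<in>uhp. pullback g \<eta> z = \<eta> z)"

definition form_support :: "(complex \<Rightarrow> 'm::metric_space) \<Rightarrow> (complex \<Rightarrow> complex) \<Rightarrow> 'm set" where
  "form_support p \<eta> = closure (p ` {z \<in> uhp. \<eta> z \<noteq> 0})"

text \<open>
  The inner integral is that of the pullback of \<open>\<eta>\<close> under the chart of \<open>B\<close>
  along the plaque with parameter \<open>s\<close>; by invariance of \<open>\<eta>\<close> the choice of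
  the lift does not matter.
\<close>
definition box_current ::
  "(complex \<Rightarrow> 'm) \<Rightarrow> ('m flow_box \<Rightarrow> real measure) \<Rightarrow> 'm flow_box \<Rightarrow> (complex \<Rightarrow> complex) \<Rightarrow> real" where
  "box_current p \<nu> B \<eta> =
     (let G = (SOME G. chart_lift p B G) in
      LINT s:{smin B<..<smax B}|\<nu> B.
        integral {tmin B..tmax B}
          (\<lambda>t. \<eta> (G (t, s)) \<bullet> vector_derivative (\<lambda>\<tau>. G (\<tau>, s)) (at t within {tmin B..tmax B})))"

text \<open>
  The summand \<open>\<phi>0\<close> is the part of the form away from the lamination, on which the
  current, being extended by zero, vanishes.
\<close>
definition ruelle_sullivan_current ::
  "'m::metric_space set \<Rightarrow> (complex \<Rightarrow> 'm) \<Rightarrow> 'm set \<Rightarrow> 'm set set \<Rightarrow> ('m set \<Rightarrow> real \<Rightarrow> 'm)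
     \<Rightarrow> ('m flow_box \<Rightarrow> real measure) \<Rightarrow> ((complex \<Rightarrow> complex) \<Rightarrow> real) \<Rightarrow> bool" where
  "ruelle_sullivan_current M p S L dir \<nu> T \<longleftrightarrow>
     (\<forall>\<B> \<phi> \<phi>0 \<phi>s.
        finite \<B> \<and> (\<forall>B\<in>\<B>. oriented_flow_box M p S L dir B) \<and> S \<subseteq> (\<Union>B\<in>\<B>. chart B ` open_rect B) \<and>
        one_form p \<phi> \<and> one_form p \<phi>0 \<and> form_support p \<phi>0 \<inter> S = {} \<and>
        (\<forall>B\<in>\<B>. one_form p (\<phi>s B) \<and> form_support p (\<phi>s B) \<subseteq> chart B ` open_rect B) \<and>
        (\<forall>z. \<phi> z = \<phi>0 z + (\<Sum>B\<in>\<B>. \<phi>s B z))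
        \<longrightarrow> T \<phi> = (\<Sum>B\<in>\<B>. box_current p \<nu> B (\<phi>s B)))"

definition test_form :: "(complex \<Rightarrow> complex) \<Rightarrow> bool" where
  "test_form \<psi> \<longleftrightarrow>
     smooth_on UNIV \<psi> \<and> compact (closure {z. \<psi> z \<noteq> 0}) \<and> closure {z. \<psi> z \<noteq> 0} \<subseteq> uhp"

text \<open>\<open>d (P dx + Q dy) = (Q\<^sub>x - P\<^sub>y) dx dy\<close>\<close>
definition ext_deriv :: "(complex \<Rightarrow> complex) \<Rightarrow> complex \<Rightarrow> real" where
  "ext_deriv \<psi> z =
     Im (frechet_derivative \<psi> (at z) 1) - Re (frechet_derivative \<psi> (at z) \<i>)"

definition d_current :: "(complex \<Rightarrow> real) \<Rightarrow> (complex \<Rightarrow> complex) \<Rightarrow> real" where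
  "d_current v \<psi> = (LINT z:uhp|lebesgue. v z * ext_deriv \<psi> z)"

definition locally_integrable :: "(complex \<Rightarrow> real) \<Rightarrow> bool" where
  "locally_integrable v \<longleftrightarrow> (\<forall>C. compact C \<and> C \<subseteq> uhp \<longrightarrow> set_integrable lebesgue C v)"

text \<open>
  Vector-valued Radon measures on the upper half-plane are set functions on the relatively
  compact Borel subsets.
\<close>
definition rc_borel :: "complex set set" where
  "rc_borel = {B \<in> sets borel. \<exists>C. compact C \<and> C \<subseteq> uhp \<and> B \<subseteq> C}"

definition vector_measure :: "(complex set \<Rightarrow> complex) \<Rightarrow> bool" where
  "vector_measure D \<longleftrightarrow>
     (\<forall>A :: nat \<Rightarrow> complex set. disjoint_family A \<and> range A \<subseteq> rc_borel \<and> (\<Union>i. A i) \<in> rc_borel \<longrightarrow>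
        (\<lambda>i. D (A i)) sums D (\<Union>i. A i))"

text \<open>
  The vector measure \<open>D\<close> represents the current \<open>dv\<close>; it is given in polar
  form by its total variation \<open>\<mu>\<close> and a field \<open>\<sigma>\<close> of unit covectors.  In
  terms of the distributional partial derivatives, \<open>D = D\<^sub>y v - i D\<^sub>x v\<close>.
\<close>
definition differential_measure :: "(complex \<Rightarrow> real) \<Rightarrow> (complex set \<Rightarrow> complex) \<Rightarrow> bool" where
  "differential_measure v D \<longleftrightarrow>
     (\<exists>\<mu> \<sigma>. sets \<mu> = sets borel \<and>
        (\<forall>C. compact C \<and> C \<subseteq> uhp \<longrightarrow> emeasure \<mu> C < \<infinity>) \<and>
        \<sigma> \<in> borel_measurable borel \<and> (\<forall>z\<in>uhp. cmod (\<sigma> z) = 1) \<and>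
        (\<forall>\<psi>. test_form \<psi> \<longrightarrow> d_current v \<psi> = (LINT z:uhp|\<mu>. \<psi> z \<bullet> \<sigma> z)) \<and>
        (\<forall>B\<in>rc_borel. D B = (LINT z:B|\<mu>. \<sigma> z)))"

definition BV_loc :: "(complex \<Rightarrow> real) \<Rightarrow> bool" where
  "BV_loc v \<longleftrightarrow> locally_integrable v \<and> (\<exists>D. differential_measure v D)"

definition half_ball :: "complex \<Rightarrow> real \<Rightarrow> complex \<Rightarrow> complex set" where
  "half_ball z r n = {w \<in> ball z r. 0 < (w - z) \<bullet> n}"

definition approx_limit_along :: "(complex \<Rightarrow> real) \<Rightarrow> complex \<Rightarrow> complex \<Rightarrow> real \<Rightarrow> bool" where
  "approx_limit_along v z n a \<longleftrightarrow>
     ((\<lambda>r. (LINT w:half_ball z r n|lebesgue. \<bar>v w - a\<bar>) / measure lebesgue (half_ball z r n))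
        \<longlongrightarrow> 0) (at_right 0)"

definition jump_set :: "(complex \<Rightarrow> real) \<Rightarrow> complex set" where
  "jump_set v = {z \<in> uhp. \<exists>a b n. a \<noteq> b \<and> cmod n = 1 \<and>
     approx_limit_along v z n a \<and> approx_limit_along v z (- n) b}"

definition abs_continuous_vm :: "(complex set \<Rightarrow> complex) \<Rightarrow> bool" where
  "abs_continuous_vm D \<longleftrightarrow> (\<forall>B\<in>rc_borel. emeasure lborel B = 0 \<longrightarrow> D B = 0)"

definition concentrated_on :: "(complex set \<Rightarrow> complex) \<Rightarrow> complex set \<Rightarrow> bool" where
  "concentrated_on D N \<longleftrightarrow> (\<forall>B\<in>rc_borel. B \<inter> N = {} \<longrightarrow> D B = 0)"

definition singular_vm :: "(complex set \<Rightarrow> complex) \<Rightarrow> bool" where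
  "singular_vm D \<longleftrightarrow> (\<exists>N\<in>sets borel. emeasure lborel N = 0 \<and> concentrated_on D N)"

definition canonical_decomposition ::
  "(complex \<Rightarrow> real) \<Rightarrow> (complex set \<Rightarrow> complex) \<Rightarrow> (complex set \<Rightarrow> complex)
     \<Rightarrow> (complex set \<Rightarrow> complex) \<Rightarrow> (complex set \<Rightarrow> complex) \<Rightarrow> bool" where
  "canonical_decomposition v D D_ac D_jump D_cantor \<longleftrightarrow>
     differential_measure v D \<and>
     (\<exists>D_sing. vector_measure D_ac \<and> abs_continuous_vm D_ac \<and>
        vector_measure D_sing \<and> singular_vm D_sing \<and>
        (\<forall>B\<in>rc_borel. D B = D_ac B + D_sing B \<and>
           D_jump B = D_sing (B \<inter> jump_set v) \<and>
           D_cantor B = D_sing (B - jump_set v)))"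

definition pushforward :: "(complex \<Rightarrow> 'm) \<Rightarrow> (complex \<Rightarrow> complex) \<Rightarrow> complex \<Rightarrow> complex" where
  "pushforward p \<psi> z =
     (if z \<in> uhp then \<Sum>g\<in>{g \<in> deck_group p. \<psi> (g z) \<noteq> 0}. pullback g \<psi> z else 0)"

text \<open>
  A primitive is a section of a flat affine line bundle over \<open>M\<close>, given by a function on
  the universal cover that is equivariant for an action of the deck group by translations
  \<open>\<rho>\<close> (which is then a homomorphism).  The pullback of \<open>T\<close> to the universal
  cover is the current whose value at \<open>\<psi>\<close> is \<open>T (pushforward p \<psi>)\<close>.
\<close>
definition primitive :: "(complex \<Rightarrow> 'm) \<Rightarrow> ((complex \<Rightarrow> complex) \<Rightarrow> real) \<Rightarrow> (complex \<Rightarrow> real) \<Rightarrow> bool" where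
  "primitive p T v \<longleftrightarrow>
     BV_loc v \<and>
     (\<exists>\<rho>. \<forall>g\<in>deck_group p. AE z in lebesgue. z \<in> uhp \<longrightarrow> v (g z) = v z + \<rho> g) \<and>
     (\<forall>\<psi>. test_form \<psi> \<longrightarrow> d_current v \<psi> = T (pushforward p \<psi>))"

end

theory Submission
  imports Defs "HOL-Complex_Analysis.Complex_Analysis" "HOL-Real_Asymp.Real_Asymp"
begin

text \<open>
  Write \<open>P\<close> for the preimage of the lamination in the upper half-plane.  Everything about
  \<open>dv\<close> is read off from the Ruelle-Sullivan current, which vanishes on forms supported
  away from \<open>P\<close> and which, on a form supported in a flow box, is the integral over the
  leaf space, with respect to the transverse measure, of line integrals along plaques
  (\<open>current_in_box\<close>).

  No absolutely continuous part.  The total variation of \<open>dv\<close> is carried by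
  \<open>P\<close>.  A flow box is bi-Lipschitz and its leaf space has Hausdorff dimension 0, so
  \<open>P\<close> is a countable union of Lipschitz images of null sets \<open>[a, b] \<times> K\<close>
  and is Lebesgue null (\<open>lamination_preimage_negligible\<close>).  Thus \<open>dv\<close> equals
  its singular part, and the jump and Cantor parts are its restrictions to the jump set and to the
  complement of the jump set.

  The dichotomy for leaves.  By invariance of the transverse measure the mass of a plaque is constant
  along its leaf.  A leaf of positive mass is periodic: otherwise it would return to some flow
  box in infinitely many plaques of the same mass, and the leaf space of that box would have infinite
  measure (\<open>atom_imp_periodic\<close>).  A periodic leaf is a minimal lamination by itself, so it
  is one of the finitely many given components, and it is isolated because the others are closed
  (\<open>periodic_leaf_isolated\<close>).

  The jump set.  Let \<open>z \<in> P\<close>.  If \<open>v\<close> has one-sided approximate limits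
  \<open>a\<close> and \<open>b\<close> at \<open>z\<close>, then \<open>dv\<close> takes the value
  \<open>\<kappa> r (a - b) + o(r)\<close>, with \<open>\<kappa> \<noteq> 0\<close>, on a form of size 1 concentrated
  on the disc of radius \<open>2r\<close> around \<open>z\<close> (\<open>blow_up\<close>).  On the other
  hand the current of such a form is at most \<open>O(r)\<close> times the transverse measure of the
  plaques at distance \<open>O(r)\<close>.  If the plaque through \<open>z\<close> has mass 0, this is
  \<open>o(r)\<close>, so \<open>a = b\<close> and \<open>z\<close> is not a jump point.  If it has
  positive mass, then its leaf is isolated and \<open>v\<close> is constant on either side of it,
  because there its gradient vanishes; since plaques have tangents, the one-sided approximate
  limits exist (\<open>approx_limit_two_sides\<close>), and they differ because the current is at least
  \<open>c r\<close> on suitable forms.  So the jump set is the preimage of the closed isolated leaves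
  of positive mass.  This is the claim about the jump part.  For the Cantor part it remains to see
  that \<open>dv\<close> vanishes near a closed isolated leaf of mass 0; it does, since there the
  transverse measure vanishes.
\<close>

section \<open>Smooth functions of one variable\<close>

primrec Ck_real :: "nat \<Rightarrow> (real \<Rightarrow> real) \<Rightarrow> bool" where
  "Ck_real 0 f \<longleftrightarrow> continuous_on UNIV f"
| "Ck_real (Suc k) f \<longleftrightarrow> (\<exists>f'. (\<forall>x. (f has_real_derivative f' x) (at x)) \<and> Ck_real k f')"

definition smooth_real :: "(real \<Rightarrow> real) \<Rightarrow> bool" where
  "smooth_real f \<longleftrightarrow> (\<forall>k. Ck_real k f)"

lemma Ck_real_SucI:
  "Ck_real k f' \<Longrightarrow> (\<And>x. (f has_real_derivative f' x) (at x)) \<Longrightarrow> Ck_real (Suc k) f"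
  by auto

lemma Ck_real_SucD: "Ck_real (Suc k) f \<Longrightarrow> Ck_real k f"
proof (induction k arbitrary: f)
  case 0
  then obtain f' where "\<forall>x. (f has_real_derivative f' x) (at x)" by auto
  then have "\<forall>x. isCont f x" using DERIV_isCont by blast
  then show ?case by (simp add: continuous_at_imp_continuous_on)
next
  case (Suc k)
  from Suc.prems obtain f' where "\<forall>x. (f has_real_derivative f' x) (at x)" "Ck_real (Suc k) f'"
    by (subst (asm) Ck_real.simps) blast
  then show ?case using Suc.IH by auto
qed

lemma Ck_real_const: "Ck_real k (\<lambda>_. c)"
proof (induction k arbitrary: c)
  case (Suc k)
  show ?case using Suc[of 0] by (auto intro!: exI[of _ "\<lambda>_. 0"])
qed auto

lemma Ck_real_affine: "Ck_real k (\<lambda>x. a * x + b)"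
proof (cases k)
  case (Suc k)
  then show ?thesis using Ck_real_const[of k a] by (auto intro!: exI[of _ "\<lambda>_. a"] derivative_eq_intros)
qed (auto intro!: continuous_intros)

lemma Ck_real_add: "Ck_real k f \<Longrightarrow> Ck_real k g \<Longrightarrow> Ck_real k (\<lambda>x. f x + g x)"
proof (induction k arbitrary: f g)
  case 0 then show ?case by (auto intro!: continuous_intros)
next
  case (Suc k)
  then obtain f' g' where d: "\<forall>x. (f has_real_derivative f' x) (at x)" "Ck_real k f'"
    "\<forall>x. (g has_real_derivative g' x) (at x)" "Ck_real k g'" by auto
  then have "Ck_real k (\<lambda>x. f' x + g' x)" using Suc.IH by blast
  moreover have "((\<lambda>x. f x + g x) has_real_derivative f' x + g' x) (at x)" for x
    using d by (simp add: DERIV_add)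
  ultimately show ?case by (rule Ck_real_SucI)
qed

lemma Ck_real_mult: "Ck_real k f \<Longrightarrow> Ck_real k g \<Longrightarrow> Ck_real k (\<lambda>x. f x * g x)"
proof (induction k arbitrary: f g)
  case 0 then show ?case by (auto intro!: continuous_intros)
next
  case (Suc k)
  then obtain f' g' where d: "\<forall>x. (f has_real_derivative f' x) (at x)" "Ck_real k f'"
    "\<forall>x. (g has_real_derivative g' x) (at x)" "Ck_real k g'" by auto
  have "Ck_real k f" "Ck_real k g" using Suc.prems Ck_real_SucD by blast+
  then have "Ck_real k (\<lambda>x. f' x * g x + f x * g' x)"
    using d by (intro Ck_real_add Suc.IH)
  moreover have "((\<lambda>x. f x * g x) has_real_derivative f' x * g x + f x * g' x) (at x)" for x
    using d by (auto intro!: derivative_eq_intros)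
  ultimately show ?case by (rule Ck_real_SucI)
qed

lemma Ck_real_compose: "Ck_real k f \<Longrightarrow> Ck_real k g \<Longrightarrow> Ck_real k (\<lambda>x. f (g x))"
proof (induction k arbitrary: f g)
  case 0 then show ?case by (auto intro: continuous_on_compose2)
next
  case (Suc k)
  then obtain f' g' where d: "\<forall>x. (f has_real_derivative f' x) (at x)" "Ck_real k f'"
    "\<forall>x. (g has_real_derivative g' x) (at x)" "Ck_real k g'" by auto
  have "Ck_real k g" using Suc.prems Ck_real_SucD by blast
  then have "Ck_real k (\<lambda>x. f' (g x) * g' x)" using d by (blast intro: Ck_real_mult[OF Suc.IH])
  moreover have "((\<lambda>x. f (g x)) has_real_derivative f' (g x) * g' x) (at x)" for x
    using d DERIV_chain2 by blast
  ultimately show ?case by (rule Ck_real_SucI)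
qed

lemma Ck_real_exp: "Ck_real k exp"
  by (induction k) (auto intro!: continuous_intros exI[of _ exp] DERIV_exp)

text \<open>
  Each order of differentiability comes with its own derivative; uniqueness of derivatives makes them
  a single function.
\<close>
lemma smooth_real_derivative:
  assumes "smooth_real f"
  obtains f' where "\<And>x. (f has_real_derivative f' x) (at x)" "smooth_real f'"
proof -
  obtain f' where f': "\<forall>x. (f has_real_derivative f' x) (at x)"
    using assms unfolding smooth_real_def by (metis Ck_real.simps(2))
  have "Ck_real k f'" for k
  proof -
    obtain g where "\<forall>x. (f has_real_derivative g x) (at x)" "Ck_real k g"
      using assms unfolding smooth_real_def by (metis Ck_real.simps(2))
    moreover from this have "g = f'" using f' DERIV_unique by blast
    ultimately show ?thesis by simp
  qed
  then show ?thesis using that f' unfolding smooth_real_def by blast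
qed

lemma smooth_real_primitive:
  assumes "\<And>x. (F has_real_derivative f x) (at x)" "smooth_real f"
  shows "smooth_real F"
  unfolding smooth_real_def
proof
  fix k
  have "Ck_real (Suc k) F" using assms unfolding smooth_real_def by auto
  then show "Ck_real k F" by (rule Ck_real_SucD)
qed

lemma smooth_real_continuous: "smooth_real f \<Longrightarrow> continuous_on UNIV f"
  unfolding smooth_real_def by (metis Ck_real.simps(1))

text \<open>
The standard smooth function that is flat at the origin.
\<close>
definition flat :: "real \<Rightarrow> real" where
  "flat x = (if x > 0 then exp (- 1 / x) else 0)"

text \<open>
  The functions \<open>q(1/x) flat x\<close> with \<open>q\<close> a polynomial form a class that is
  closed under differentiation, which makes \<open>flat\<close> smooth: differentiation replaces
  \<open>q(y)\<close> by \<open>y\<^sup>2 (q(y) - q'(y))\<close>.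
\<close>
lemma flat_poly_derivative:
  fixes q :: "real poly"
  shows "((\<lambda>x. poly q (1 / x) * flat x) has_real_derivative
           poly (pCons 0 (pCons 0 (q - pderiv q))) (1 / x) * flat x) (at x)"
proof -
  have lim: "((\<lambda>h. poly r (1 / h) * exp (- 1 / h)) \<longlongrightarrow> 0) (at_right (0::real))" for r :: "real poly"
  proof -
    have "((\<lambda>y. y ^ k / exp y) \<longlongrightarrow> (0::real)) at_top" for k by (rule tendsto_power_div_exp_0)
    then have "((\<lambda>y. \<Sum>i\<le>degree r. coeff r i * (y ^ i / exp y)) \<longlongrightarrow> (\<Sum>i\<le>degree r. coeff r i * 0)) at_top"
      by (intro tendsto_intros)
    then have "((\<lambda>y. poly r y * exp (- y)) \<longlongrightarrow> 0) at_top"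
      by (simp add: poly_altdef sum_distrib_left exp_minus divide_inverse mult_ac)
    then have "((\<lambda>h. poly r (inverse h) * exp (- inverse h)) \<longlongrightarrow> 0) (at_right (0::real))"
      using filterlim_inverse_at_top_right by (rule filterlim_compose)
    then show ?thesis by (simp add: divide_inverse)
  qed
  consider "x > 0" | "x < 0" | "x = 0" by linarith
  then show ?thesis
  proof cases
    case 1
    have "((\<lambda>x. poly q (1 / x) * exp (- 1 / x)) has_real_derivative
           poly (pCons 0 (pCons 0 (q - pderiv q))) (1 / x) * flat x) (at x)"
      using 1 by (auto intro!: derivative_eq_intros simp: flat_def field_simps power2_eq_square)
    moreover have "\<forall>\<^sub>F y in nhds x. poly q (1 / y) * exp (- 1 / y) = poly q (1 / y) * flat y"
      using eventually_nhds_in_open[of "{0<..}" x] 1 by (auto simp: flat_def elim!: eventually_mono)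
    ultimately show ?thesis by (subst (asm) DERIV_cong_ev[OF refl _ refl]) auto
  next
    case 2
    have "((\<lambda>x. 0) has_real_derivative poly (pCons 0 (pCons 0 (q - pderiv q))) (1 / x) * flat x) (at x)"
      using 2 by (auto simp: flat_def)
    moreover have "\<forall>\<^sub>F y in nhds x. 0 = poly q (1 / y) * flat y"
      using eventually_nhds_in_open[of "{..<0}" x] 2 by (auto simp: flat_def elim!: eventually_mono)
    ultimately show ?thesis by (subst (asm) DERIV_cong_ev[OF refl _ refl]) auto
  next
    case 3
    have "((\<lambda>h. poly (pCons 0 q) (1 / h) * exp (- 1 / h)) \<longlongrightarrow> 0) (at_right (0::real))" by (rule lim)
    moreover have "\<forall>\<^sub>F h in at_right 0. poly (pCons 0 q) (1 / h) * exp (- 1 / h) = (poly q (1 / h) * flat h) / h"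
      by (rule eventually_at_right_less[THEN eventually_mono]) (auto simp: flat_def)
    ultimately have R: "((\<lambda>h. (poly q (1 / h) * flat h) / h) \<longlongrightarrow> 0) (at_right 0)"
      by (rule Lim_transform_eventually)
    have "\<forall>\<^sub>F h in at_left 0. (0::real) = (poly q (1 / h) * flat h) / h"
      unfolding eventually_at_left_field by (intro exI[of _ "-1"]) (auto simp: flat_def)
    then have L: "((\<lambda>h. (poly q (1 / h) * flat h) / h) \<longlongrightarrow> 0) (at_left 0)"
      by (rule Lim_transform_eventually[OF tendsto_const])
    have "((\<lambda>h. (poly q (1 / h) * flat h) / h) \<longlongrightarrow> 0) (at 0)"
      using L R by (simp add: filterlim_split_at)
    moreover have "flat 0 = 0" by (simp add: flat_def)
    ultimately show ?thesis using 3 by (simp add: DERIV_def)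
  qed
qed

lemma smooth_real_flat: "smooth_real flat"
proof -
  have "Ck_real k (\<lambda>x. poly q (1 / x) * flat x)" for k and q :: "real poly"
  proof (induction k arbitrary: q)
    case 0
    show ?case using DERIV_isCont[OF flat_poly_derivative] by (auto intro!: continuous_at_imp_continuous_on)
  next
    case (Suc k)
    show ?case by (rule Ck_real_SucI[OF Suc flat_poly_derivative])
  qed
  from this[of _ "[:1:]"] show ?thesis by (simp add: smooth_real_def)
qed

lemma has_real_derivative_flat: "(flat has_real_derivative (1 / x)\<^sup>2 * flat x) (at x)"
  using flat_poly_derivative[of "[:1:]" x] by (simp add: power2_eq_square)

lemma flat_pos: "x > 0 \<Longrightarrow> flat x > 0" and flat_zero: "x \<le> 0 \<Longrightarrow> flat x = 0" and flat_nonneg: "flat x \<ge> 0"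
  by (auto simp: flat_def)

lemma flat_le_1: "flat x \<le> 1" by (auto simp: flat_def)

text \<open>
Positive exactly on the interval from \<open>a\<close> to \<open>b\<close>.
\<close>
definition hump :: "real \<Rightarrow> real \<Rightarrow> real \<Rightarrow> real" where
  "hump a b x = flat (x - a) * flat (b - x)"

lemma smooth_real_hump: "smooth_real (hump a b)"
proof -
  have "Ck_real k (\<lambda>x. flat (1 * x + (-a)) * flat ((-1) * x + b))" for k
  proof -
    have flat: "Ck_real k flat" using smooth_real_flat by (simp add: smooth_real_def)
    show ?thesis
      by (rule Ck_real_mult[OF Ck_real_compose[OF flat Ck_real_affine] Ck_real_compose[OF flat Ck_real_affine]])
  qed
  moreover have "(\<lambda>x. flat (1 * x + (-a)) * flat ((-1) * x + b)) = hump a b"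
    by (auto simp: hump_def)
  ultimately show ?thesis unfolding smooth_real_def by simp
qed

lemma hump_nonneg: "hump a b x \<ge> 0" by (simp add: hump_def flat_nonneg)

lemma hump_pos_iff: "hump a b x > 0 \<longleftrightarrow> x \<in> {a<..<b}"
proof (cases "x \<in> {a<..<b}")
  case True
  then show ?thesis using flat_pos[of "x - a"] flat_pos[of "b - x"] by (simp add: hump_def)
next
  case False
  then have "hump a b x = 0" by (auto simp: hump_def flat_zero not_less)
  then show ?thesis using False by simp
qed

text \<open>
  Composing \<open>n hump\<close> with \<open>y \<mapsto> 1 - exp (-y)\<close> keeps the zeros and, as
  \<open>n\<close> grows, pushes all positive values to 1: smooth approximations of the indicator of
  the interval.
\<close>
definition plateau :: "real \<Rightarrow> real \<Rightarrow> nat \<Rightarrow> real \<Rightarrow> real" where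
  "plateau a b n x = 1 - exp (- real n * hump a b x)"

lemma smooth_real_plateau: "smooth_real (plateau a b n)"
proof -
  have "Ck_real k (\<lambda>x. (-1) * exp ((- real n) * hump a b x + 0) + 1)" for k
  proof -
    have hump: "Ck_real k (hump a b)" using smooth_real_hump by (simp add: smooth_real_def)
    show ?thesis
      by (rule Ck_real_compose[OF Ck_real_affine Ck_real_compose[OF Ck_real_exp
            Ck_real_compose[OF Ck_real_affine hump]]])
  qed
  moreover have "(\<lambda>x. (-1) * exp ((- real n) * hump a b x + 0) + 1) = plateau a b n"
    by (auto simp: plateau_def)
  ultimately show ?thesis unfolding smooth_real_def by simp
qed

lemma plateau_outside: "x \<notin> {a<..<b} \<Longrightarrow> plateau a b n x = 0"
  using hump_pos_iff[of a b x] hump_nonneg[of a b x] by (auto simp: plateau_def)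

lemma plateau_bounds: "0 \<le> plateau a b n x" "plateau a b n x \<le> 1"
  by (auto simp: plateau_def hump_nonneg)

lemma plateau_tendsto: "(\<lambda>n. plateau a b n x) \<longlonglongrightarrow> indicator {a<..<b} x"
proof (cases "x \<in> {a<..<b}")
  case True
  then have "hump a b x > 0" by (simp add: hump_pos_iff)
  then have "(\<lambda>n. 1 - exp (- real n * hump a b x)) \<longlonglongrightarrow> 1" by real_asymp
  then show ?thesis using True by (simp add: plateau_def)
next
  case False
  then show ?thesis by (simp add: plateau_outside)
qed

section \<open>Smooth functions of two variables\<close>

lemma Ck_on_SucI:
  "Ck_on k S fx \<Longrightarrow> Ck_on k S fy \<Longrightarrow>
    (\<And>z. z \<in> S \<Longrightarrow> (f has_derivative (\<lambda>h. of_real (Re h) * fx z + of_real (Im h) * fy z)) (at z)) \<Longrightarrow>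
    Ck_on (Suc k) S f"
  by auto

lemma Ck_on_SucE:
  assumes "Ck_on (Suc k) S f"
  obtains fx fy where
    "\<forall>z\<in>S. (f has_derivative (\<lambda>h. of_real (Re h) * fx z + of_real (Im h) * fy z)) (at z)"
    "Ck_on k S fx" "Ck_on k S fy"
  using assms by (simp only: Ck_on.simps) blast

lemma Ck_on_SucD: "Ck_on (Suc k) S f \<Longrightarrow> Ck_on k S f"
proof (induction k arbitrary: f)
  case 0
  then obtain fx fy where
    d: "\<forall>z\<in>S. (f has_derivative (\<lambda>h. of_real (Re h) * fx z + of_real (Im h) * fy z)) (at z)"
    and "Ck_on 0 S fx" "Ck_on 0 S fy"
    by (rule Ck_on_SucE)
  have "isCont f z" if "z \<in> S" for z by (rule has_derivative_continuous[OF d[rule_format, OF that]])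
  then show ?case by (simp add: continuous_at_imp_continuous_on)
next
  case (Suc k)
  from Suc.prems obtain fx fy where d:
    "\<forall>z\<in>S. (f has_derivative (\<lambda>h. of_real (Re h) * fx z + of_real (Im h) * fy z)) (at z)"
    "Ck_on (Suc k) S fx" "Ck_on (Suc k) S fy" by (rule Ck_on_SucE)
  show ?case by (rule Ck_on_SucI[OF Suc.IH[OF d(2)] Suc.IH[OF d(3)] d(1)[rule_format]])
qed

lemma Ck_on_cong:
  "open S \<Longrightarrow> (\<And>z. z \<in> S \<Longrightarrow> f z = g z) \<Longrightarrow> Ck_on k S f \<Longrightarrow> Ck_on k S g"
proof (induction k arbitrary: f g)
  case 0 then show ?case by (auto cong: continuous_on_cong)
next
  case (Suc k)
  from Suc.prems(3) obtain fx fy where d: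
    "\<forall>z\<in>S. (f has_derivative (\<lambda>h. of_real (Re h) * fx z + of_real (Im h) * fy z)) (at z)"
    "Ck_on k S fx" "Ck_on k S fy" by (rule Ck_on_SucE)
  have "(g has_derivative (\<lambda>h. of_real (Re h) * fx z + of_real (Im h) * fy z)) (at z)" if "z \<in> S" for z
    by (rule has_derivative_transform_within_open[OF d(1)[rule_format, OF that] Suc.prems(1) that Suc.prems(2)])
  then show ?case by (rule Ck_on_SucI[OF d(2,3)])
qed

text \<open>
  The partial derivatives on different neighbourhoods agree because they are values of the Frechet
  derivative, so they patch together.
\<close>
lemma Ck_on_local:
  assumes "\<And>z. z \<in> S \<Longrightarrow> \<exists>U. open U \<and> z \<in> U \<and> Ck_on k U f"
  shows "Ck_on k S f"
  using assms
proof (induction k arbitrary: f)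
  case 0
  have "isCont f z" if "z \<in> S" for z using 0[OF that] by (auto simp: continuous_on_eq_continuous_at)
  then show ?case by (simp add: continuous_at_imp_continuous_on)
next
  case (Suc k)
  define fx where "fx z = frechet_derivative f (at z) 1" for z
  define fy where "fy z = frechet_derivative f (at z) \<i>" for z
  have *: "\<exists>U. open U \<and> z \<in> U \<and> Ck_on k U fx \<and> Ck_on k U fy \<and>
      (f has_derivative (\<lambda>h. of_real (Re h) * fx z + of_real (Im h) * fy z)) (at z)" if "z \<in> S" for z
  proof -
    obtain U where U: "open U" "z \<in> U" and C: "Ck_on (Suc k) U f" using Suc.prems \<open>z \<in> S\<close> by blast
    from C obtain gx gy where
      g: "\<forall>z\<in>U. (f has_derivative (\<lambda>h. of_real (Re h) * gx z + of_real (Im h) * gy z)) (at z)"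
      "Ck_on k U gx" "Ck_on k U gy" by (rule Ck_on_SucE)
    have gf: "gx w = fx w \<and> gy w = fy w" if "w \<in> U" for w
      unfolding fx_def fy_def frechet_derivative_at[OF g(1)[rule_format, OF that], symmetric] by simp_all
    then have e: "gx z = fx z" "gy z = fy z" using U by auto
    have C: "Ck_on k U fx" "Ck_on k U fy"
      by (rule Ck_on_cong[OF U(1) _ g(2)], simp add: gf) (rule Ck_on_cong[OF U(1) _ g(3)], simp add: gf)
    show ?thesis by (intro exI[of _ U] conjI U C g(1)[rule_format, OF U(2), unfolded e])
  qed
  have "Ck_on k S fx" "Ck_on k S fy" by (rule Suc.IH, use * in metis)+
  then show ?case by (rule Ck_on_SucI) (use * in metis)
qed

lemma Ck_on_const: "Ck_on k S (\<lambda>_. c)"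
proof (induction k arbitrary: c)
  case (Suc k)
  show ?case using Suc[of 0] by (auto intro!: exI[of _ "\<lambda>_. 0"])
qed auto

lemma Ck_on_add: "Ck_on k S f \<Longrightarrow> Ck_on k S g \<Longrightarrow> Ck_on k S (\<lambda>x. f x + g x)"
proof (induction k arbitrary: f g)
  case 0 then show ?case by (auto intro!: continuous_intros)
next
  case (Suc k)
  from Suc.prems(1) obtain fx fy where df:
    "\<forall>z\<in>S. (f has_derivative (\<lambda>h. of_real (Re h) * fx z + of_real (Im h) * fy z)) (at z)"
    "Ck_on k S fx" "Ck_on k S fy" by (rule Ck_on_SucE)
  from Suc.prems(2) obtain gx gy where dg:
    "\<forall>z\<in>S. (g has_derivative (\<lambda>h. of_real (Re h) * gx z + of_real (Im h) * gy z)) (at z)"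
    "Ck_on k S gx" "Ck_on k S gy" by (rule Ck_on_SucE)
  have "Ck_on k S (\<lambda>z. fx z + gx z)" "Ck_on k S (\<lambda>z. fy z + gy z)"
    by (rule Suc.IH; fact)+
  moreover have "((\<lambda>x. f x + g x) has_derivative (\<lambda>h. of_real (Re h) * (fx z + gx z) + of_real (Im h) * (fy z + gy z))) (at z)"
    if "z \<in> S" for z
    by (rule has_derivative_eq_rhs[OF has_derivative_add[OF df(1)[rule_format, OF that] dg(1)[rule_format, OF that]]])
      (auto simp: algebra_simps)
  ultimately show ?case by (rule Ck_on_SucI)
qed

lemma Ck_on_mult: "Ck_on k S f \<Longrightarrow> Ck_on k S g \<Longrightarrow> Ck_on k S (\<lambda>x. f x * g x)"
proof (induction k arbitrary: f g)
  case 0 then show ?case by (auto intro!: continuous_intros)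
next
  case (Suc k)
  from Suc.prems(1) obtain fx fy where df:
    "\<forall>z\<in>S. (f has_derivative (\<lambda>h. of_real (Re h) * fx z + of_real (Im h) * fy z)) (at z)"
    "Ck_on k S fx" "Ck_on k S fy" by (rule Ck_on_SucE)
  from Suc.prems(2) obtain gx gy where dg:
    "\<forall>z\<in>S. (g has_derivative (\<lambda>h. of_real (Re h) * gx z + of_real (Im h) * gy z)) (at z)"
    "Ck_on k S gx" "Ck_on k S gy" by (rule Ck_on_SucE)
  have k: "Ck_on k S f" "Ck_on k S g" using Suc.prems Ck_on_SucD by blast+
  have "Ck_on k S (\<lambda>z. f z * gx z + fx z * g z)" "Ck_on k S (\<lambda>z. f z * gy z + fy z * g z)"
    by (rule Ck_on_add; rule Suc.IH; fact)+
  moreover have "((\<lambda>x. f x * g x) has_derivative (\<lambda>h. of_real (Re h) * (f z * gx z + fx z * g z) +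
          of_real (Im h) * (f z * gy z + fy z * g z))) (at z)" if "z \<in> S" for z
    by (rule has_derivative_eq_rhs[OF has_derivative_mult[OF df(1)[rule_format, OF that] dg(1)[rule_format, OF that]]])
      (auto simp: algebra_simps)
  ultimately show ?case by (rule Ck_on_SucI)
qed

lemma Ck_on_linear:
  assumes "bounded_linear A" "Ck_on k S f"
  shows "Ck_on k S (\<lambda>x. A (f x))"
  using assms(2)
proof (induction k arbitrary: f)
  case 0 then show ?case
    by (auto intro: bounded_linear.continuous_on[OF assms(1)])
next
  case (Suc k)
  from Suc.prems(1) obtain fx fy where d:
    "\<forall>z\<in>S. (f has_derivative (\<lambda>h. of_real (Re h) * fx z + of_real (Im h) * fy z)) (at z)"
    "Ck_on k S fx" "Ck_on k S fy" by (rule Ck_on_SucE)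
  have A: "A (of_real a * x + of_real b * y) = of_real a * A x + of_real b * A y" for a b x y
    using bounded_linear.linear[OF assms(1)] by (simp add: linear_add linear_scale flip: scaleR_conv_of_real)
  have "Ck_on k S (\<lambda>z. A (fx z))" "Ck_on k S (\<lambda>z. A (fy z))"
    by (rule Suc.IH[OF d(2)], rule Suc.IH[OF d(3)])
  moreover have "((\<lambda>x. A (f x)) has_derivative (\<lambda>h. of_real (Re h) * A (fx z) + of_real (Im h) * A (fy z))) (at z)"
    if "z \<in> S" for z
    by (rule has_derivative_eq_rhs[OF bounded_linear.has_derivative[OF assms(1) d(1)[rule_format, OF that]]])
      (simp add: A)
  ultimately show ?case by (rule Ck_on_SucI)
qed

lemma Ck_on_holomorphic: "open S \<Longrightarrow> h holomorphic_on S \<Longrightarrow> Ck_on k S h"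
proof (induction k arbitrary: h)
  case 0 then show ?case by (auto intro: holomorphic_on_imp_continuous_on)
next
  case (Suc k)
  have "Ck_on k S (deriv h)" "Ck_on k S (\<lambda>z. \<i> * deriv h z)"
    using Suc by (auto intro!: Suc.IH holomorphic_intros)
  moreover have "(h has_derivative (\<lambda>w. of_real (Re w) * deriv h z + of_real (Im w) * (\<i> * deriv h z))) (at z)"
    if "z \<in> S" for z
  proof -
    have "(h has_field_derivative deriv h z) (at z)"
      using Suc.prems that by (simp add: holomorphic_derivI)
    then have "(h has_derivative (*) (deriv h z)) (at z)" by (simp add: has_field_derivative_def)
    moreover have "(*) (deriv h z) = (\<lambda>w. of_real (Re w) * deriv h z + of_real (Im w) * (\<i> * deriv h z))"
      by (auto simp: fun_eq_iff complex_eq_iff algebra_simps)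
    ultimately show ?thesis by simp
  qed
  ultimately show ?case by (rule Ck_on_SucI)
qed

lemma Ck_on_compose_holomorphic:
  assumes "open U" "g holomorphic_on U" "g ` U \<subseteq> S" "Ck_on k S f"
  shows "Ck_on k U (\<lambda>z. f (g z))"
  using assms(4)
proof (induction k arbitrary: f)
  case 0 then show ?case
    using assms(2,3) by (auto intro: continuous_on_compose2 holomorphic_on_imp_continuous_on)
next
  case (Suc k)
  from Suc.prems(1) obtain fx fy where d:
    "\<forall>z\<in>S. (f has_derivative (\<lambda>h. of_real (Re h) * fx z + of_real (Im h) * fy z)) (at z)"
    "Ck_on k S fx" "Ck_on k S fy" by (rule Ck_on_SucE)
  have dg: "Ck_on k U (deriv g)" using assms by (auto intro!: Ck_on_holomorphic holomorphic_intros)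
  have Re': "bounded_linear (\<lambda>w. complex_of_real (Re w))" and Im': "bounded_linear (\<lambda>w. complex_of_real (Im w))"
    by (intro bounded_linear_compose[OF bounded_linear_of_real] bounded_linear_Re bounded_linear_Im)+
  let ?gx = "\<lambda>z. of_real (Re (deriv g z)) * fx (g z) + of_real (Im (deriv g z)) * fy (g z)"
  let ?gy = "\<lambda>z. of_real (- Im (deriv g z)) * fx (g z) + of_real (Re (deriv g z)) * fy (g z)"
  have "Ck_on k U ?gx"
    by (rule Ck_on_add[OF Ck_on_mult[OF Ck_on_linear[OF Re' dg] Suc.IH[OF d(2)]]
          Ck_on_mult[OF Ck_on_linear[OF Im' dg] Suc.IH[OF d(3)]]])
  moreover have "Ck_on k U ?gy"
    using Ck_on_add[OF Ck_on_mult[OF Ck_on_linear[OF bounded_linear_minus[OF Im'] dg] Suc.IH[OF d(2)]]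
          Ck_on_mult[OF Ck_on_linear[OF Re' dg] Suc.IH[OF d(3)]]] by simp
  moreover have "((\<lambda>z. f (g z)) has_derivative (\<lambda>h. of_real (Re h) * ?gx z + of_real (Im h) * ?gy z)) (at z)"
    if "z \<in> U" for z
  proof -
    have "(g has_derivative (*) (deriv g z)) (at z)"
      using assms that by (simp add: holomorphic_derivI flip: has_field_derivative_def)
    moreover have "(f has_derivative (\<lambda>h. of_real (Re h) * fx (g z) + of_real (Im h) * fy (g z))) (at (g z))"
      by (rule d(1)[rule_format]) (use that assms in blast)
    ultimately show ?thesis
      by (rule has_derivative_eq_rhs[OF has_derivative_compose]) (auto simp: algebra_simps)
  qed
  ultimately show ?case by (rule Ck_on_SucI)
qed

lemma has_derivative_product:
  fixes n m z \<zeta> :: complex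
  assumes "\<And>x. (u has_real_derivative u' x) (at x)" "\<And>x. (w has_real_derivative w' x) (at x)"
  shows "((\<lambda>z. of_real (u (z \<bullet> n) * w (z \<bullet> m)) * \<zeta>) has_derivative
     (\<lambda>h. of_real ((h \<bullet> n) * (u' (z \<bullet> n) * w (z \<bullet> m)) + (h \<bullet> m) * (u (z \<bullet> n) * w' (z \<bullet> m))) * \<zeta>)) (at z)"
proof -
  have u: "((\<lambda>z. u (z \<bullet> n)) has_derivative (\<lambda>h. (h \<bullet> n) * u' (z \<bullet> n))) (at z)"
    by (rule has_derivative_eq_rhs[OF has_derivative_compose[OF _ assms(1)[unfolded has_field_derivative_def]]])
       (auto intro!: derivative_eq_intros)
  have w: "((\<lambda>z. w (z \<bullet> m)) has_derivative (\<lambda>h. (h \<bullet> m) * w' (z \<bullet> m))) (at z)"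
    by (rule has_derivative_eq_rhs[OF has_derivative_compose[OF _ assms(2)[unfolded has_field_derivative_def]]])
       (auto intro!: derivative_eq_intros)
  show ?thesis
    by (rule has_derivative_eq_rhs[OF has_derivative_mult_left[OF has_derivative_of_real[OF has_derivative_mult[OF u w]]]])
       (auto simp: algebra_simps)
qed

text \<open>
  Functions \<open>u(z \<bullet> n) w(z \<bullet> m)\<close> are the only test functions that are
  evaluated below: with \<open>n = 1\<close>, \<open>m = \<i>\<close> they separate the two coordinates,
  and with a rotated frame they are adapted to the direction of a leaf.
\<close>
lemma Ck_on_product:
  assumes "smooth_real u" "smooth_real w"
  shows "Ck_on k S (\<lambda>z. of_real (u (z \<bullet> n) * w (z \<bullet> m)) * \<zeta>)"
  using assms
proof (induction k arbitrary: u w)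
  case 0
  then have "continuous_on UNIV u" "continuous_on UNIV w" by (auto intro: smooth_real_continuous)
  then show ?case
    by (auto intro!: continuous_intros intro: continuous_on_compose2)
next
  case (Suc k)
  obtain u' where u': "\<And>x. (u has_real_derivative u' x) (at x)" "smooth_real u'"
    using Suc.prems by (auto elim: smooth_real_derivative)
  obtain w' where w': "\<And>x. (w has_real_derivative w' x) (at x)" "smooth_real w'"
    using Suc.prems by (auto elim: smooth_real_derivative)
  let ?f = "\<lambda>c d z. of_real c * (of_real (u' (z \<bullet> n) * w (z \<bullet> m)) * \<zeta>) + of_real d * (of_real (u (z \<bullet> n) * w' (z \<bullet> m)) * \<zeta>)"
  have f: "Ck_on k S (?f c d)" for c d
    by (rule Ck_on_add[OF Ck_on_mult[OF Ck_on_const Suc.IH[OF u'(2) Suc.prems(2)]]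
          Ck_on_mult[OF Ck_on_const Suc.IH[OF Suc.prems(1) w'(2)]]])
  have "Ck_on k S (?f (Re n) (Re m))" "Ck_on k S (?f (Im n) (Im m))" by (rule f)+
  moreover have "((\<lambda>z. of_real (u (z \<bullet> n) * w (z \<bullet> m)) * \<zeta>) has_derivative
     (\<lambda>h. of_real (Re h) * ?f (Re n) (Re m) z + of_real (Im h) * ?f (Im n) (Im m) z)) (at z)" for z
    by (rule has_derivative_eq_rhs[OF has_derivative_product[OF u'(1) w'(1)]])
      (auto simp: inner_complex_def algebra_simps)
  ultimately show ?case by (rule Ck_on_SucI)
qed

section \<open>Measures and functions tested against smooth forms\<close>

lemma test_formI:
  assumes "\<And>k. Ck_on k UNIV \<psi>" "\<And>z. z \<notin> C \<Longrightarrow> \<psi> z = 0" "compact C" "C \<subseteq> uhp"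
  shows "test_form \<psi>" "closure {z. \<psi> z \<noteq> 0} \<subseteq> C"
proof -
  have "{z. \<psi> z \<noteq> 0} \<subseteq> C" using assms(2) by blast
  then show C: "closure {z. \<psi> z \<noteq> 0} \<subseteq> C" using assms(3) by (simp add: closure_minimal compact_imp_closed)
  then have "compact (closure {z. \<psi> z \<noteq> 0})"
    using assms(3) by (meson bounded_subset closed_closure compact_eq_bounded_closed)
  then show "test_form \<psi>" using assms(1,4) C by (auto simp: test_form_def smooth_on_def)
qed

lemma ext_deriv_product:
  fixes n m z \<zeta> :: complex
  assumes "\<And>x. (u has_real_derivative u' x) (at x)" "\<And>x. (w has_real_derivative w' x) (at x)"
  shows "ext_deriv (\<lambda>z. of_real (u (z \<bullet> n) * w (z \<bullet> m)) * \<zeta>) z =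
     u' (z \<bullet> n) * w (z \<bullet> m) * Im (cnj n * \<zeta>) + u (z \<bullet> n) * w' (z \<bullet> m) * Im (cnj m * \<zeta>)"
  unfolding ext_deriv_def frechet_derivative_at[OF has_derivative_product[OF assms], symmetric]
  by (simp add: inner_complex_def algebra_simps)

text \<open>
  The sets on which the integral vanishes form a Dynkin system containing the boxes, so they are all
  Borel sets; apply this to the sets where \<open>f\<close> is positive and where it is negative.
\<close>
lemma AE_zero_of_box_integrals:
  fixes f :: "complex \<Rightarrow> real"
  assumes M: "sets M = sets borel"
    and int: "set_integrable M (cbox a b) f"
    and zero: "\<And>c d. box c d \<subseteq> box a b \<Longrightarrow> (LINT z:box c d|M. f z) = 0"
  shows "AE z in M. z \<in> box a b \<longrightarrow> f z = 0"
proof -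
  have [measurable_cong]: "sets M = sets borel" by (rule M)
  have int': "set_integrable M (box a b) f"
    by (rule set_integrable_subset[OF int]) (auto simp: M box_subset_cbox)
  define g where "g z = indicator (box a b) z * f z" for z
  have g: "integrable M g" using int' by (simp add: set_integrable_def g_def[abs_def])
  have gA: "integrable M (\<lambda>z. indicator A z * g z)" if "A \<in> sets borel" for A
    using integrable_mult_indicator[OF _ g, of A] that by (simp add: M)
  have Z: "(\<integral>z. indicator A z * g z \<partial>M) = 0" if "A \<in> sets borel" for A
  proof -
    have "Int_stable (range (\<lambda>(a, b). box a b :: complex set))"
      by (auto simp: Int_stable_def box_Int_box)
    moreover have "range (\<lambda>(a, b). box a b :: complex set) \<subseteq> Pow UNIV" by auto
    moreover have "A \<in> sigma_sets UNIV (range (\<lambda>(a, b). box a b))"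
      using that by (simp add: borel_eq_box)
    ultimately show ?thesis
    proof (induction rule: sigma_sets_induct_disjoint)
      case (basic A)
      then obtain c d where A: "A = box c d" by auto
      obtain c' d' where "box c d \<inter> box a b = box c' d'" using box_Int_box by blast
      moreover have "indicator A z * g z = indicator (box c d \<inter> box a b) z * f z" for z
        by (simp add: A g_def split: split_indicator)
      moreover have "box c' d' \<subseteq> box a b" using calculation(1) by blast
      ultimately show ?case using zero[of c' d'] by (simp add: set_lebesgue_integral_def)
    next
      case empty then show ?case by simp
    next
      case (compl A)
      then have A: "A \<in> sets borel" by (simp add: borel_eq_box)
      have "indicator (UNIV - A) z * g z = g z - indicator A z * g z" for z
        by (simp split: split_indicator)
      moreover have "(\<integral>z. g z \<partial>M) = 0"
        using zero[of a b] by (simp add: g_def[abs_def] set_lebesgue_integral_def)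
      ultimately show ?case using compl g gA[OF A] by simp
    next
      case (union A)
      then have A: "A i \<in> sets borel" for i by (auto simp: borel_eq_box)
      have "(\<integral>z. indicator (\<Union>i. A i) z *\<^sub>R g z \<partial>M) = (\<Sum>i. (LINT z:A i|M. g z))"
        unfolding set_lebesgue_integral_def[symmetric]
        by (rule lebesgue_integral_countable_add)
          (use A union(1) gA[of "\<Union>i. A i"] in \<open>auto simp: disjoint_family_on_def set_integrable_def M\<close>)
      then show ?case using union by (simp add: set_lebesgue_integral_def)
    qed
  qed
  have meas: "g \<in> borel_measurable borel" using g M by (metis borel_measurable_integrable measurable_cong_sets)
  have "AE z in M. indicator {z. g z > 0} z * g z = 0"
  proof (rule integral_nonneg_eq_0_iff_AE[THEN iffD1])
    show "integrable M (\<lambda>z. indicator {z. g z > 0} z * g z)" by (rule gA) (use meas in measurable)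
    show "(\<integral>z. indicator {z. g z > 0} z * g z \<partial>M) = 0" by (rule Z) (use meas in measurable)
  qed (auto split: split_indicator)
  moreover have "AE z in M. - (indicator {z. g z < 0} z * g z) = 0"
  proof (rule integral_nonneg_eq_0_iff_AE[THEN iffD1])
    show "integrable M (\<lambda>z. - (indicator {z. g z < 0} z * g z))" by (intro integrable_minus gA) (use meas in measurable)
    show "(\<integral>z. - (indicator {z. g z < 0} z * g z) \<partial>M) = 0"
      using Z[of "{z. g z < 0}"] meas by simp
  qed (auto split: split_indicator)
  ultimately show ?thesis
    by eventually_elim (auto simp: g_def split: split_indicator_asm)
qed

text \<open>
By the Lindelof property countably many of the given neighbourhoods suffice.
\<close>
lemma AE_open_of_local:
  fixes V :: "complex set"
  assumes "open V" and loc: "\<And>z. z \<in> V \<Longrightarrow> \<exists>U. open U \<and> z \<in> U \<and> (AE w in M. w \<in> U \<longrightarrow> P w)"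
  shows "AE w in M. w \<in> V \<longrightarrow> P w"
proof -
  define F where "F = {U. open U \<and> (AE w in M. w \<in> U \<longrightarrow> P w)}"
  obtain F' where F': "F' \<subseteq> F" "countable F'" "\<Union>F' = \<Union>F"
    by (rule Lindelof[of F]) (auto simp: F_def)
  have "\<forall>U\<in>F'. AE w in M. w \<in> U \<longrightarrow> P w" using F' by (auto simp: F_def)
  then have "AE w in M. \<forall>U\<in>F'. w \<in> U \<longrightarrow> P w" using F'(2) by (subst AE_ball_countable) auto
  moreover have V: "V \<subseteq> \<Union>F'"
  proof
    fix z assume "z \<in> V"
    with loc obtain U where "U \<in> F" "z \<in> U" unfolding F_def by auto
    then show "z \<in> \<Union>F'" unfolding F'(3) by blast
  qed
  ultimately show ?thesis by (eventually_elim) (use V in \<open>meson UnionE subsetD\<close>)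
qed

lemma inner_one_ii [simp]: "z \<bullet> (1::complex) = Re z" "z \<bullet> \<i> = Im z"
  by (auto simp: inner_complex_def)

lemma plateau_product_convergence:
  fixes f :: "complex \<Rightarrow> real"
  assumes M: "sets M = sets borel" and int: "set_integrable M (cbox a b) f"
  shows "(\<lambda>n. \<integral>z. plateau (Re a) (Re b) n (Re z) * plateau (Im a) (Im b) n (Im z) * f z \<partial>M)
     \<longlonglongrightarrow> (LINT z:box a b|M. f z)"
proof -
  have [measurable_cong]: "sets M = sets borel" by (rule M)
  define g where "g z = indicator (cbox a b) z * f z" for z
  have g: "integrable M g" using int by (simp add: set_integrable_def g_def[abs_def])
  have cont: "continuous_on UNIV (plateau c d n)" for c d n
    by (rule smooth_real_continuous[OF smooth_real_plateau])
  have [measurable]: "plateau c d n \<in> borel_measurable borel" for c d n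
    using cont borel_measurable_continuous_onI by blast
  have eq: "plateau (Re a) (Re b) n (Re z) * plateau (Im a) (Im b) n (Im z) * f z =
    plateau (Re a) (Re b) n (Re z) * plateau (Im a) (Im b) n (Im z) * g z" for n z
    by (cases "z \<in> cbox a b") (auto simp: g_def in_cbox_complex_iff plateau_outside)
  have "(\<lambda>n. \<integral>z. plateau (Re a) (Re b) n (Re z) * plateau (Im a) (Im b) n (Im z) * g z \<partial>M)
     \<longlonglongrightarrow> (\<integral>z. indicator (box a b) z * g z \<partial>M)"
  proof (rule integral_dominated_convergence[where w = "\<lambda>z. \<bar>g z\<bar>"])
    show "AE z in M. (\<lambda>n. plateau (Re a) (Re b) n (Re z) * plateau (Im a) (Im b) n (Im z) * g z)
        \<longlonglongrightarrow> indicator (box a b) z * g z"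
    proof (rule AE_I2)
      fix z
      have "indicator (box a b) z = indicator {Re a<..<Re b} (Re z) * (indicator {Im a<..<Im b} (Im z) :: real)"
        by (auto simp: in_box_complex_iff split: split_indicator)
      then show "(\<lambda>n. plateau (Re a) (Re b) n (Re z) * plateau (Im a) (Im b) n (Im z) * g z)
        \<longlonglongrightarrow> indicator (box a b) z * g z"
        by (auto intro!: tendsto_intros plateau_tendsto)
    qed
    show "AE z in M. norm (plateau (Re a) (Re b) n (Re z) * plateau (Im a) (Im b) n (Im z) * g z) \<le> \<bar>g z\<bar>" for n
      using plateau_bounds by (intro AE_I2) (auto simp: abs_mult intro!: mult_left_le_one_le mult_le_one)
    show "(\<lambda>z. plateau (Re a) (Re b) n (Re z) * plateau (Im a) (Im b) n (Im z) * g z) \<in> borel_measurable M" for n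
      using borel_measurable_integrable[OF g] by measurable
    show "(\<lambda>z. indicator (box a b) z * g z) \<in> borel_measurable M"
      using borel_measurable_integrable[OF g] by measurable
  qed (use g in auto)
  moreover have "indicator (box a b) z * g z = indicator (box a b) z * f z" for z
    using box_subset_cbox[of a b] by (auto simp: g_def split: split_indicator)
  ultimately show ?thesis by (simp only: eq set_lebesgue_integral_def real_scaleR_def)
qed

lemma test_form_plateau_product:
  assumes "cbox a b \<subseteq> uhp" "smooth_real u" "smooth_real w"
    "\<And>x. x \<notin> {Re a<..<Re b} \<Longrightarrow> u x = 0" "\<And>x. x \<notin> {Im a<..<Im b} \<Longrightarrow> w x = 0"
  shows "test_form (\<lambda>z. of_real (u (Re z) * w (Im z)) * \<zeta>)"
    and "closure {z. of_real (u (Re z) * w (Im z)) * \<zeta> \<noteq> 0} \<subseteq> cbox a b"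
proof -
  have *: "Ck_on k UNIV (\<lambda>z. of_real (u (Re z) * w (Im z)) * \<zeta>)" for k
    using Ck_on_product[OF assms(2,3), of k UNIV 1 \<i> \<zeta>] by simp
  have **: "of_real (u (Re z) * w (Im z)) * \<zeta> = 0" if "z \<notin> cbox a b" for z
    using that assms(4)[of "Re z"] assms(5)[of "Im z"] by (force simp: in_cbox_complex_iff)
  show "test_form (\<lambda>z. of_real (u (Re z) * w (Im z)) * \<zeta>)"
    "closure {z. of_real (u (Re z) * w (Im z)) * \<zeta> \<noteq> 0} \<subseteq> cbox a b"
    by (rule test_formI[OF * ** compact_cbox assms(1)], assumption)+
qed

text \<open>
  Plateaus converge to indicators of boxes, so the vector measure \<open>\<sigma> d\<mu>\<close> vanishes on all
  boxes in \<open>V\<close> and \<open>\<sigma> = 0\<close> almost everywhere there.  As \<open>\<sigma>\<close>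
  has length 1, this leaves no mass.
\<close>
lemma measure_zero_of_test_forms:
  assumes M: "sets \<mu> = sets borel" and fin: "\<And>C. compact C \<Longrightarrow> C \<subseteq> uhp \<Longrightarrow> emeasure \<mu> C < \<infinity>"
    and \<sigma>: "\<sigma> \<in> borel_measurable borel" and \<sigma>1: "\<And>z. z \<in> uhp \<Longrightarrow> cmod (\<sigma> z) = 1"
    and V: "open V" "V \<subseteq> uhp"
    and zero: "\<And>\<psi>. test_form \<psi> \<Longrightarrow> closure {z. \<psi> z \<noteq> 0} \<subseteq> V \<Longrightarrow> (LINT z:uhp|\<mu>. \<psi> z \<bullet> \<sigma> z) = 0"
  shows "AE z in \<mu>. z \<notin> V"
proof -
  have [measurable_cong]: "sets \<mu> = sets borel" by (rule M)
  have [measurable]: "\<sigma> \<in> borel_measurable borel" by (rule \<sigma>)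
  have box: "AE z in \<mu>. z \<in> box a b \<longrightarrow> \<zeta> \<bullet> \<sigma> z = 0" if ab: "cbox a b \<subseteq> V" for a b \<zeta>
  proof (rule AE_zero_of_box_integrals[OF M])
    have sub: "set_integrable \<mu> (cbox c d) (\<lambda>z. \<zeta> \<bullet> \<sigma> z)" if "cbox c d \<subseteq> V" for c d
      unfolding set_integrable_def
    proof (rule integrableI_bounded_set_indicator[where B = "cmod \<zeta>"])
      show "AE x in \<mu>. x \<in> cbox c d \<longrightarrow> norm (\<zeta> \<bullet> \<sigma> x) \<le> cmod \<zeta>"
        using that V(2) by (intro AE_I2) (metis Cauchy_Schwarz_ineq2 \<sigma>1 in_mono mult.right_neutral real_norm_def)
      show "emeasure \<mu> (cbox c d) < \<infinity>" using that V by (intro fin) auto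
    qed (auto simp: M)
    then show "set_integrable \<mu> (cbox a b) (\<lambda>z. \<zeta> \<bullet> \<sigma> z)" using ab by blast
    fix c d :: complex assume cd: "box c d \<subseteq> box a b"
    show "(LINT z:box c d|\<mu>. \<zeta> \<bullet> \<sigma> z) = 0"
    proof (cases "box c d = {}")
      case False
      then have "cbox c d \<subseteq> cbox a b" using cd by (metis closure_box closure_minimal closed_cbox box_subset_cbox order_trans)
      then have cdV: "cbox c d \<subseteq> V" using ab by blast
      have "(\<integral>z. plateau (Re c) (Re d) n (Re z) * plateau (Im c) (Im d) n (Im z) * (\<zeta> \<bullet> \<sigma> z) \<partial>\<mu>) = 0" for n
      proof -
        let ?\<psi> = "\<lambda>z. of_real (plateau (Re c) (Re d) n (Re z) * plateau (Im c) (Im d) n (Im z)) * \<zeta>"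
        have t: "test_form ?\<psi>" "closure {z. ?\<psi> z \<noteq> 0} \<subseteq> cbox c d"
          by (rule test_form_plateau_product; use cdV V smooth_real_plateau plateau_outside in blast)+
        have "(LINT z:uhp|\<mu>. ?\<psi> z \<bullet> \<sigma> z) = 0" by (rule zero) (use t cdV in auto)
        moreover have "indicator uhp z *\<^sub>R (?\<psi> z \<bullet> \<sigma> z) =
          plateau (Re c) (Re d) n (Re z) * plateau (Im c) (Im d) n (Im z) * (\<zeta> \<bullet> \<sigma> z)" for z
        proof -
          have "?\<psi> z \<bullet> \<sigma> z = plateau (Re c) (Re d) n (Re z) * plateau (Im c) (Im d) n (Im z) * (\<zeta> \<bullet> \<sigma> z)"
            by (simp only: scaleR_conv_of_real[symmetric] inner_scaleR_left)
          moreover have "?\<psi> z = 0" if "z \<notin> uhp"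
            using t(2) that cdV V(2) closure_subset[of "{z. ?\<psi> z \<noteq> 0}"] by blast
          ultimately show ?thesis by (auto split: split_indicator)
        qed
        ultimately show ?thesis by (simp add: set_lebesgue_integral_def)
      qed
      then have "(\<lambda>n. 0) \<longlonglongrightarrow> (LINT z:box c d|\<mu>. \<zeta> \<bullet> \<sigma> z)"
        using plateau_product_convergence[OF M sub[OF cdV]] by simp
      then show ?thesis using LIMSEQ_unique tendsto_const by blast
    qed (simp add: set_lebesgue_integral_def)
  qed
  have "AE z in \<mu>. z \<in> V \<longrightarrow> False"
  proof (rule AE_open_of_local[OF V(1)])
    fix z assume "z \<in> V"
    then obtain a b where ab: "z \<in> box a b" "cbox a b \<subseteq> V" by (rule open_contains_cbox[OF V(1)])
    have "AE w in \<mu>. w \<in> box a b \<longrightarrow> False"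
      using box[OF ab(2), of 1] box[OF ab(2), of \<i>]
    proof eventually_elim
      case (elim w)
      show ?case
      proof
        assume "w \<in> box a b"
        then have "\<sigma> w = 0" "w \<in> uhp"
          using elim ab(2) V(2) box_subset_cbox[of a b] by (auto simp: complex_eq_iff inner_complex_def)
        then show False using \<sigma>1 by force
      qed
    qed
    then show "\<exists>U. open U \<and> z \<in> U \<and> (AE w in \<mu>. w \<in> U \<longrightarrow> False)" using ab open_box by blast
  qed
  then show ?thesis by simp
qed

section \<open>Functions with vanishing gradient\<close>

lemma continuous_antiderivative:
  fixes g :: "real \<Rightarrow> real"
  assumes "continuous_on UNIV g"
  obtains F where "\<And>x. (F has_real_derivative g x) (at x)"
proof
  fix x :: real
  have "((\<lambda>u. LBINT y=ereal 0..ereal u. g y) has_vector_derivative g x) (at x within {- \<bar>x\<bar> - 1..\<bar>x\<bar> + 1})"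
    by (rule interval_integral_FTC2) (auto intro: continuous_on_subset[OF assms])
  moreover have "at x within {- \<bar>x\<bar> - 1..\<bar>x\<bar> + 1} = at x"
    by (rule at_within_interior) (auto simp: interior_cbox[of "- \<bar>x\<bar> - 1" "\<bar>x\<bar> + 1", simplified] abs_if)
  ultimately show "((\<lambda>u. LBINT y=ereal 0..ereal u. g y) has_real_derivative g x) (at x)"
    by (simp add: has_real_derivative_iff_has_vector_derivative)
qed

lemma compact_support_FTC:
  fixes u :: "real \<Rightarrow> real"
  assumes "a \<le> b" "continuous_on UNIV u" "\<And>x. x \<notin> {a<..<b} \<Longrightarrow> u x = 0"
    "\<And>x. (U has_real_derivative u x) (at x)"
  shows "has_bochner_integral lborel u (U b - U a)"
proof -
  have "has_bochner_integral lborel (\<lambda>x. u x * indicator {a..b} x) (U b - U a)"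
    using assms by (intro has_bochner_integral_FTC_Icc_real) (auto simp: continuous_on_eq_continuous_at)
  moreover have "(\<lambda>x. u x * indicator {a..b} x) = u"
    using assms(3) by (force split: split_indicator)
  ultimately show ?thesis by simp
qed

lemma smooth_real_diff_scale:
  assumes "smooth_real u" "smooth_real h"
  shows "smooth_real (\<lambda>x. u x - c * h x)"
proof -
  have "Ck_real k (\<lambda>x. u x + (-c) * h x)" for k
    using assms unfolding smooth_real_def
    by (intro Ck_real_add Ck_real_mult[OF Ck_real_const[of k "-c"]]) auto
  then show ?thesis by (simp add: smooth_real_def)
qed

text \<open>
  Subtracting the right multiple of a fixed bump makes the total integral 0, and then the
  antiderivative that vanishes to the left of the interval also vanishes to the right of it.
\<close>
lemma compact_primitive:
  assumes ab: "a < b" and u: "smooth_real u" and u0: "\<forall>x. x \<notin> {a<..<b} \<longrightarrow> u x = 0"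
  shows "\<exists>A. smooth_real A \<and> (\<forall>x. x \<notin> {a<..<b} \<longrightarrow> A x = 0) \<and>
    (\<forall>x. (A has_real_derivative (u x - ((\<integral>x. u x \<partial>lborel) / (\<integral>x. hump a b x \<partial>lborel)) * hump a b x)) (at x))"
proof -
  let ?h = "hump a b"
  have hc: "continuous_on UNIV ?h" and uc: "continuous_on UNIV u"
    using smooth_real_continuous smooth_real_hump u by blast+
  have h0: "?h x = 0" if "x \<notin> {a<..<b}" for x
    using that hump_pos_iff[of a b x] hump_nonneg[of a b x] by linarith
  obtain P where P: "\<And>x. (P has_real_derivative ?h x) (at x)" using continuous_antiderivative[OF hc] by blast
  obtain U where U: "\<And>x. (U has_real_derivative u x) (at x)" using continuous_antiderivative[OF uc] by blast
  have iP: "(\<integral>x. ?h x \<partial>lborel) = P b - P a"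
    using compact_support_FTC[OF _ hc h0 P] ab by (simp add: has_bochner_integral_integral_eq)
  have iU: "(\<integral>x. u x \<partial>lborel) = U b - U a"
    using compact_support_FTC[OF _ uc u0[rule_format] U] ab by (simp add: has_bochner_integral_integral_eq)
  have "P a < P b"
  proof (rule DERIV_pos_imp_increasing_open[OF ab])
    show "\<exists>y. (P has_real_derivative y) (at x) \<and> 0 < y" if "a < x" "x < b" for x
      using P[of x] that hump_pos_iff[of a b x] by auto
    show "continuous_on {a..b} P" using P DERIV_isCont continuous_at_imp_continuous_on by blast
  qed
  define c where "c = (U b - U a) / (P b - P a)"
  define A where "A x = (U x - c * P x) - (U a - c * P a)" for x
  have A': "(A has_real_derivative (u x - c * ?h x)) (at x)" for x
    unfolding A_def using P U by (auto intro!: derivative_eq_intros)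
  have Aa: "A a = 0" by (simp add: A_def)
  have Ab: "A b = 0"
  proof -
    have "c * (P b - P a) = U b - U a" using \<open>P a < P b\<close> by (simp add: c_def)
    then show ?thesis by (simp add: A_def algebra_simps)
  qed
  have "A x = 0" if x: "x \<notin> {a<..<b}" for x
  proof -
    have zero: "(A has_real_derivative 0) (at y)" if "y \<notin> {a<..<b}" for y
      using A'[of y] h0[OF that] u0 that by simp
    consider "x \<le> a" | "x \<ge> b" using x by (cases "x \<le> a") auto
    then show ?thesis
    proof cases
      case 1
      have "A x = A a"
        using DERIV_isconst_end[of x a A] 1 zero DERIV_isCont[OF A']
        by (cases "x = a") (auto simp: continuous_at_imp_continuous_on)
      then show ?thesis using Aa by simp
    next
      case 2
      have "A x = A b"
        using DERIV_isconst_end[of b x A] 2 zero DERIV_isCont[OF A']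
        by (cases "x = b") (auto simp: continuous_at_imp_continuous_on)
      then show ?thesis using Ab by simp
    qed
  qed
  moreover have "smooth_real A"
    by (rule smooth_real_primitive[OF A' smooth_real_diff_scale[OF u smooth_real_hump]])
  ultimately show ?thesis using A' unfolding c_def iP iU by (intro exI[of _ A]) simp
qed

lemma plateau_integral_tendsto:
  assumes "a \<le> b"
  shows "(\<lambda>n. \<integral>x. plateau a b n x \<partial>lborel) \<longlonglongrightarrow> b - a"
proof -
  have cont: "continuous_on UNIV (plateau c d n)" for c d n
    by (rule smooth_real_continuous[OF smooth_real_plateau])
  have [measurable]: "plateau c d n \<in> borel_measurable borel" for c d n
    using cont borel_measurable_continuous_onI by blast
  have "(\<lambda>n. \<integral>x. plateau a b n x \<partial>lborel) \<longlonglongrightarrow> (\<integral>x. indicator {a<..<b} x \<partial>lborel)"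
  proof (rule integral_dominated_convergence[where w = "indicator {a..b}"])
    show "integrable lborel (indicator {a..b} :: real \<Rightarrow> real)"
      using emeasure_compact_finite[of "{a..b}"] by (intro integrable_real_indicator) auto
    show "AE x in lborel. norm (plateau a b n x) \<le> indicator {a..b} x" for n
    proof (rule AE_I2)
      fix x show "norm (plateau a b n x) \<le> indicator {a..b} x"
        using plateau_bounds[of a b n x] plateau_outside[of x a b n] by (auto split: split_indicator)
    qed
  qed (auto simp: plateau_tendsto)
  then show ?thesis using assms by simp
qed

text \<open>
  The lemma of du Bois-Reymond in two variables.  By \<open>compact_primitive\<close> a product
  \<open>u(x) w(y)\<close> differs from a multiple of a fixed product of bumps by partial derivatives of
  products with support in the box, which \<open>v\<close> annihilates.  So the integral of
  \<open>v\<close> against \<open>u(x) w(y)\<close> is a constant \<open>c\<close> times the product of the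
  integrals of \<open>u\<close> and \<open>w\<close>; letting both tend to indicators gives
  \<open>v = c\<close>.
\<close>
lemma AE_constant_on_box:
  fixes v :: "complex \<Rightarrow> real"
  assumes int: "set_integrable lborel (cbox a b) v" and ab: "Re a < Re b" "Im a < Im b"
    and hx: "\<And>A A' w. smooth_real A \<Longrightarrow> smooth_real w \<Longrightarrow> (\<And>x. (A has_real_derivative A' x) (at x)) \<Longrightarrow>
      (\<And>x. x \<notin> {Re a<..<Re b} \<Longrightarrow> A x = 0) \<Longrightarrow> (\<And>x. x \<notin> {Im a<..<Im b} \<Longrightarrow> w x = 0) \<Longrightarrow>
      (\<integral>z. v z * (A' (Re z) * w (Im z)) \<partial>lborel) = 0"
    and hy: "\<And>u A A'. smooth_real u \<Longrightarrow> smooth_real A \<Longrightarrow> (\<And>x. (A has_real_derivative A' x) (at x)) \<Longrightarrow>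
      (\<And>x. x \<notin> {Re a<..<Re b} \<Longrightarrow> u x = 0) \<Longrightarrow> (\<And>x. x \<notin> {Im a<..<Im b} \<Longrightarrow> A x = 0) \<Longrightarrow>
      (\<integral>z. v z * (u (Re z) * A' (Im z)) \<partial>lborel) = 0"
  shows "\<exists>c. AE z in lborel. z \<in> box a b \<longrightarrow> v z = c"
proof -
  define h1 where "h1 = hump (Re a) (Re b)"
  define h2 where "h2 = hump (Im a) (Im b)"
  define I where "I u w = (\<integral>z. v z * (u (Re z) * w (Im z)) \<partial>lborel)" for u w
  have h: "smooth_real h1" "smooth_real h2" by (auto simp: h1_def h2_def smooth_real_hump)
  have h0: "h1 x = 0" if "x \<notin> {Re a<..<Re b}" for x
    using that hump_pos_iff[of "Re a" "Re b" x] hump_nonneg[of "Re a" "Re b" x] unfolding h1_def by linarith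
  have h20: "h2 x = 0" if "x \<notin> {Im a<..<Im b}" for x
    using that hump_pos_iff[of "Im a" "Im b" x] hump_nonneg[of "Im a" "Im b" x] unfolding h2_def by linarith
  have vm: "integrable lborel (\<lambda>z. indicator (cbox a b) z * v z)" using int by (simp add: set_integrable_def)
  have integ: "integrable lborel (\<lambda>z. v z * (u (Re z) * w (Im z)))"
    if u: "smooth_real u" "smooth_real w" "\<And>x. x \<notin> {Re a<..<Re b} \<Longrightarrow> u x = 0"
      "\<And>x. x \<notin> {Im a<..<Im b} \<Longrightarrow> w x = 0" for u w
  proof -
    have uc: "continuous_on UNIV u" "continuous_on UNIV w" using u smooth_real_continuous by blast+
    have [measurable]: "u \<in> borel_measurable borel" "w \<in> borel_measurable borel"
      using uc borel_measurable_continuous_onI by blast+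
    have "bounded (u ` {Re a..Re b})" "bounded (w ` {Im a..Im b})"
      by (intro compact_imp_bounded compact_continuous_image continuous_on_subset[OF uc(1)]
        continuous_on_subset[OF uc(2)]; simp)+
    then obtain K L where K: "\<And>x. x \<in> {Re a..Re b} \<Longrightarrow> \<bar>u x\<bar> \<le> K" and L: "\<And>x. x \<in> {Im a..Im b} \<Longrightarrow> \<bar>w x\<bar> \<le> L"
      unfolding bounded_iff by force
    have "integrable lborel (\<lambda>z. (K * L) * (indicator (cbox a b) z * v z))" using vm by simp
    then show ?thesis
    proof (rule Bochner_Integration.integrable_bound)
      have eq: "v z * (u (Re z) * w (Im z)) = (indicator (cbox a b) z * v z) * (u (Re z) * w (Im z))" for z
        using u(3)[of "Re z"] u(4)[of "Im z"] by (cases "z \<in> cbox a b") (auto simp: in_cbox_complex_iff)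
      show "(\<lambda>z. v z * (u (Re z) * w (Im z))) \<in> borel_measurable lborel"
        unfolding eq using borel_measurable_integrable[OF vm] by measurable
      show "AE z in lborel. norm (v z * (u (Re z) * w (Im z))) \<le> norm (K * L * (indicat_real (cbox a b) z * v z))"
      proof (rule AE_I2)
        fix z
        show "norm (v z * (u (Re z) * w (Im z))) \<le> norm (K * L * (indicat_real (cbox a b) z * v z))"
        proof (cases "z \<in> cbox a b")
          case True
          then have "\<bar>u (Re z)\<bar> \<le> K" "\<bar>w (Im z)\<bar> \<le> L" using K L by (auto simp: in_cbox_complex_iff)
          then have "\<bar>u (Re z)\<bar> * \<bar>w (Im z)\<bar> \<le> \<bar>K\<bar> * \<bar>L\<bar>" by (intro mult_mono) auto
          then have "\<bar>v z\<bar> * (\<bar>u (Re z)\<bar> * \<bar>w (Im z)\<bar>) \<le> \<bar>v z\<bar> * (\<bar>K\<bar> * \<bar>L\<bar>)" by (intro mult_left_mono) auto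
          then show ?thesis using True by (simp add: abs_mult mult_ac)
        next
          case False
          then show ?thesis using eq[of z] by simp
        qed
      qed
    qed
  qed
  have red1: "I u w = ((\<integral>x. u x \<partial>lborel) / (\<integral>x. h1 x \<partial>lborel)) * I h1 w"
    if u: "smooth_real u" "smooth_real w" "\<And>x. x \<notin> {Re a<..<Re b} \<Longrightarrow> u x = 0"
      "\<And>x. x \<notin> {Im a<..<Im b} \<Longrightarrow> w x = 0" for u w
  proof -
    have u0: "\<forall>x. x \<notin> {Re a<..<Re b} \<longrightarrow> u x = 0" by (simp add: u(3))
    obtain A where A: "smooth_real A" "\<forall>x. x \<notin> {Re a<..<Re b} \<longrightarrow> A x = 0"
      "\<forall>x. (A has_real_derivative (u x - ((\<integral>x. u x \<partial>lborel) / (\<integral>x. h1 x \<partial>lborel)) * h1 x)) (at x)"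
      using compact_primitive[OF ab(1) u(1) u0, folded h1_def] by (elim exE conjE) (rule that)
    have "0 = (\<integral>z. v z * ((u (Re z) - ((\<integral>x. u x \<partial>lborel) / (\<integral>x. h1 x \<partial>lborel)) * h1 (Re z)) * w (Im z)) \<partial>lborel)"
      by (rule hx[OF A(1) u(2) A(3)[rule_format] A(2)[rule_format] u(4), symmetric])
    also have "\<dots> = (\<integral>z. v z * (u (Re z) * w (Im z)) -
        ((\<integral>x. u x \<partial>lborel) / (\<integral>x. h1 x \<partial>lborel)) * (v z * (h1 (Re z) * w (Im z))) \<partial>lborel)"
      by (intro Bochner_Integration.integral_cong) (auto simp: algebra_simps)
    also have "\<dots> = I u w - ((\<integral>x. u x \<partial>lborel) / (\<integral>x. h1 x \<partial>lborel)) * I h1 w"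
      unfolding I_def using integ[OF u] integ[OF h(1) u(2) h0 u(4)] by simp
    finally show ?thesis by simp
  qed
  have red2: "I h1 w = ((\<integral>x. w x \<partial>lborel) / (\<integral>x. h2 x \<partial>lborel)) * I h1 h2"
    if u: "smooth_real w" "\<And>x. x \<notin> {Im a<..<Im b} \<Longrightarrow> w x = 0" for w
  proof -
    have u0: "\<forall>x. x \<notin> {Im a<..<Im b} \<longrightarrow> w x = 0" by (simp add: u(2))
    obtain A where A: "smooth_real A" "\<forall>x. x \<notin> {Im a<..<Im b} \<longrightarrow> A x = 0"
      "\<forall>x. (A has_real_derivative (w x - ((\<integral>x. w x \<partial>lborel) / (\<integral>x. h2 x \<partial>lborel)) * h2 x)) (at x)"
      using compact_primitive[OF ab(2) u(1) u0, folded h2_def] by (elim exE conjE) (rule that)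
    have "0 = (\<integral>z. v z * (h1 (Re z) * (w (Im z) - ((\<integral>x. w x \<partial>lborel) / (\<integral>x. h2 x \<partial>lborel)) * h2 (Im z))) \<partial>lborel)"
      by (rule hy[OF h(1) A(1) A(3)[rule_format] h0 A(2)[rule_format], symmetric])
    also have "\<dots> = (\<integral>z. v z * (h1 (Re z) * w (Im z)) -
        ((\<integral>x. w x \<partial>lborel) / (\<integral>x. h2 x \<partial>lborel)) * (v z * (h1 (Re z) * h2 (Im z))) \<partial>lborel)"
      by (intro Bochner_Integration.integral_cong) (auto simp: algebra_simps)
    also have "\<dots> = I h1 w - ((\<integral>x. w x \<partial>lborel) / (\<integral>x. h2 x \<partial>lborel)) * I h1 h2"
      unfolding I_def using integ[OF h(1) u(1) h0 u(2)] integ[OF h h0 h20] by simp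
    finally show ?thesis by simp
  qed
  define c where "c = I h1 h2 / ((\<integral>x. h1 x \<partial>lborel) * (\<integral>x. h2 x \<partial>lborel))"
  have "AE z in lborel. z \<in> box a b \<longrightarrow> v z - c = 0"
  proof (rule AE_zero_of_box_integrals)
    have "set_integrable lborel (cbox a b) (\<lambda>z. c)"
      using integrable_real_indicator[of "cbox a b" lborel] emeasure_lborel_cbox_finite[of a b]
      by (simp add: set_integrable_def)
    then show "set_integrable lborel (cbox a b) (\<lambda>z. v z - c)" using int by (rule set_integral_diff(1)[rotated])
    fix p q :: complex assume sub: "box p q \<subseteq> box a b"
    show "(LINT z:box p q|lborel. v z - c) = 0"
    proof (cases "box p q = {}")
      case False
      then have pq: "Re p < Re q" "Im p < Im q" by (auto simp: box_eq_empty Basis_complex_def not_le)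
      have cb: "cbox p q \<subseteq> cbox a b"
        using sub False by (metis closure_box closure_minimal closed_cbox box_subset_cbox order_trans)
      then have "Re a \<le> Re p" "Re q \<le> Re b" "Im a \<le> Im p" "Im q \<le> Im b"
        using pq by (auto simp: subset_box Basis_complex_def)
      then have out: "plateau (Re p) (Re q) n x = 0" if "x \<notin> {Re a<..<Re b}" for n x
        using that by (intro plateau_outside) auto
      have out2: "plateau (Im p) (Im q) n x = 0" if "x \<notin> {Im a<..<Im b}" for n x
        using that \<open>Im a \<le> Im p\<close> \<open>Im q \<le> Im b\<close> by (intro plateau_outside) auto
      have i: "set_integrable lborel (cbox p q) v" using cb int by (rule set_integrable_subset[rotated 2]) simp
      have "(\<lambda>n. I (plateau (Re p) (Re q) n) (plateau (Im p) (Im q) n)) \<longlonglongrightarrow> (LINT z:box p q|lborel. v z)"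
        using plateau_product_convergence[OF _ i] by (simp add: I_def mult_ac)
      moreover have "I (plateau (Re p) (Re q) n) (plateau (Im p) (Im q) n) =
          (\<integral>x. plateau (Re p) (Re q) n x \<partial>lborel) * (\<integral>x. plateau (Im p) (Im q) n x \<partial>lborel) * c" for n
        using red1[of "plateau (Re p) (Re q) n" "plateau (Im p) (Im q) n"] red2[of "plateau (Im p) (Im q) n"]
        by (simp add: smooth_real_plateau out out2 c_def mult_ac)
      moreover have "(\<lambda>n. (\<integral>x. plateau (Re p) (Re q) n x \<partial>lborel) * (\<integral>x. plateau (Im p) (Im q) n x \<partial>lborel) * c)
         \<longlonglongrightarrow> (Re q - Re p) * (Im q - Im p) * c"
        using pq by (intro tendsto_intros plateau_integral_tendsto) auto
      ultimately have "(LINT z:box p q|lborel. v z) = (Re q - Re p) * (Im q - Im p) * c"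
        using LIMSEQ_unique by simp
      moreover have "(LINT z:box p q|lborel. c) = (Re q - Re p) * (Im q - Im p) * c"
        using pq by (simp add: set_lebesgue_integral_def measure_lborel_box_eq Basis_complex_def)
      moreover have "set_integrable lborel (box p q) v"
        by (rule set_integrable_subset[OF i]) (auto simp: box_subset_cbox)
      moreover have "set_integrable lborel (box p q) (\<lambda>z. c)"
        using integrable_real_indicator[of "box p q" lborel] emeasure_lborel_box_finite[of p q]
        by (simp add: set_integrable_def)
      ultimately show ?thesis by (simp add: set_integral_diff)
    qed (simp add: set_lebesgue_integral_def)
  qed simp
  then show ?thesis by auto
qed

text \<open>
  With \<open>\<zeta> = \<i>\<close> and \<open>\<zeta> = -1\<close> the form \<open>u(x) w(y) \<zeta>\<close> is
  \<open>u w dy\<close> and \<open>- u w dx\<close>, whose exterior derivatives are the two partial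
  derivatives of \<open>u w\<close>.
\<close>
lemma AE_constant_locally:
  assumes li: "set_integrable lebesgue (cbox a b) v" and ab: "Re a < Re b" "Im a < Im b" and uhp: "cbox a b \<subseteq> uhp"
    and zero: "\<And>\<psi>. test_form \<psi> \<Longrightarrow> closure {z. \<psi> z \<noteq> 0} \<subseteq> cbox a b \<Longrightarrow> d_current v \<psi> = 0"
  shows "\<exists>c. AE z in lebesgue. z \<in> box a b \<longrightarrow> v z = c"
proof -
  define f where "f z = indicator (cbox a b) z * v z" for z
  have f: "integrable lebesgue f" using li by (simp add: set_integrable_def f_def[abs_def])
  obtain v' where v': "v' \<in> borel_measurable lborel" "AE z in lborel. f z = v' z"
    using completion_ex_borel_measurable_real[OF borel_measurable_integrable[OF f]] by blast
  have ae: "AE z in lebesgue. f z = v' z" by (rule AE_completion[OF v'(2)])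
  have vm: "v' \<in> borel_measurable lebesgue" using v'(1) by (rule measurable_completion)
  have "integrable lebesgue v'"
    using integrable_cong_AE[OF borel_measurable_integrable[OF f] vm ae] f by blast
  then have v'i: "integrable lborel v'" using integrable_completion[OF v'(1)] by blast
  have v'b[measurable]: "v' \<in> borel_measurable borel" using v'(1) by simp
  have key: "(\<integral>z. v' z * g z \<partial>lborel) = d_current v \<psi>"
    if g: "g \<in> borel_measurable borel" "\<And>z. ext_deriv \<psi> z = g z" "\<And>z. z \<notin> cbox a b \<Longrightarrow> g z = 0" for g \<psi>
  proof -
    have [measurable]: "g \<in> borel_measurable borel" by (rule g(1))
    have "d_current v \<psi> = (\<integral>z. f z * g z \<partial>lebesgue)"
      unfolding d_current_def set_lebesgue_integral_def
      by (rule Bochner_Integration.integral_cong)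
         (use g(2,3) uhp in \<open>auto simp: f_def split: split_indicator\<close>)
    also have "\<dots> = (\<integral>z. v' z * g z \<partial>lebesgue)"
    proof (rule integral_cong_AE)
      have "g \<in> borel_measurable lebesgue" using g(1) by (simp add: measurable_completion)
      then show "(\<lambda>z. f z * g z) \<in> borel_measurable lebesgue" "(\<lambda>z. v' z * g z) \<in> borel_measurable lebesgue"
        using borel_measurable_integrable[OF f] vm by auto
    qed (use ae in auto)
    also have "\<dots> = (\<integral>z. v' z * g z \<partial>lborel)" by (rule integral_completion) measurable
    finally show ?thesis by simp
  qed
  have deriv0: "A' x = 0" if "\<And>x. (A has_real_derivative A' x) (at x)" "\<And>x. x \<notin> {p<..<q} \<Longrightarrow> A x = 0" "x \<notin> {p..q}"
    for A A' :: "real \<Rightarrow> real" and p q x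
  proof -
    have "(A has_real_derivative 0) (at x)"
      by (rule has_field_derivative_transform_within_open[OF DERIV_const, of "- {p..q}"])
        (use that(3) in \<open>auto simp: that(2)\<close>)
    then show ?thesis using that(1) DERIV_unique by blast
  qed
  have meas: "A' \<in> borel_measurable borel" if A: "smooth_real A" "\<And>x. (A has_real_derivative A' x) (at x)" for A A' :: "real \<Rightarrow> real"
  proof -
    obtain B where B: "\<And>x. (A has_real_derivative B x) (at x)" "smooth_real B"
      using smooth_real_derivative[OF A(1)] by blast
    have "B = A'" using B(1) A(2) DERIV_unique by blast
    then show ?thesis using B(2) smooth_real_continuous borel_measurable_continuous_onI by blast
  qed
  have meas': "A \<in> borel_measurable borel" if "smooth_real A" for A
    using smooth_real_continuous[OF that] borel_measurable_continuous_onI by blast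
  have "\<exists>c. AE z in lborel. z \<in> box a b \<longrightarrow> v' z = c"
  proof (rule AE_constant_on_box[OF _ ab])
    show "set_integrable lborel (cbox a b) v'"
      unfolding set_integrable_def by (rule integrable_mult_indicator[OF _ v'i]) simp
  next
    fix A A' w assume A: "smooth_real A" "smooth_real w" "\<And>x. (A has_real_derivative A' x) (at x)"
      "\<And>x. x \<notin> {Re a<..<Re b} \<Longrightarrow> A x = 0" "\<And>x. x \<notin> {Im a<..<Im b} \<Longrightarrow> w x = 0"
    obtain w' where w': "\<And>x. (w has_real_derivative w' x) (at x)" using smooth_real_derivative[OF A(2)] by blast
    let ?\<psi> = "\<lambda>z. of_real (A (Re z) * w (Im z)) * \<i>"
    have "ext_deriv ?\<psi> z = A' (Re z) * w (Im z)" for z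
      using ext_deriv_product[OF A(3) w', of 1 \<i> \<i> z] by simp
    moreover have "A' (Re z) * w (Im z) = 0" if "z \<notin> cbox a b" for z
    proof -
      have "A' x = 0" if "x \<notin> {Re a..Re b}" for x by (rule deriv0[OF A(3) A(4) that])
      then show ?thesis using that A(5)[of "Im z"] by (auto simp: in_cbox_complex_iff)
    qed
    moreover have "(\<lambda>z. A' (Re z) * w (Im z)) \<in> borel_measurable borel"
      using meas[OF A(1,3)] meas'[OF A(2)] by measurable
    ultimately have "(\<integral>z. v' z * (A' (Re z) * w (Im z)) \<partial>lborel) = d_current v ?\<psi>" by (intro key)
    also have "\<dots> = 0"
      by (rule zero; rule test_form_plateau_product[OF uhp A(1,2,4,5)]; assumption)
    finally show "(\<integral>z. v' z * (A' (Re z) * w (Im z)) \<partial>lborel) = 0" .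
  next
    fix A A' w assume A: "smooth_real w" "smooth_real A" "\<And>x. (A has_real_derivative A' x) (at x)"
      "\<And>x. x \<notin> {Re a<..<Re b} \<Longrightarrow> w x = 0" "\<And>x. x \<notin> {Im a<..<Im b} \<Longrightarrow> A x = 0"
    obtain w' where w': "\<And>x. (w has_real_derivative w' x) (at x)" using smooth_real_derivative[OF A(1)] by blast
    let ?\<psi> = "\<lambda>z. of_real (w (Re z) * A (Im z)) * (- 1)"
    have "ext_deriv ?\<psi> z = w (Re z) * A' (Im z)" for z
      using ext_deriv_product[OF w' A(3), of 1 \<i> "- 1" z] by simp
    moreover have "w (Re z) * A' (Im z) = 0" if "z \<notin> cbox a b" for z
    proof -
      have "A' x = 0" if "x \<notin> {Im a..Im b}" for x by (rule deriv0[OF A(3) A(5) that])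
      then show ?thesis using that A(4)[of "Re z"] by (auto simp: in_cbox_complex_iff)
    qed
    moreover have "(\<lambda>z. w (Re z) * A' (Im z)) \<in> borel_measurable borel"
      using meas[OF A(2,3)] meas'[OF A(1)] by measurable
    ultimately have "(\<integral>z. v' z * (w (Re z) * A' (Im z)) \<partial>lborel) = d_current v ?\<psi>" by (intro key)
    also have "\<dots> = 0"
      by (rule zero; rule test_form_plateau_product[OF uhp A(1,2,4,5)]; assumption)
    finally show "(\<integral>z. v' z * (w (Re z) * A' (Im z)) \<partial>lborel) = 0" .
  qed
  then obtain c where "AE z in lborel. z \<in> box a b \<longrightarrow> v' z = c" by blast
  then have "AE z in lebesgue. z \<in> box a b \<longrightarrow> v' z = c" by (rule AE_completion)
  with ae have "AE z in lebesgue. z \<in> box a b \<longrightarrow> v z = c"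
    by eventually_elim (use box_subset_cbox[of a b] in \<open>auto simp: f_def\<close>)
  then show ?thesis by blast
qed

lemma AE_constant_unique:
  fixes v :: "complex \<Rightarrow> real"
  assumes "AE z in lebesgue. z \<in> U \<longrightarrow> v z = c" "AE z in lebesgue. z \<in> W \<longrightarrow> v z = d"
    "open U" "open W" "U \<inter> W \<noteq> {}"
  shows "c = d"
proof (rule ccontr)
  assume "c \<noteq> d"
  have "AE z in lebesgue. z \<notin> U \<inter> W"
    using assms(1,2)
  proof eventually_elim
    case (elim z)
    then show ?case using \<open>c \<noteq> d\<close> by auto
  qed
  then have "U \<inter> W \<in> null_sets lebesgue"
    using assms(3,4) by (subst AE_iff_null_sets) (auto intro: borel_open)
  then show False using open_not_negligible[of "U \<inter> W"] assms(3-5) by (auto simp: negligible_iff_null_sets)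
qed

text \<open>
  The local constants agree on overlaps, because a nonempty open set is not null.
\<close>
lemma AE_constant_on_connected:
  assumes li: "locally_integrable v" and V: "open V" "V \<subseteq> uhp" "connected V"
    and zero: "\<And>\<psi>. test_form \<psi> \<Longrightarrow> closure {z. \<psi> z \<noteq> 0} \<subseteq> V \<Longrightarrow> d_current v \<psi> = 0"
  shows "\<exists>c. AE z in lebesgue. z \<in> V \<longrightarrow> v z = c"
proof (cases "V = {}")
  case False
  have "\<exists>U c. open U \<and> z \<in> U \<and> U \<subseteq> V \<and> (AE w in lebesgue. w \<in> U \<longrightarrow> v w = c)" if "z \<in> V" for z
  proof -
    obtain a b where ab: "cbox a b \<subseteq> V" "z \<in> box a b" "\<forall>i\<in>Basis. a \<bullet> i < b \<bullet> i"
      using open_contains_cbox[OF V(1) \<open>z \<in> V\<close>] by blast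
    have "\<exists>c. AE z in lebesgue. z \<in> box a b \<longrightarrow> v z = c"
    proof (rule AE_constant_locally)
      show "set_integrable lebesgue (cbox a b) v" using li ab(1) V(2) by (auto simp: locally_integrable_def)
      show "Re a < Re b" "Im a < Im b" using ab(3) by (auto simp: Basis_complex_def)
    qed (use ab(1) V(2) zero in auto)
    then show ?thesis using ab box_subset_cbox[of a b] open_box by (meson order_trans)
  qed
  then obtain U c where U: "\<And>z. z \<in> V \<Longrightarrow> open (U z) \<and> z \<in> U z \<and> U z \<subseteq> V \<and> (AE w in lebesgue. w \<in> U z \<longrightarrow> v w = c z)"
    by metis
  obtain z0 where z0: "z0 \<in> V" using False by blast
  have "c z0 = c z" if z: "z \<in> V" for z
  proof (rule connected_local_const[OF V(3) z0 z])
    show "\<forall>a\<in>V. \<forall>\<^sub>F b in at a within V. c a = c b"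
    proof
      fix a assume a: "a \<in> V"
      have "c a = c b" if b: "b \<in> V" "b \<in> U a" for b
        by (rule AE_constant_unique[of "U a" v _ "U b"]) (use U[OF a] U[OF b(1)] b in auto)
      then show "\<forall>\<^sub>F b in at a within V. c a = c b"
        unfolding eventually_at_topological using U[OF a] by blast
    qed
  qed
  then have "AE z in lebesgue. z \<in> V \<longrightarrow> v z = c z0"
    by (intro AE_open_of_local[OF V(1)]) (use U in metis)
  then show ?thesis by blast
qed simp

section \<open>Blowing up at a jump point\<close>

text \<open>
The derivative of \<open>hump (-1) 1\<close>.
\<close>
definition bell' :: "real \<Rightarrow> real" where
  "bell' x = hump (- 1) 1 x * (1 / (1 + x)\<^sup>2 - 1 / (1 - x)\<^sup>2)"

lemma has_real_derivative_bell: "(hump (- 1) 1 has_real_derivative bell' x) (at x)"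
proof -
  have 1: "((\<lambda>x. flat (x - -1)) has_real_derivative (1 / (x - -1))\<^sup>2 * flat (x - -1) * 1) (at x)"
    by (rule DERIV_chain2[OF has_real_derivative_flat]) (auto intro!: derivative_eq_intros)
  have 2: "((\<lambda>x. flat (1 - x)) has_real_derivative (1 / (1 - x))\<^sup>2 * flat (1 - x) * (-1)) (at x)"
    by (rule DERIV_chain2[OF has_real_derivative_flat]) (auto intro!: derivative_eq_intros)
  have "((\<lambda>x. flat (x - -1) * flat (1 - x)) has_real_derivative bell' x) (at x)"
    by (rule DERIV_cong[OF DERIV_mult[OF 1 2]]) (simp add: bell'_def hump_def power_divide algebra_simps)
  moreover have "(\<lambda>x. flat (x - -1) * flat (1 - x)) = hump (-1) 1" by (auto simp: hump_def)
  ultimately show ?thesis by simp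
qed

lemma bell_odd: "bell' (- x) = - bell' x"
  by (simp add: bell'_def hump_def algebra_simps)

lemma bell_even: "hump (- 1) 1 (- x) = hump (- 1) 1 x"
  by (simp add: hump_def algebra_simps)

lemma bell_zero: "\<bar>x\<bar> \<ge> 1 \<Longrightarrow> hump (- 1) 1 x = 0" "\<bar>x\<bar> \<ge> 1 \<Longrightarrow> bell' x = 0"
proof -
  show *: "hump (- 1) 1 x = 0" if "\<bar>x\<bar> \<ge> 1"
    using that hump_pos_iff[of "-1" 1 x] hump_nonneg[of "-1" 1 x] by (auto simp: abs_if split: if_splits)
  show "bell' x = 0" if "\<bar>x\<bar> \<ge> 1" using *[OF that] by (simp add: bell'_def)
qed

lemma bell_deriv_neg:
  assumes "0 < x" "x < 1" shows "bell' x < 0"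
proof -
  have "(1 - x)\<^sup>2 < (1 + x)\<^sup>2" using assms by (intro power_strict_mono) auto
  then have "1 / (1 + x)\<^sup>2 < 1 / (1 - x)\<^sup>2" using assms by (intro divide_strict_left_mono mult_pos_pos) auto
  moreover have "hump (-1) 1 x > 0" using assms by (simp add: hump_pos_iff)
  ultimately show ?thesis unfolding bell'_def by (simp add: mult_pos_neg)
qed

lemma bell_deriv_nonpos: "0 \<le> x \<Longrightarrow> bell' x \<le> 0"
  using bell_deriv_neg[of x] bell_zero(2)[of x] by (cases "x = 0"; cases "x < 1") (auto simp: bell'_def)

lemma bell_le_1: "hump (- 1) 1 x \<le> 1"
  unfolding hump_def using mult_mono[OF flat_le_1 flat_le_1] by (simp add: flat_nonneg)

lemma continuous_bell': "continuous_on UNIV bell'"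
proof -
  obtain B where B: "\<And>x. (hump (-1) 1 has_real_derivative B x) (at x)" "smooth_real B"
    using smooth_real_derivative[OF smooth_real_hump] by blast
  have "B = bell'" using B(1) has_real_derivative_bell DERIV_unique by blast
  then show ?thesis using B(2) smooth_real_continuous by blast
qed

lemma bell'_bounded: "\<exists>K>0. \<forall>x. \<bar>bell' x\<bar> \<le> K"
proof -
  have "bounded (bell' ` {-1..1})"
    by (intro compact_imp_bounded compact_continuous_image continuous_on_subset[OF continuous_bell']; simp)
  then obtain K where K: "\<forall>x\<in>{-1..1}. \<bar>bell' x\<bar> \<le> K" unfolding bounded_iff by auto
  have "\<bar>bell' x\<bar> \<le> \<bar>K\<bar> + 1" for x
  proof (cases "\<bar>x\<bar> \<ge> 1")
    case False
    then have "\<bar>bell' x\<bar> \<le> K" by (intro K[rule_format]) auto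
    then show ?thesis by linarith
  qed (simp add: bell_zero(2))
  then show ?thesis by (intro exI[of _ "\<bar>K\<bar> + 1"]) auto
qed

text \<open>
  A bump of width \<open>r\<close> at \<open>z\<close> times the covector \<open>\<i> n\<close>: along a
  curve through \<open>z\<close> it measures the part of the motion that is orthogonal to
  \<open>n\<close>, and its exterior derivative is the derivative of the bump in the direction
  \<open>n\<close>.
\<close>
definition blow_form :: "complex \<Rightarrow> complex \<Rightarrow> real \<Rightarrow> complex \<Rightarrow> complex" where
  "blow_form z n r w =
     of_real (hump (- 1) 1 (((w - z) \<bullet> n) / r) * hump (- 1) 1 (((w - z) \<bullet> (\<i> * n)) / r)) * (\<i> * n)"

definition blow_kernel :: "complex \<Rightarrow> complex \<Rightarrow> real" where
  "blow_kernel n x = bell' (x \<bullet> n) * hump (- 1) 1 (x \<bullet> (\<i> * n))"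

lemma norm_sq_frame:
  fixes x n :: complex
  assumes "cmod n = 1"
  shows "(cmod x)\<^sup>2 = (x \<bullet> n)\<^sup>2 + (x \<bullet> (\<i> * n))\<^sup>2"
proof -
  have n: "(Re n)\<^sup>2 + (Im n)\<^sup>2 = 1" using assms by (simp add: cmod_def)
  have "(x \<bullet> n)\<^sup>2 + (x \<bullet> (\<i> * n))\<^sup>2 = ((Re x)\<^sup>2 + (Im x)\<^sup>2) * ((Re n)\<^sup>2 + (Im n)\<^sup>2)"
    by (simp add: inner_complex_def power2_eq_square algebra_simps)
  then show ?thesis by (simp add: n cmod_power2)
qed

text \<open>
The square of half-width 1 lies in the disc of radius 2; this is why radii \<open>2r\<close> occur below.
\<close>
lemma frame_bound:
  assumes "cmod n = 1" "\<bar>x \<bullet> n\<bar> < 1" "\<bar>x \<bullet> (\<i> * n)\<bar> < 1"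
  shows "cmod x < 2"
proof -
  have "(x \<bullet> n)\<^sup>2 < 1" "(x \<bullet> (\<i> * n))\<^sup>2 < 1" using assms(2,3) by (simp_all add: abs_square_less_1)
  then have "(cmod x)\<^sup>2 < 2\<^sup>2" using norm_sq_frame[OF assms(1), of x] by simp
  then show ?thesis by (rule power2_less_imp_less) simp
qed

lemma blow_kernel_support: "cmod n = 1 \<Longrightarrow> cmod x \<ge> 2 \<Longrightarrow> blow_kernel n x = 0"
  using frame_bound[of n x] bell_zero[of "x \<bullet> n"] bell_zero[of "x \<bullet> (\<i> * n)"]
  unfolding blow_kernel_def by (cases "\<bar>x \<bullet> n\<bar> < 1"; cases "\<bar>x \<bullet> (\<i> * n)\<bar> < 1") auto

lemma cmod_scale_inverse: "r > 0 \<Longrightarrow> cmod (x /\<^sub>R r) = cmod x / r"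
  by (simp add: divide_inverse mult.commute)

lemma blow_form_support:
  assumes "cmod n = 1" "r > 0" "dist z w \<ge> 2 * r" shows "blow_form z n r w = 0"
proof -
  let ?x = "(w - z) /\<^sub>R r"
  have "cmod ?x = cmod (w - z) / r" by (rule cmod_scale_inverse[OF assms(2)])
  moreover have "cmod (w - z) \<ge> 2 * r" using assms(3) by (simp add: dist_norm norm_minus_commute)
  ultimately have "cmod ?x \<ge> 2" using assms(2) by (simp add: le_divide_eq)
  then have "\<not> (\<bar>?x \<bullet> n\<bar> < 1 \<and> \<bar>?x \<bullet> (\<i> * n)\<bar> < 1)" using frame_bound[OF assms(1), of ?x] by linarith
  then have "\<bar>((w - z) \<bullet> n) / r\<bar> \<ge> 1 \<or> \<bar>((w - z) \<bullet> (\<i> * n)) / r\<bar> \<ge> 1"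
    by (auto simp: divide_inverse mult.commute)
  then show ?thesis using bell_zero(1) by (auto simp: blow_form_def)
qed

lemma blow_form_alt:
  "blow_form z n r = (\<lambda>w. of_real (hump (-1) 1 ((1/r) * (w \<bullet> n) + (- (z \<bullet> n) / r)) *
      hump (-1) 1 ((1/r) * (w \<bullet> (\<i> * n)) + (- (z \<bullet> (\<i> * n)) / r))) * (\<i> * n))"
  by (simp add: blow_form_def[abs_def] inner_diff_left diff_divide_distrib)

lemma smooth_real_bell_affine: "smooth_real (\<lambda>x. hump (-1) 1 (c * x + d))"
  unfolding smooth_real_def
  using Ck_real_compose[OF _ Ck_real_affine] smooth_real_hump[unfolded smooth_real_def] by blast

lemma test_form_blow_form:
  assumes n: "cmod n = 1" and r: "r > 0" and sub: "cball z (2 * r) \<subseteq> uhp"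
  shows "test_form (blow_form z n r)" "closure {w. blow_form z n r w \<noteq> 0} \<subseteq> cball z (2 * r)"
proof -
  have C: "Ck_on k UNIV (blow_form z n r)" for k
    unfolding blow_form_alt by (rule Ck_on_product[OF smooth_real_bell_affine smooth_real_bell_affine])
  have z: "blow_form z n r w = 0" if "w \<notin> cball z (2 * r)" for w
    using that blow_form_support[OF n r, of z w] by auto
  show "test_form (blow_form z n r)" by (rule test_formI(1)[OF C z compact_cball sub])
  show "closure {w. blow_form z n r w \<noteq> 0} \<subseteq> cball z (2 * r)" by (rule test_formI(2)[OF C z compact_cball sub])
qed

lemma norm_blow_form_le: "cmod n = 1 \<Longrightarrow> cmod (blow_form z n r w) \<le> 1"
  unfolding blow_form_def norm_mult norm_of_real using bell_le_1 hump_nonneg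
  by (simp add: abs_mult mult_le_one)

lemma ext_deriv_blow_form:
  assumes n: "cmod n = 1" and r: "r > 0"
  shows "ext_deriv (blow_form z n r) w = (1 / r) * blow_kernel n ((w - z) /\<^sub>R r)"
proof -
  have d: "((\<lambda>x. hump (-1) 1 ((1/r) * x + d)) has_real_derivative bell' ((1/r) * x + d) * (1 / r)) (at x)" for d x
    by (rule DERIV_chain2[OF has_real_derivative_bell]) (use r in \<open>auto intro!: derivative_eq_intros\<close>)
  have nn: "Im (cnj n * (\<i> * n)) = 1" "Im (cnj (\<i> * n) * (\<i> * n)) = 0"
    using n by (simp_all add: cmod_def power2_eq_square)
  show ?thesis
    unfolding blow_form_alt ext_deriv_product[OF d d] nn
    using r by (simp add: blow_kernel_def inner_diff_left algebra_simps divide_inverse)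
qed

text \<open>
  Negative \<open>c\<close> is of interest too: \<open>c = -1\<close> exchanges opposite half-discs.
\<close>
lemma lborel_integral_affine:
  fixes f :: "complex \<Rightarrow> real"
  assumes c: "c \<noteq> 0" and f: "f \<in> borel_measurable borel"
  shows "(\<integral>x. f x \<partial>lborel) = c\<^sup>2 * (\<integral>x. f (t + c *\<^sub>R x) \<partial>lborel)"
proof -
  have [measurable]: "f \<in> borel_measurable borel" by (rule f)
  have "(\<integral>x. f x \<partial>lborel) = (\<integral>x. f x \<partial>density (distr lborel borel (\<lambda>x. t + c *\<^sub>R x)) (\<lambda>_. \<bar>c\<bar>^DIM(complex)))"
    using lborel_affine[OF c, of t] by simp
  also have "\<dots> = (\<integral>x. c\<^sup>2 *\<^sub>R f x \<partial>distr lborel borel (\<lambda>x. t + c *\<^sub>R x))"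
    by (subst integral_density) (auto simp: )
  also have "\<dots> = c\<^sup>2 * (\<integral>x. f (t + c *\<^sub>R x) \<partial>lborel)"
    by (subst integral_distr) auto
  finally show ?thesis .
qed

lemma open_half_ball: "open (half_ball z r n)"
proof -
  have "half_ball z r n = ball z r \<inter> {w. 0 < (w - z) \<bullet> n}" by (auto simp: half_ball_def)
  moreover have "open {w. 0 < (w - z) \<bullet> n}" by (intro open_Collect_less continuous_intros)
  ultimately show ?thesis by (metis open_Int open_ball)
qed

lemma half_ball_scale: "r > 0 \<Longrightarrow> indicator (half_ball z (2 * r) n) (z + r *\<^sub>R x) = indicator (half_ball 0 2 n) x"
  by (auto simp: half_ball_def dist_norm zero_less_mult_iff split: split_indicator)

lemma measure_half_ball_scale:
  assumes "r > 0"
  shows "measure lebesgue (half_ball z (2 * r) n) = r\<^sup>2 * measure lebesgue (half_ball 0 2 n)"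
proof -
  have [measurable]: "half_ball z r n \<in> sets borel" for z r n by (simp add: open_half_ball)
  have fin: "emeasure lborel (half_ball z r n) < \<infinity>" for z r
    by (rule emeasure_bounded_finite) (rule bounded_subset[of "ball z r"], auto simp: half_ball_def)
  have "measure lebesgue (half_ball z (2 * r) n) = (\<integral>x. indicator (half_ball z (2 * r) n) x \<partial>lborel)"
    by (simp add: measure_completion)
  also have "\<dots> = r\<^sup>2 * (\<integral>x. indicator (half_ball z (2 * r) n) (z + r *\<^sub>R x) \<partial>lborel)"
    by (rule lborel_integral_affine) (use assms in auto)
  also have "\<dots> = r\<^sup>2 * measure lebesgue (half_ball 0 2 n)"
    using assms by (simp add: half_ball_scale measure_completion)
  finally show ?thesis .
qed

lemma measure_half_ball_pos:
  assumes "cmod m = 1"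
  shows "measure lebesgue (half_ball 0 2 m) > 0"
proof -
  have "m \<in> half_ball 0 2 m" using assms by (auto simp: half_ball_def dot_square_norm)
  then have "\<not> negligible (half_ball 0 2 m)" using open_not_negligible[OF open_half_ball] by blast
  moreover have "half_ball 0 2 m \<in> lmeasurable"
    by (rule lmeasurable_open[OF _ open_half_ball])
      (rule bounded_subset[of "ball 0 2"], auto simp: half_ball_def)
  ultimately show ?thesis using negligible_iff_measure zero_less_measure_iff by blast
qed

definition blow_constant :: "complex \<Rightarrow> real" where
  "blow_constant n = (\<integral>x. indicator (half_ball 0 2 n) x * blow_kernel n x \<partial>lborel)"

lemma borel_blow_kernel [measurable]: "blow_kernel n \<in> borel_measurable borel"
proof -
  have "continuous_on UNIV (blow_kernel n)"
    unfolding blow_kernel_def[abs_def]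
    by (intro continuous_intros continuous_on_compose2[OF continuous_bell']
        continuous_on_compose2[OF smooth_real_continuous[OF smooth_real_hump]]) auto
  then show ?thesis by (rule borel_measurable_continuous_onI)
qed

lemma blow_kernel_bounded: "\<exists>K>0. \<forall>n x. \<bar>blow_kernel n x\<bar> \<le> K"
proof -
  obtain K where K: "K > 0" "\<And>x. \<bar>bell' x\<bar> \<le> K" using bell'_bounded by blast
  have "\<bar>blow_kernel n x\<bar> \<le> K * 1" for n x
    unfolding blow_kernel_def abs_mult using K bell_le_1 hump_nonneg by (intro mult_mono) auto
  then show ?thesis using K by auto
qed

lemma integrable_half_ball_kernel:
  "integrable lborel (\<lambda>x. indicator (half_ball 0 2 n) x * blow_kernel n x)"
proof -
  obtain K where K: "K > 0" "\<And>n x. \<bar>blow_kernel n x\<bar> \<le> K" using blow_kernel_bounded by blast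
  have "emeasure lborel (half_ball 0 2 n) < \<infinity>"
    by (rule emeasure_bounded_finite) (rule bounded_subset[of "ball 0 2"], auto simp: half_ball_def)
  then have "integrable lborel (\<lambda>x. indicator (half_ball 0 2 n) x *\<^sub>R blow_kernel n x)"
    by (intro integrableI_bounded_set_indicator[where B = K]) (use K in \<open>auto simp: open_half_ball\<close>)
  then show ?thesis by simp
qed

text \<open>
  On the half-disc the bump decreases in the direction \<open>n\<close>, so the integrand is never
  positive, and it is negative on the open half-square.
\<close>
lemma blow_constant_neg:
  assumes n: "cmod n = 1" shows "blow_constant n < 0"
proof -
  let ?f = "\<lambda>x. - (indicator (half_ball 0 2 n) x * blow_kernel n x)"
  have f: "integrable lborel ?f" using integrable_half_ball_kernel by (rule integrable_minus)
  have nonneg: "?f x \<ge> 0" for x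
    using bell_deriv_nonpos[of "x \<bullet> n"] hump_nonneg[of "-1" 1 "x \<bullet> (\<i> * n)"]
    by (auto simp: half_ball_def blow_kernel_def mult_le_0_iff split: split_indicator)
  have "(\<integral>x. ?f x \<partial>lborel) \<noteq> 0"
  proof
    assume "(\<integral>x. ?f x \<partial>lborel) = 0"
    then have ae: "AE x in lborel. ?f x = 0" using integral_nonneg_eq_0_iff_AE[OF f] nonneg by auto
    define U where "U = {x. 0 < x \<bullet> n} \<inter> {x. x \<bullet> n < 1} \<inter> {x. -1 < x \<bullet> (\<i> * n)} \<inter> {x. x \<bullet> (\<i> * n) < 1}"
    have U: "open U" unfolding U_def by (intro open_Int open_Collect_less continuous_intros)
    have nn: "n \<bullet> n = 1" using n by (simp add: dot_square_norm)
    have "(1/2) *\<^sub>R n \<in> U" by (simp add: U_def nn) (simp add: inner_complex_def)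
    have "?f x \<noteq> 0" if "x \<in> U" for x
    proof -
      have "x \<in> half_ball 0 2 n" using that frame_bound[OF n, of x] by (auto simp: U_def half_ball_def)
      then show ?thesis using that bell_deriv_neg[of "x \<bullet> n"] hump_pos_iff[of "-1" 1 "x \<bullet> (\<i> * n)"]
        by (auto simp: U_def blow_kernel_def)
    qed
    then have "AE x in lborel. x \<notin> U" using ae by (auto elim: eventually_mono)
    then have "AE x in lebesgue. x \<notin> U" by (rule AE_completion)
    then have "U \<in> null_sets lebesgue" using U by (subst AE_iff_null_sets) auto
    then show False using open_not_negligible[OF U] \<open>(1/2) *\<^sub>R n \<in> U\<close> by (auto simp: negligible_iff_null_sets)
  qed
  moreover have "(\<integral>x. ?f x \<partial>lborel) \<ge> 0" by (rule Bochner_Integration.integral_nonneg) (rule nonneg)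
  ultimately show ?thesis by (simp add: blow_constant_def)
qed

lemma half_ball_kernel_integral:
  assumes r: "r > 0"
  shows "(\<integral>w. indicator (half_ball z (2 * r) n) w * blow_kernel n ((w - z) /\<^sub>R r) \<partial>lborel) = r\<^sup>2 * blow_constant n"
    "(\<integral>w. indicator (half_ball z (2 * r) (- n)) w * blow_kernel n ((w - z) /\<^sub>R r) \<partial>lborel) = - r\<^sup>2 * blow_constant n"
proof -
  have [measurable]: "half_ball z r n \<in> sets borel" for z r n by (simp add: open_half_ball)
  have m: "(\<lambda>w. indicator (half_ball z (2 * r) m) w * blow_kernel n ((w - z) /\<^sub>R r)) \<in> borel_measurable borel" for m
    by measurable
  have *: "(\<integral>w. indicator (half_ball z (2 * r) m) w * blow_kernel n ((w - z) /\<^sub>R r) \<partial>lborel) =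
     r\<^sup>2 * (\<integral>x. indicator (half_ball 0 2 m) x * blow_kernel n x \<partial>lborel)" for m
    using lborel_integral_affine[OF _ m, where c = r and t = z] r by (simp add: half_ball_scale)
  show "(\<integral>w. indicator (half_ball z (2 * r) n) w * blow_kernel n ((w - z) /\<^sub>R r) \<partial>lborel) = r\<^sup>2 * blow_constant n"
    using * by (simp add: blow_constant_def)
  have i: "indicator (half_ball 0 2 (- n)) (0 + (-1) *\<^sub>R x) = (indicator (half_ball 0 2 n) x :: real)" for x
    by (auto simp: half_ball_def split: split_indicator)
  have k: "blow_kernel n (0 + (-1) *\<^sub>R x) = - blow_kernel n x" for x
    by (simp add: blow_kernel_def bell_odd bell_even)
  have m': "(\<lambda>x. indicator (half_ball 0 2 (- n)) x * blow_kernel n x) \<in> borel_measurable borel" by measurable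
  have "(\<integral>x. indicator (half_ball 0 2 (- n)) x * blow_kernel n x \<partial>lborel) = - blow_constant n"
    using lborel_integral_affine[OF _ m', where c = "-1" and t = 0] unfolding i k by (simp add: blow_constant_def)
  then show "(\<integral>w. indicator (half_ball z (2 * r) (- n)) w * blow_kernel n ((w - z) /\<^sub>R r) \<partial>lborel) = - r\<^sup>2 * blow_constant n"
    using * by simp
qed

text \<open>
  Replacing \<open>v\<close> by its approximate limit on the half-disc costs at most the integral of
  \<open>\<bar>v - a\<bar>\<close> times the bound for the kernel.
\<close>
lemma blow_up_half:
  assumes li: "locally_integrable v" and n: "cmod n = 1" and m: "cmod m = 1"
    and K: "K > 0" "\<And>x. \<bar>blow_kernel n x\<bar> \<le> K"
    and r: "r > 0" and sub: "cball z (2 * r) \<subseteq> uhp"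
  defines "k \<equiv> \<lambda>w. blow_kernel n ((w - z) /\<^sub>R r)"
  shows "set_integrable lebesgue (half_ball z (2 * r) m) (\<lambda>w. v w * k w)"
    and "\<bar>(LINT w:half_ball z (2 * r) m|lebesgue. v w * k w) - a * (LINT w:half_ball z (2 * r) m|lebesgue. k w)\<bar>
      \<le> K * (LINT w:half_ball z (2 * r) m|lebesgue. \<bar>v w - a\<bar>)"
proof -
  let ?H = "half_ball z (2 * r) m"
  have H[measurable]: "?H \<in> sets borel" by (simp add: open_half_ball)
  have sub': "?H \<subseteq> cball z (2 * r)" by (auto simp: half_ball_def)
  have "set_integrable lebesgue (cball z (2 * r)) v" using li sub by (simp add: locally_integrable_def)
  then have v: "set_integrable lebesgue ?H v" by (rule set_integrable_subset) (use sub' H in auto)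
  have kb[measurable]: "k \<in> borel_measurable borel" unfolding k_def by measurable
  then have km: "k \<in> borel_measurable lebesgue" by (simp add: measurable_completion)
  have one: "set_integrable lebesgue ?H (\<lambda>w. 1 :: real)"
  proof -
    have "emeasure lebesgue ?H < \<infinity>"
      using emeasure_bounded_finite[of ?H] bounded_subset[OF bounded_cball sub'] H by simp
    then show ?thesis by (simp add: set_integrable_def H)
  qed
  have mult: "set_integrable lebesgue ?H (\<lambda>w. f w * k w)" if "set_integrable lebesgue ?H f" for f :: "complex \<Rightarrow> real"
  proof -
    have "integrable lebesgue (\<lambda>w. K * (indicator ?H w * f w))" using that by (simp add: set_integrable_def)
    moreover have "(\<lambda>w. indicator ?H w * f w) \<in> borel_measurable lebesgue"
      using that by (simp add: set_integrable_def borel_measurable_integrable)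
    then have "(\<lambda>w. (indicator ?H w * f w) * k w) \<in> borel_measurable lebesgue" using km by (rule borel_measurable_times)
    moreover have "AE w in lebesgue. norm ((indicator ?H w * f w) * k w) \<le> norm (K * (indicator ?H w * f w))"
    proof (rule AE_I2)
      fix w
      have "\<bar>indicator ?H w * f w\<bar> * \<bar>k w\<bar> \<le> \<bar>indicator ?H w * f w\<bar> * K"
        using K by (intro mult_left_mono) (auto simp: k_def)
      then show "norm ((indicator ?H w * f w) * k w) \<le> norm (K * (indicator ?H w * f w))"
        using K(1) by (simp add: abs_mult mult.commute)
    qed
    ultimately have "integrable lebesgue (\<lambda>w. (indicator ?H w * f w) * k w)" by (rule Bochner_Integration.integrable_bound)
    then show ?thesis by (simp add: set_integrable_def mult.assoc)
  qed
  show vk: "set_integrable lebesgue ?H (\<lambda>w. v w * k w)" by (rule mult[OF v])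
  have kk: "set_integrable lebesgue ?H (\<lambda>w. a * k w)" using mult[OF one] by simp
  have va: "set_integrable lebesgue ?H (\<lambda>w. \<bar>v w - a\<bar>)"
  proof -
    have "set_integrable lebesgue ?H (\<lambda>w. a * 1)" by (rule set_integrable_mult_right) (rule one)
    then have "set_integrable lebesgue ?H (\<lambda>w. v w - a)" using set_integral_diff(1)[OF v] by simp
    then show ?thesis by (rule set_integrable_abs)
  qed
  have "(LINT w:?H|lebesgue. v w * k w) - a * (LINT w:?H|lebesgue. k w) = (LINT w:?H|lebesgue. v w * k w - a * k w)"
    using set_integral_diff(2)[OF vk kk] by simp
  also have "\<bar>\<dots>\<bar> \<le> (LINT w:?H|lebesgue. K * \<bar>v w - a\<bar>)"
    unfolding set_lebesgue_integral_def
  proof (rule order_trans[OF integral_abs_bound])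
    show "(\<integral>w. \<bar>indicat_real ?H w *\<^sub>R (v w * k w - a * k w)\<bar> \<partial>lebesgue)
      \<le> (\<integral>w. indicat_real ?H w *\<^sub>R (K * \<bar>v w - a\<bar>) \<partial>lebesgue)"
    proof (rule integral_mono')
      show "integrable lebesgue (\<lambda>w. indicat_real ?H w *\<^sub>R (K * \<bar>v w - a\<bar>))"
        using set_integrable_mult_right[OF va, of K] by (simp add: set_integrable_def)
      fix w
      have "\<bar>v w * k w - a * k w\<bar> = \<bar>v w - a\<bar> * \<bar>k w\<bar>" by (simp add: abs_mult flip: left_diff_distrib)
      also have "\<dots> \<le> \<bar>v w - a\<bar> * K" using K by (intro mult_left_mono) (auto simp: k_def)
      finally show "\<bar>indicat_real ?H w *\<^sub>R (v w * k w - a * k w)\<bar> \<le> indicat_real ?H w *\<^sub>R (K * \<bar>v w - a\<bar>)"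
        by (auto split: split_indicator simp: mult.commute)
    qed (use K in \<open>auto split: split_indicator\<close>)
  qed
  finally show "\<bar>(LINT w:?H|lebesgue. v w * k w) - a * (LINT w:?H|lebesgue. k w)\<bar>
      \<le> K * (LINT w:?H|lebesgue. \<bar>v w - a\<bar>)" by simp
qed

text \<open>
  After scaling, \<open>v\<close> tends to \<open>a\<close> on one half-disc and to \<open>b\<close> on the
  other, and the kernel has opposite integrals over the two.
\<close>
lemma blow_up:
  assumes li: "locally_integrable v" and n: "cmod n = 1" and z: "z \<in> uhp"
    and a: "approx_limit_along v z n a" and b: "approx_limit_along v z (- n) b"
  shows "((\<lambda>r. d_current v (blow_form z n r) / r) \<longlongrightarrow> (a - b) * blow_constant n) (at_right 0)"
proof -
  obtain K where K: "K > 0" "\<And>n x. \<bar>blow_kernel n x\<bar> \<le> K" using blow_kernel_bounded by blast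
  have "open uhp" unfolding uhp_def by (intro open_Collect_less continuous_intros)
  then obtain e where e: "e > 0" "cball z e \<subseteq> uhp" using z open_contains_cball by blast
  define E where "E m c r = (LINT w:half_ball z r m|lebesgue. \<bar>v w - c\<bar>) / measure lebesgue (half_ball z r m)" for m c r
  define m0 where "m0 m = measure lebesgue (half_ball 0 2 m)" for m
  have lim2: "filterlim (\<lambda>r::real. 2 * r) (at_right 0) (at_right 0)"
    unfolding filterlim_at by (auto intro!: tendsto_eq_intros eventually_at_right_less simp: eventually_at_filter)
  have "((\<lambda>r. E n a (2 * r)) \<longlongrightarrow> 0) (at_right 0)" "((\<lambda>r. E (- n) b (2 * r)) \<longlongrightarrow> 0) (at_right 0)"
    using filterlim_compose[OF a[unfolded approx_limit_along_def] lim2]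
      filterlim_compose[OF b[unfolded approx_limit_along_def] lim2] by (simp_all add: E_def)
  then have lim: "((\<lambda>r. K * m0 n * E n a (2 * r) + K * m0 (- n) * E (- n) b (2 * r)) \<longlongrightarrow> K * m0 n * 0 + K * m0 (- n) * 0) (at_right 0)"
    by (intro tendsto_intros)
  have main: "\<bar>d_current v (blow_form z n r) / r - (a - b) * blow_constant n\<bar>
      \<le> K * m0 n * E n a (2 * r) + K * m0 (- n) * E (- n) b (2 * r)" if r: "0 < r" "r < e / 2" for r
  proof -
    have sub: "cball z (2 * r) \<subseteq> uhp" using e(2) r by (auto intro: order_trans)
    let ?k = "\<lambda>w. blow_kernel n ((w - z) /\<^sub>R r)"
    let ?H = "half_ball z (2 * r) n" and ?H' = "half_ball z (2 * r) (- n)"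
    have nm: "cmod (- n) = 1" using n by simp
    note h = blow_up_half[OF li n n K r(1) sub] and h' = blow_up_half[OF li n nm K r(1) sub]
    \<comment> \<open>On the line between the half-discs the kernel vanishes because the derivative of an even bump is 0 there.\<close>
    have ksupp: "?k w = 0" if "w \<notin> ?H" "w \<notin> ?H'" for w
    proof (cases "dist z w < 2 * r")
      case True
      then have "(w - z) \<bullet> n = 0" using that by (auto simp: half_ball_def)
      then show ?thesis by (simp add: blow_kernel_def bell'_def)
    next
      case False
      have "cmod ((w - z) /\<^sub>R r) = cmod (w - z) / r" by (rule cmod_scale_inverse[OF r(1)])
      moreover have "cmod (w - z) \<ge> 2 * r" using False by (simp add: dist_norm norm_minus_commute)
      ultimately have "cmod ((w - z) /\<^sub>R r) \<ge> 2" using r by (simp add: le_divide_eq)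
      then show ?thesis by (rule blow_kernel_support[OF n])
    qed
    have split: "indicator uhp w *\<^sub>R (v w * ext_deriv (blow_form z n r) w) =
       (1 / r) * (indicator ?H w *\<^sub>R (v w * ?k w) + indicator ?H' w *\<^sub>R (v w * ?k w))" for w
    proof -
      have "\<not> (w \<in> ?H \<and> w \<in> ?H')" by (auto simp: half_ball_def)
      moreover have "w \<in> uhp" if "w \<in> ?H \<or> w \<in> ?H'" using that sub by (force simp: half_ball_def)
      ultimately show ?thesis using ksupp[of w] ext_deriv_blow_form[OF n r(1), of z w]
        by (auto split: split_indicator)
    qed
    have d: "d_current v (blow_form z n r) = (1 / r) * ((LINT w:?H|lebesgue. v w * ?k w) + (LINT w:?H'|lebesgue. v w * ?k w))"
      unfolding d_current_def set_lebesgue_integral_def split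
      using h(1) h'(1) by (simp add: set_integrable_def)
    have [measurable]: "half_ball z r n \<in> sets borel" for z r n by (simp add: open_half_ball)
    have leb: "(LINT w:half_ball z (2 * r) m|lebesgue. ?k w) = (\<integral>w. indicator (half_ball z (2 * r) m) w * ?k w \<partial>lborel)" for m
      unfolding set_lebesgue_integral_def by (subst integral_completion) (auto)
    have k1: "(LINT w:?H|lebesgue. ?k w) = r\<^sup>2 * blow_constant n" and k2: "(LINT w:?H'|lebesgue. ?k w) = - r\<^sup>2 * blow_constant n"
      unfolding leb by (rule half_ball_kernel_integral[OF r(1)])+
    have m0: "m0 m > 0" if "cmod m = 1" for m
      unfolding m0_def by (rule measure_half_ball_pos[OF that])
    have E: "(LINT w:half_ball z (2 * r) m|lebesgue. \<bar>v w - c\<bar>) = r\<^sup>2 * m0 m * E m c (2 * r)" if "cmod m = 1" for m c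
      unfolding E_def measure_half_ball_scale[OF r(1)] using m0[OF that] r by (simp add: m0_def)
    have "d_current v (blow_form z n r) / r - (a - b) * blow_constant n =
      (1 / r\<^sup>2) * (((LINT w:?H|lebesgue. v w * ?k w) - a * (LINT w:?H|lebesgue. ?k w)) +
         ((LINT w:?H'|lebesgue. v w * ?k w) - b * (LINT w:?H'|lebesgue. ?k w)))"
      unfolding d k1 k2 using r by (simp add: field_simps power2_eq_square)
    also have "\<bar>\<dots>\<bar> \<le> (1 / r\<^sup>2) * (K * (LINT w:?H|lebesgue. \<bar>v w - a\<bar>) + K * (LINT w:?H'|lebesgue. \<bar>v w - b\<bar>))"
      unfolding abs_mult using h(2)[of a] h'(2)[of b] by (intro mult_mono) auto
    also have "\<dots> = K * m0 n * E n a (2 * r) + K * m0 (- n) * E (- n) b (2 * r)"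
      unfolding E[OF n] E[OF nm] using r by (simp add: field_simps)
    finally show ?thesis .
  qed
  have "((\<lambda>r. d_current v (blow_form z n r) / r - (a - b) * blow_constant n) \<longlongrightarrow> 0) (at_right 0)"
  proof (rule Lim_null_comparison)
    show "\<forall>\<^sub>F r in at_right 0. norm (d_current v (blow_form z n r) / r - (a - b) * blow_constant n)
        \<le> K * m0 n * E n a (2 * r) + K * m0 (- n) * E (- n) b (2 * r)"
      unfolding eventually_at_right_field by (rule exI[of _ "e / 2"]) (use main e in auto)
  qed (use lim in simp)
  then show ?thesis by (simp add: LIM_zero_iff)
qed

section \<open>Moebius transformations\<close>

lemma open_uhp: "open uhp" unfolding uhp_def by (intro open_Collect_less continuous_intros)

lemma connected_uhp: "connected uhp"
  unfolding uhp_def by (intro convex_connected convex_halfspace_Im_gt)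

lemma psl2rE:
  assumes "g \<in> psl2r"
  obtains a b c d :: real where "a * d - b * c = 1"
    "g = (\<lambda>z. (of_real a * z + of_real b) / (of_real c * z + of_real d))"
  using assms unfolding psl2r_def by blast

lemma moebius_denominator:
  fixes a b c d :: real
  assumes "a * d - b * c = 1" "z \<in> uhp"
  shows "of_real c * z + of_real d \<noteq> 0"
proof
  assume "of_real c * z + of_real d = 0"
  then have "c * Im z = 0" "c * Re z + d = 0" by (auto simp: complex_eq_iff)
  then have "c = 0" "d = 0" using assms(2) by (auto simp: uhp_def)
  then show False using assms(1) by simp
qed

lemma moebius_Im:
  fixes a b c d :: real
  assumes "a * d - b * c = 1" "z \<in> uhp"
  shows "Im ((of_real a * z + of_real b) / (of_real c * z + of_real d)) = Im z / (cmod (of_real c * z + of_real d))\<^sup>2"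
proof -
  have "Im ((of_real a * z + of_real b) / (of_real c * z + of_real d)) =
    ((a * d - b * c) * Im z) / (cmod (of_real c * z + of_real d))\<^sup>2"
    by (simp add: Im_divide cmod_power2 algebra_simps)
  then show ?thesis using assms(1) by simp
qed

lemma moebius_difference:
  fixes a b c d :: real
  assumes "a * d - b * c = 1" "z \<in> uhp" "w \<in> uhp"
  shows "(of_real a * z + of_real b) / (of_real c * z + of_real d) -
    (of_real a * w + of_real b) / (of_real c * w + of_real d) =
    (z - w) / ((of_real c * z + of_real d) * (of_real c * w + of_real d))"
proof -
  have "(of_real a * z + of_real b) * (of_real c * w + of_real d) -
     (of_real a * w + of_real b) * (of_real c * z + of_real d) = of_real (a * d - b * c) * (z - w)"
    by (simp add: algebra_simps)
  then show ?thesis using moebius_denominator[OF assms(1)] assms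
    by (simp add: diff_frac_eq)
qed

lemma psl2r_maps_uhp: "g \<in> psl2r \<Longrightarrow> z \<in> uhp \<Longrightarrow> g z \<in> uhp"
proof (elim psl2rE)
  fix a b c d :: real assume *: "a * d - b * c = 1" "z \<in> uhp"
    "g = (\<lambda>z. (of_real a * z + of_real b) / (of_real c * z + of_real d))"
  then show "g z \<in> uhp" using moebius_Im[OF *(1,2)] moebius_denominator[OF *(1,2)] by (simp add: uhp_def)
qed

lemma psl2r_isometry:
  assumes g: "g \<in> psl2r" and z: "z \<in> uhp" and w: "w \<in> uhp"
  shows "hdist (g z) (g w) = hdist z w"
  using g
proof (rule psl2rE)
  fix a b c d :: real assume *: "a * d - b * c = 1"
    and gg: "g = (\<lambda>z. (of_real a * z + of_real b) / (of_real c * z + of_real d))"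
  have nz: "of_real c * z + of_real d \<noteq> 0" "of_real c * w + of_real d \<noteq> 0"
    using moebius_denominator[OF *] z w by auto
  have I: "Im (g z) = Im z / (cmod (of_real c * z + of_real d))\<^sup>2" "Im (g w) = Im w / (cmod (of_real c * w + of_real d))\<^sup>2"
    using moebius_Im[OF *] z w by (simp_all add: gg)
  have D: "cmod (g z - g w) = cmod (z - w) / (cmod (of_real c * z + of_real d) * cmod (of_real c * w + of_real d))"
    using moebius_difference[OF * z w] by (simp add: gg norm_divide norm_mult)
  show ?thesis unfolding hdist_def I D using nz by (simp add: power_divide power_mult_distrib)
qed

lemma psl2r_holomorphic: "g \<in> psl2r \<Longrightarrow> g holomorphic_on uhp"
proof (elim psl2rE)
  fix a b c d :: real assume *: "a * d - b * c = 1"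
    "g = (\<lambda>z. (of_real a * z + of_real b) / (of_real c * z + of_real d))"
  show "g holomorphic_on uhp" unfolding *(2)
    by (intro holomorphic_intros) (use moebius_denominator[OF *(1)] in auto)
qed

lemma psl2r_id: "(\<lambda>z. z) \<in> psl2r"
  unfolding psl2r_def by (rule CollectI, rule exI[of _ 1], rule exI[of _ 0], rule exI[of _ 0], rule exI[of _ 1]) simp

lemma psl2r_compose:
  assumes "g \<in> psl2r" "h \<in> psl2r"
  shows "\<exists>k\<in>psl2r. \<forall>z\<in>uhp. k z = g (h z)"
proof -
  obtain a b c d :: real where 1: "a * d - b * c = 1"
    and g: "g = (\<lambda>z. (of_real a * z + of_real b) / (of_real c * z + of_real d))" using assms(1) by (rule psl2rE)
  obtain a' b' c' d' :: real where 2: "a' * d' - b' * c' = 1"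
    and h: "h = (\<lambda>z. (of_real a' * z + of_real b') / (of_real c' * z + of_real d'))" using assms(2) by (rule psl2rE)
  define A where "A = a * a' + b * c'" define B where "B = a * b' + b * d'"
  define C where "C = c * a' + d * c'" define D where "D = c * b' + d * d'"
  have "A * D - B * C = (a * d - b * c) * (a' * d' - b' * c')" by (simp add: A_def B_def C_def D_def algebra_simps)
  then have det: "A * D - B * C = 1" using 1 2 by simp
  let ?k = "\<lambda>z. (of_real A * z + of_real B) / (of_real C * z + of_real D)"
  have "?k \<in> psl2r" unfolding psl2r_def using det by blast
  moreover have "?k z = g (h z)" if z: "z \<in> uhp" for z
  proof -
    have n: "of_real c' * z + of_real d' \<noteq> 0" by (rule moebius_denominator[OF 2 z])
    have hz: "h z * (of_real c' * z + of_real d') = of_real a' * z + of_real b'" using n by (simp add: h)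
    have "(of_real a * h z + of_real b) * (of_real c' * z + of_real d') =
        of_real a * (h z * (of_real c' * z + of_real d')) + of_real b * (of_real c' * z + of_real d')"
      by (simp only: distrib_right mult.assoc)
    also have "\<dots> = of_real A * z + of_real B"
      unfolding hz A_def B_def of_real_add of_real_mult by algebra
    finally have "of_real A * z + of_real B = (of_real a * h z + of_real b) * (of_real c' * z + of_real d')" ..
    moreover have "of_real C * z + of_real D = (of_real c * h z + of_real d) * (of_real c' * z + of_real d')"
    proof -
      have "(of_real c * h z + of_real d) * (of_real c' * z + of_real d') =
        of_real c * (h z * (of_real c' * z + of_real d')) + of_real d * (of_real c' * z + of_real d')"
        by (simp only: distrib_right mult.assoc)
      also have "\<dots> = of_real C * z + of_real D"
        unfolding hz C_def D_def of_real_add of_real_mult by algebra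
      finally show ?thesis ..
    qed
    ultimately show ?thesis using n by (simp add: g)
  qed
  ultimately show ?thesis by (intro bexI[of _ ?k] ballI)
qed

lemma moebius_inverse:
  fixes a b c d :: real and z :: complex
  assumes 1: "a * d - b * c = 1" and n: "of_real c * z + of_real d \<noteq> 0"
  defines "w \<equiv> (of_real a * z + of_real b) / (of_real c * z + of_real d)"
  shows "(of_real d * w + of_real (- b)) / (of_real (- c) * w + of_real a) = z"
proof -
  let ?n = "of_real c * z + of_real d :: complex"
  have wn: "w * ?n = of_real a * z + of_real b" using n by (simp add: w_def)
  have det: "of_real a * of_real d - of_real b * of_real c = (1::complex)"
    using 1 by (metis of_real_1 of_real_diff of_real_mult)
  have "(of_real d * w + of_real (- b)) * ?n = of_real d * (w * ?n) - of_real b * ?n"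
    unfolding of_real_minus by algebra
  also have "\<dots> = (of_real a * of_real d - of_real b * of_real c) * z"
    unfolding wn of_real_minus by algebra
  finally have N: "(of_real d * w + of_real (- b)) * ?n = z" by (simp only: det mult_1)
  have "(of_real (- c) * w + of_real a) * ?n = - of_real c * (w * ?n) + of_real a * ?n"
    unfolding of_real_minus by algebra
  also have "\<dots> = of_real a * of_real d - of_real b * of_real c"
    unfolding wn of_real_minus by algebra
  finally have D: "(of_real (- c) * w + of_real a) * ?n = 1" by (simp only: det)
  have "(of_real d * w + of_real (- b)) / (of_real (- c) * w + of_real a) =
    ((of_real d * w + of_real (- b)) * ?n) / ((of_real (- c) * w + of_real a) * ?n)"
    using n by simp
  then show ?thesis unfolding N D by simp
qed

lemma psl2r_inverse:
  assumes "g \<in> psl2r"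
  shows "\<exists>k\<in>psl2r. \<forall>z\<in>uhp. k (g z) = z \<and> g (k z) = z"
proof -
  obtain a b c d :: real where 1: "a * d - b * c = 1"
    and g: "g = (\<lambda>z. (of_real a * z + of_real b) / (of_real c * z + of_real d))" using assms(1) by (rule psl2rE)
  have 2: "d * a - (-b) * (-c) = 1" using 1 by (simp add: algebra_simps)
  let ?k = "\<lambda>z. (of_real d * z + of_real (-b)) / (of_real (-c) * z + of_real a)"
  have k: "?k \<in> psl2r" unfolding psl2r_def using 2 by blast
  moreover have "?k (g z) = z" if z: "z \<in> uhp" for z
    using moebius_inverse[OF 1 moebius_denominator[OF 1 z]] by (simp add: g)
  moreover have "g (?k z) = z" if z: "z \<in> uhp" for z
    using moebius_inverse[OF 2 moebius_denominator[OF 2 z]] by (simp add: g)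
  ultimately show ?thesis by (intro bexI[of _ ?k] ballI conjI)
qed

text \<open>
  Cross-multiplying gives a quadratic polynomial with real coefficients that vanishes on the upper
  half-plane, hence identically.  Since numerator and denominator have no common zero, the
  denominators vanish at the same points, so that the conventional value 0 is taken at the same pole.
\<close>
lemma psl2r_eqI:
  assumes g: "g \<in> psl2r" and h: "h \<in> psl2r" and eq: "\<And>z. z \<in> uhp \<Longrightarrow> g z = h z"
  shows "g = h"
proof -
  obtain a b c d :: real where 1: "a * d - b * c = 1"
    and g: "g = (\<lambda>z. (of_real a * z + of_real b) / (of_real c * z + of_real d))" using g by (rule psl2rE)
  obtain a' b' c' d' :: real where 2: "a' * d' - b' * c' = 1"
    and h: "h = (\<lambda>z. (of_real a' * z + of_real b') / (of_real c' * z + of_real d'))" using h by (rule psl2rE)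
  have cross: "(of_real a * z + of_real b) * (of_real c' * z + of_real d') =
    (of_real a' * z + of_real b') * (of_real c * z + of_real d)" if "z \<in> uhp" for z
    using eq[OF that] moebius_denominator[OF 1 that] moebius_denominator[OF 2 that]
    by (simp add: g h frac_eq_eq)
  define P where "P = a * c' - a' * c" define Q where "Q = a * d' + b * c' - a' * d - b' * c"
  define R where "R = b * d' - b' * d"
  have poly: "of_real P * z\<^sup>2 + of_real Q * z + of_real R = 0" if "z \<in> uhp" for z :: complex
    using cross[OF that] by (simp add: P_def Q_def R_def algebra_simps power2_eq_square)
  have i: "- P + R = 0" "Q = 0" using poly[of \<i>] by (auto simp: uhp_def complex_eq_iff)
  have "- 4 * P + R = 0" using poly[of "2 * \<i>"] by (auto simp: uhp_def complex_eq_iff power2_eq_square)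
  then have PQR: "P = 0" "Q = 0" "R = 0" using i by auto
  have cross': "(of_real a * z + of_real b) * (of_real c' * z + of_real d') =
    (of_real a' * z + of_real b') * (of_real c * z + of_real d)" for z :: complex
  proof -
    have "(of_real a * z + of_real b) * (of_real c' * z + of_real d') -
      (of_real a' * z + of_real b') * (of_real c * z + of_real d) = of_real P * z\<^sup>2 + of_real Q * z + of_real R"
      by (simp add: P_def Q_def R_def algebra_simps power2_eq_square)
    then show ?thesis by (simp add: PQR)
  qed
  have nz: "of_real a * z + of_real b \<noteq> 0 \<or> of_real c * z + of_real d \<noteq> 0"
    if "a * d - b * c = 1" for z :: complex and a b c d :: real
  proof (rule ccontr)
    assume "\<not> ?thesis"
    then have "a * Im z = 0" "a * Re z + b = 0" "c * Im z = 0" "c * Re z + d = 0" by (auto simp: complex_eq_iff)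
    moreover have "a * d - b * c = a * (c * Re z + d) - c * (a * Re z + b)" by (simp add: algebra_simps)
    ultimately show False using that by simp
  qed
  have "g z = h z" for z
    using cross'[of z] nz[OF 1, of z] nz[OF 2, of z]
    by (cases "of_real c * z + of_real d = 0"; cases "of_real c' * z + of_real d' = 0")
       (auto simp: g h frac_eq_eq)
  then show ?thesis by blast
qed

section \<open>The deck group\<close>

lemma deck_psl2r: "g \<in> deck_group p \<Longrightarrow> g \<in> psl2r"
  and deck_invariant: "g \<in> deck_group p \<Longrightarrow> z \<in> uhp \<Longrightarrow> p (g z) = p z"
  by (auto simp: deck_group_def)

lemma deck_uhp: "g \<in> deck_group p \<Longrightarrow> z \<in> uhp \<Longrightarrow> g z \<in> uhp"
  by (simp add: deck_psl2r psl2r_maps_uhp)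

lemma deck_holomorphic: "g \<in> deck_group p \<Longrightarrow> g holomorphic_on uhp"
  by (simp add: deck_psl2r psl2r_holomorphic)

lemma deck_id: "(\<lambda>z. z) \<in> deck_group p" by (simp add: deck_group_def psl2r_id)

text \<open>
  The literal composition of two fractional linear functions takes another conventional value at a
  pole, hence the statement on the half-plane only.
\<close>
lemma deck_compose:
  assumes "g \<in> deck_group p" "h \<in> deck_group p"
  shows "\<exists>k\<in>deck_group p. \<forall>z\<in>uhp. k z = g (h z)"
proof -
  obtain k where k: "k \<in> psl2r" "\<forall>z\<in>uhp. k z = g (h z)" using psl2r_compose assms deck_psl2r by metis
  have "k \<in> deck_group p" using k assms deck_uhp deck_invariant by (auto simp: deck_group_def psl2r_maps_uhp)
  then show ?thesis using k by blast
qed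

lemma deck_inverse:
  assumes "g \<in> deck_group p"
  shows "\<exists>k\<in>deck_group p. \<forall>z\<in>uhp. k (g z) = z \<and> g (k z) = z"
proof -
  obtain k where k: "k \<in> psl2r" "\<forall>z\<in>uhp. k (g z) = z \<and> g (k z) = z" using psl2r_inverse assms deck_psl2r by metis
  have "p (k z) = p z" if "z \<in> uhp" for z
    using deck_invariant[OF assms psl2r_maps_uhp[OF k(1) that]] k(2) that by simp
  then have "k \<in> deck_group p" using k(1) by (simp add: deck_group_def)
  then show ?thesis using k by blast
qed

lemma surface_covering: "closed_hyperbolic_surface M p \<Longrightarrow> covering_space uhp p M"
  by (simp add: closed_hyperbolic_surface_def)

lemma surface_compact: "closed_hyperbolic_surface M p \<Longrightarrow> compact M"
  by (simp add: closed_hyperbolic_surface_def)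

lemma surface_transitive:
  "closed_hyperbolic_surface M p \<Longrightarrow> z \<in> uhp \<Longrightarrow> w \<in> uhp \<Longrightarrow> p z = p w \<Longrightarrow> \<exists>g\<in>deck_group p. g z = w"
  by (simp add: closed_hyperbolic_surface_def)

lemma surface_continuous: "closed_hyperbolic_surface M p \<Longrightarrow> continuous_on uhp p"
  using surface_covering covering_space_imp_continuous by blast

lemma surface_image: "closed_hyperbolic_surface M p \<Longrightarrow> p ` uhp = M"
  using surface_covering covering_space_imp_surjective by blast

text \<open>
Two lifts of the covering map that agree at one point are equal.
\<close>
lemma deck_unique:
  assumes M: "closed_hyperbolic_surface M p" and g: "g \<in> deck_group p" and h: "h \<in> deck_group p"
    and w: "w \<in> uhp" and eq: "g w = h w"
  shows "g = h"
proof (rule psl2r_eqI[OF deck_psl2r[OF g] deck_psl2r[OF h]])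
  fix z assume z: "z \<in> uhp"
  show "g z = h z"
  proof (rule covering_space_lift_unique[OF surface_covering[OF M], of g w h uhp p])
    show "continuous_on uhp g" "continuous_on uhp h"
      using g h deck_holomorphic holomorphic_on_imp_continuous_on by blast+
  qed (use M g h w z eq in \<open>auto simp: deck_invariant deck_uhp connected_uhp surface_continuous dest: surface_image\<close>)
qed

lemma surface_locally_injective:
  assumes M: "closed_hyperbolic_surface M p" and z: "z \<in> uhp"
  obtains V where "open V" "z \<in> V" "V \<subseteq> uhp" "inj_on p V"
proof -
  obtain T U q where *: "z \<in> T" "openin (top_of_set uhp) T" "homeomorphism T U p q"
    using covering_space_local_homeomorphism[OF surface_covering[OF M] z] by metis
  have "open T" "T \<subseteq> uhp" using *(2) open_uhp by (auto simp: openin_open_eq)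
  moreover have "inj_on p T" using *(3) by (metis homeomorphism_apply1 inj_on_inverseI)
  ultimately show ?thesis using that *(1) by blast
qed

section \<open>Hyperbolic and Euclidean distances\<close>

lemma hdist_refl_arg: "z \<in> uhp \<Longrightarrow> w \<in> uhp \<Longrightarrow> 1 + (cmod (z - w))\<^sup>2 / (2 * Im z * Im w) \<ge> 1"
  by (simp add: uhp_def)

lemma cosh_hdist: "z \<in> uhp \<Longrightarrow> w \<in> uhp \<Longrightarrow> cosh (hdist z w) = 1 + (cmod (z - w))\<^sup>2 / (2 * Im z * Im w)"
  unfolding hdist_def by (rule cosh_arcosh_real) (rule hdist_refl_arg)

lemma hdist_nonneg: "z \<in> uhp \<Longrightarrow> w \<in> uhp \<Longrightarrow> hdist z w \<ge> 0"
  unfolding hdist_def by (rule arcosh_nonneg_real) (rule hdist_refl_arg)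

lemma cosh_ge_quadratic: "1 + x\<^sup>2 / 2 \<le> cosh x" for x :: real
proof -
  have "1 + y\<^sup>2 / 2 \<le> cosh y" if y: "y \<ge> 0" for y :: real
  proof -
    define f where "f t = cosh t - 1 - t\<^sup>2 / 2" for t :: real
    have s: "t \<le> sinh t" if "t \<ge> 0" for t :: real
    proof -
      have "sinh 0 - 0 \<le> sinh t - t"
      proof (rule DERIV_nonneg_imp_nondecreasing[OF that])
        fix x :: real
        show "\<exists>y. ((\<lambda>x. sinh x - x) has_real_derivative y) (at x) \<and> 0 \<le> y"
          by (intro exI[of _ "cosh x - 1"] conjI) (auto intro!: derivative_eq_intros simp: cosh_real_ge_1)
      qed
      then show ?thesis by simp
    qed
    have "f 0 \<le> f y"
    proof (rule DERIV_nonneg_imp_nondecreasing[OF y])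
      fix x :: real assume "0 \<le> x"
      then show "\<exists>y. (f has_real_derivative y) (at x) \<and> 0 \<le> y"
        unfolding f_def by (intro exI[of _ "sinh x - x"] conjI) (auto intro!: derivative_eq_intros simp: s)
    qed
    then show ?thesis by (simp add: f_def)
  qed
  from this[of "\<bar>x\<bar>"] show ?thesis by simp
qed

lemma cosh_le_quadratic:
  fixes x :: real
  assumes x: "0 \<le> x" "x \<le> 1" shows "cosh x \<le> 1 + x\<^sup>2"
proof -
  have "exp x \<le> 1 + x + x\<^sup>2" using exp_bound[OF x] by simp
  moreover have "exp (- x) \<le> 1 - x + x\<^sup>2"
  proof -
    have "1 + x \<le> exp x" by (rule exp_ge_add_one_self)
    then have "exp (- x) \<le> 1 / (1 + x)" using x by (simp add: exp_minus field_simps)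
    also have "\<dots> \<le> 1 - x + x\<^sup>2"
    proof -
      have "(1 - x + x\<^sup>2) * (1 + x) = 1 + x ^ 3" by (simp add: algebra_simps power2_eq_square power3_eq_cube)
      then have "1 \<le> (1 - x + x\<^sup>2) * (1 + x)" using x by simp
      then show ?thesis using x by (simp add: divide_le_eq)
    qed
    finally show ?thesis .
  qed
  ultimately show ?thesis by (simp add: cosh_def)
qed

lemma dist_le_hdist:
  assumes M: "closed_hyperbolic_surface M p" and z: "z \<in> uhp" "w \<in> uhp"
  shows "dist (p z) (p w) \<le> hdist z w"
proof -
  have "dist (p z) (p w) = Inf {hdist z' w' | z' w'. z' \<in> uhp \<and> w' \<in> uhp \<and> p z' = p z \<and> p w' = p w}"
    using M z by (simp add: closed_hyperbolic_surface_def)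
  also have "\<dots> \<le> hdist z w"
    by (rule cInf_lower) (use z hdist_nonneg in \<open>auto intro!: bdd_belowI[of _ 0]\<close>)
  finally show ?thesis .
qed

lemma hdist_le_norm:
  assumes z: "z \<in> uhp" "w \<in> uhp" and m: "m > 0" "Im z \<ge> m" "Im w \<ge> m"
  shows "hdist z w \<le> cmod (z - w) / m"
proof -
  have "(hdist z w)\<^sup>2 / 2 \<le> (cmod (z - w))\<^sup>2 / (2 * Im z * Im w)"
    using cosh_ge_quadratic[of "hdist z w"] cosh_hdist[OF z] by simp
  also have "\<dots> \<le> (cmod (z - w))\<^sup>2 / (2 * m * m)"
    using m by (intro divide_left_mono mult_mono mult_pos_pos) auto
  finally have "(hdist z w)\<^sup>2 \<le> (cmod (z - w) / m)\<^sup>2" by (simp add: power_divide power2_eq_square)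
  then show ?thesis by (rule power2_le_imp_le) (use m in auto)
qed

lemma norm_le_hdist:
  assumes z: "z \<in> uhp" "w \<in> uhp" and R: "Im z \<le> R" "Im w \<le> R" and h: "hdist z w \<le> 1"
  shows "cmod (z - w) \<le> 2 * R * hdist z w"
proof -
  have p: "0 < Im z" "0 < Im w" using z by (auto simp: uhp_def)
  then have R0: "R > 0" using R by linarith
  have "(cmod (z - w))\<^sup>2 / (2 * Im z * Im w) \<le> (hdist z w)\<^sup>2"
    using cosh_le_quadratic[OF hdist_nonneg[OF z] h] cosh_hdist[OF z] by simp
  then have "(cmod (z - w))\<^sup>2 \<le> (hdist z w)\<^sup>2 * (2 * Im z * Im w)"
    using p by (simp add: divide_le_eq)
  also have "\<dots> \<le> (hdist z w)\<^sup>2 * (2 * R * R)"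
    using p R R0 by (intro mult_left_mono mult_mono) auto
  also have "\<dots> \<le> (2 * R * hdist z w)\<^sup>2" using R0 by (simp add: power2_eq_square algebra_simps)
  finally show ?thesis by (rule power2_le_imp_le) (use R0 hdist_nonneg[OF z] in auto)
qed

text \<open>
  The bound has to be uniform in the far point \<open>w\<close>, whose height is controlled only by
  \<open>Im z + \<bar>z - w\<bar>\<close>; this leads to the value of \<open>\<kappa>\<close>.
\<close>
lemma small_hdist_imp_close:
  assumes \<rho>: "\<rho> > 0" and Y: "Y > 0"
  shows "\<exists>\<eta>>0. \<forall>z\<in>uhp. \<forall>w\<in>uhp. Im z \<le> Y \<longrightarrow> hdist z w < \<eta> \<longrightarrow> cmod (z - w) < \<rho>"
proof -
  define \<kappa> where "\<kappa> = \<rho> / (2 * Y * (Y / \<rho> + 1))"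
  have k: "\<kappa> > 0" using assms by (simp add: \<kappa>_def add_pos_pos)
  have "cmod (z - w) < \<rho>" if z: "z \<in> uhp" "w \<in> uhp" "Im z \<le> Y" "hdist z w < arcosh (1 + \<kappa>)" for z w
  proof (rule ccontr)
    assume "\<not> ?thesis"
    then have D: "cmod (z - w) \<ge> \<rho>" by simp
    let ?D = "cmod (z - w)"
    have p: "0 < Im z" "0 < Im w" using z by (auto simp: uhp_def)
    have "cosh (hdist z w) < cosh (arcosh (1 + \<kappa>))"
      using z(4) hdist_nonneg[OF z(1,2)] by (intro cosh_real_strict_mono)
    then have "?D\<^sup>2 / (2 * Im z * Im w) < \<kappa>" using cosh_hdist[OF z(1,2)] k by (simp add: cosh_arcosh_real)
    then have "?D\<^sup>2 < \<kappa> * (2 * Im z * Im w)" using p by (simp add: divide_less_eq)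
    also have "\<dots> \<le> \<kappa> * (2 * Y * (Y + ?D))"
    proof -
      have "\<bar>Im z - Im w\<bar> \<le> ?D" using abs_Im_le_cmod[of "z - w"] by simp
      then show ?thesis using k p z(3) by (intro mult_left_mono mult_mono) auto
    qed
    also have "\<dots> \<le> \<kappa> * (2 * Y * ((Y / \<rho> + 1) * ?D))"
    proof -
      have "Y \<le> Y / \<rho> * ?D" using D \<rho> Y by (simp add: field_simps)
      then show ?thesis using k Y by (intro mult_left_mono) (auto simp: algebra_simps)
    qed
    also have "\<dots> = \<rho> * ?D"
    proof -
      have "2 * Y * (Y / \<rho> + 1) \<noteq> 0" using assms by (simp add: add_pos_pos less_imp_neq[symmetric])
      then show ?thesis unfolding \<kappa>_def by (simp add: field_simps)
    qed
    finally have "?D < \<rho>" using D \<rho> by (simp add: power2_eq_square mult_less_cancel_right)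
    then show False using D by simp
  qed
  moreover have "arcosh (1 + \<kappa>) > 0" using k arcosh_real_gt_1_iff[of "1 + \<kappa>"] by simp
  ultimately show ?thesis by blast
qed

text \<open>
  The distance of \<open>p z\<close> and \<open>p w\<close> is almost attained by the distance of two points
  in their fibres.  A deck transformation moves the first one to \<open>z\<close>; the second is then
  so close to \<open>z\<close> that it lies in a neighbourhood on which \<open>p\<close> is injective, and
  therefore it is \<open>w\<close>.
\<close>
lemma surface_local_isometry:
  assumes M: "closed_hyperbolic_surface M p" and z0: "z0 \<in> uhp"
  shows "\<exists>r>0. ball z0 r \<subseteq> uhp \<and> (\<forall>z\<in>ball z0 r. \<forall>w\<in>ball z0 r. hdist z w \<le> dist (p z) (p w))"
proof -
  obtain V where V: "open V" "z0 \<in> V" "V \<subseteq> uhp" "inj_on p V" using surface_locally_injective[OF M z0] .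
  obtain \<rho> where \<rho>: "\<rho> > 0" "ball z0 (2 * \<rho>) \<subseteq> V"
  proof -
    obtain e where "e > 0" "ball z0 e \<subseteq> V" using V open_contains_ball by blast
    then show ?thesis using that[of "e / 2"] by simp
  qed
  define Y where "Y = Im z0 + 2 * \<rho>"
  have Y: "Y > 0" using z0 \<rho> by (simp add: Y_def uhp_def add_pos_pos)
  have ImY: "Im z \<le> Y" if "z \<in> ball z0 (2 * \<rho>)" for z
    using that abs_Im_le_cmod[of "z0 - z"] by (simp add: Y_def dist_norm)
  obtain \<eta> where \<eta>: "\<eta> > 0" "\<And>z w. z \<in> uhp \<Longrightarrow> w \<in> uhp \<Longrightarrow> Im z \<le> Y \<Longrightarrow> hdist z w < \<eta> \<Longrightarrow> cmod (z - w) < \<rho>"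
    using small_hdist_imp_close[OF \<rho>(1) Y] by blast
  have "isCont p z0" using surface_continuous[OF M] open_uhp z0 continuous_on_eq_continuous_at by blast
  then obtain r0 where r0: "r0 > 0" "\<And>z. dist z z0 < r0 \<Longrightarrow> dist (p z) (p z0) < \<eta> / 2"
    unfolding continuous_at_eps_delta using \<eta>(1) by (metis half_gt_zero)
  define r where "r = min r0 \<rho>"
  have r: "r > 0" using r0 \<rho> by (simp add: r_def)
  have rsub: "ball z0 r \<subseteq> ball z0 (2 * \<rho>)" using \<rho>(1) by (auto simp: r_def)
  have sub: "ball z0 r \<subseteq> uhp" using rsub \<rho>(2) V(3) by blast
  have "hdist z w \<le> dist (p z) (p w)" if zw: "z \<in> ball z0 r" "w \<in> ball z0 r" for z w
  proof (rule field_le_epsilon)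
    fix e :: real assume e: "e > 0"
    have zu: "z \<in> uhp" "w \<in> uhp" using zw sub by auto
    have "dist (p z) (p z0) < \<eta> / 2" "dist (p w) (p z0) < \<eta> / 2"
      using r0(2)[of z] r0(2)[of w] zw by (simp_all add: r_def dist_commute)
    then have small: "dist (p z) (p w) < \<eta>" using dist_triangle2[of "p z" "p w" "p z0"] by linarith
    define X where "X = {hdist z' w' | z' w'. z' \<in> uhp \<and> w' \<in> uhp \<and> p z' = p z \<and> p w' = p w}"
    have "dist (p z) (p w) = Inf X" using M zu unfolding closed_hyperbolic_surface_def X_def by blast
    moreover have "X \<noteq> {}" using zu by (auto simp: X_def)
    ultimately obtain x where "x \<in> X" "x < dist (p z) (p w) + min e (\<eta> - dist (p z) (p w))"
      using cInf_lessD[of X "dist (p z) (p w) + min e (\<eta> - dist (p z) (p w))"] e small by auto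
    then obtain z' w' where zw': "z' \<in> uhp" "w' \<in> uhp" "p z' = p z" "p w' = p w"
      and h1: "hdist z' w' < dist (p z) (p w) + e" "hdist z' w' < \<eta>" by (auto simp: X_def)
    obtain g where g: "g \<in> deck_group p" "g z' = z" using surface_transitive[OF M zw'(1) zu(1) zw'(3)] by blast
    have gw: "g w' \<in> uhp" "p (g w') = p w" using g zw' by (auto simp: deck_uhp deck_invariant)
    have hg: "hdist z (g w') = hdist z' w'" using psl2r_isometry[OF deck_psl2r[OF g(1)] zw'(1,2)] g(2) by simp
    then have "cmod (z - g w') < \<rho>" using \<eta>(2)[OF zu(1) gw(1)] ImY zw(1) rsub h1(2) by (metis subsetD)
    moreover have "dist z0 z < \<rho>" using zw(1) by (simp add: r_def)
    ultimately have "dist z0 (g w') < 2 * \<rho>" using dist_triangle[of z0 "g w'" z] by (simp add: dist_norm)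
    then have "g w' \<in> V" "w \<in> V" using \<rho>(2) zw(2) rsub by auto
    then have "g w' = w" using V(4) gw(2) by (auto dest: inj_onD)
    then show "hdist z w \<le> dist (p z) (p w) + e" using hg h1(1) by simp
  qed
  then show ?thesis using r sub by blast
qed

section \<open>Pushing forward forms with small support\<close>

context
  fixes M :: "'m::metric_space set" and p :: "complex \<Rightarrow> 'm" and V :: "complex set" and \<psi> :: "complex \<Rightarrow> complex"
  assumes M: "closed_hyperbolic_surface M p" and V: "open V" "V \<subseteq> uhp" "inj_on p V"
    and \<psi>: "test_form \<psi>" "closure {z. \<psi> z \<noteq> 0} \<subseteq> V"
begin

lemma push_support: "\<psi> z \<noteq> 0 \<Longrightarrow> z \<in> V"
  using \<psi>(2) closure_subset[of "{z. \<psi> z \<noteq> 0}"] by blast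

text \<open>
  If the support lies in a set on which \<open>p\<close> is injective, then at most one deck transformation
  moves a given point into it.
\<close>
lemma pushforward_single_term:
  assumes z: "z \<in> uhp" and g: "g \<in> deck_group p" "g z \<in> V"
  shows "pushforward p \<psi> z = pullback g \<psi> z"
proof -
  have only: "h = g" if h: "h \<in> deck_group p" "\<psi> (h z) \<noteq> 0" for h
  proof (rule deck_unique[OF M h(1) g(1) z])
    show "h z = g z"
      by (rule inj_onD[OF V(3) _ push_support[OF h(2)] g(2)])
        (simp add: deck_invariant[OF h(1) z] deck_invariant[OF g(1) z])
  qed
  show ?thesis
  proof (cases "\<psi> (g z) = 0")
    case True
    then have "{h \<in> deck_group p. \<psi> (h z) \<noteq> 0} = {}" using only by blast
    then show ?thesis using z True by (simp only: pushforward_def pullback_def) simp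
  next
    case False
    then have "{h \<in> deck_group p. \<psi> (h z) \<noteq> 0} = {g}" using only g(1) by blast
    then show ?thesis using z by (simp only: pushforward_def) simp
  qed
qed

lemma pushforward_no_term:
  assumes "\<And>g. g \<in> deck_group p \<Longrightarrow> \<psi> (g z) = 0"
  shows "pushforward p \<psi> z = 0"
proof -
  have "{h \<in> deck_group p. \<psi> (h z) \<noteq> 0} = {}" using assms by auto
  then show ?thesis by (simp only: pushforward_def) simp
qed

lemma pushforward_on: "z \<in> V \<Longrightarrow> pushforward p \<psi> z = \<psi> z"
  using pushforward_single_term[of z "\<lambda>z. z"] V(2) by (auto simp: deck_id pullback_def)

lemma pushforward_nonzero:
  assumes "pushforward p \<psi> z \<noteq> 0"
  shows "z \<in> uhp" "p z \<in> p ` closure {z. \<psi> z \<noteq> 0}"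
proof -
  show z: "z \<in> uhp" using assms by (auto simp: pushforward_def split: if_splits)
  obtain g where g: "g \<in> deck_group p" "\<psi> (g z) \<noteq> 0" using assms pushforward_no_term by blast
  then have "g z \<in> closure {z. \<psi> z \<noteq> 0}" using closure_subset[of "{z. \<psi> z \<noteq> 0}"] by blast
  moreover have "p z = p (g z)" using deck_invariant[OF g(1) z] by simp
  ultimately show "p z \<in> p ` closure {z. \<psi> z \<noteq> 0}" by blast
qed

lemma compact_push_support: "compact (p ` closure {z. \<psi> z \<noteq> 0})"
  using \<psi> V(2) surface_continuous[OF M]
  by (intro compact_continuous_image) (auto simp: test_form_def intro: continuous_on_subset)

lemma form_support_pushforward: "form_support p (pushforward p \<psi>) \<subseteq> p ` closure {z. \<psi> z \<noteq> 0}"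
  unfolding form_support_def
  by (rule closure_minimal) (use pushforward_nonzero compact_push_support compact_imp_closed in auto)

lemma Ck_on_pullback:
  assumes g: "g \<in> deck_group p" and U: "open U" "U \<subseteq> uhp"
  shows "Ck_on k U (pullback g \<psi>)"
proof -
  have h: "g holomorphic_on U" using deck_holomorphic[OF g] U(2) holomorphic_on_subset by blast
  have "Ck_on k U (deriv g)" using h U(1) by (intro Ck_on_holomorphic holomorphic_deriv)
  then have "Ck_on k U (\<lambda>z. cnj (deriv g z))" by (rule Ck_on_linear[OF bounded_linear_cnj])
  moreover have "Ck_on k U (\<lambda>z. \<psi> (g z))"
    by (rule Ck_on_compose_holomorphic[OF U(1) h, where S = UNIV]) (use \<psi>(1) in \<open>auto simp: test_form_def smooth_on_def\<close>)
  ultimately have "Ck_on k U (\<lambda>z. cnj (deriv g z) * \<psi> (g z))" by (rule Ck_on_mult)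
  moreover have "pullback g \<psi> = (\<lambda>z. cnj (deriv g z) * \<psi> (g z))" by (simp add: pullback_def fun_eq_iff)
  ultimately show ?thesis by simp
qed

text \<open>
  Near a point of the orbit of \<open>V\<close> the pushforward is a single pullback; a point outside the
  orbit has a neighbourhood off the preimage of the compact support.
\<close>
lemma smooth_on_pushforward: "smooth_on uhp (pushforward p \<psi>)"
  unfolding smooth_on_def
proof
  fix k
  show "Ck_on k uhp (pushforward p \<psi>)"
  proof (rule Ck_on_local)
    fix z assume z: "z \<in> uhp"
    show "\<exists>U. open U \<and> z \<in> U \<and> Ck_on k U (pushforward p \<psi>)"
    proof (cases "\<exists>g\<in>deck_group p. g z \<in> V")
      case True
      then obtain g where g: "g \<in> deck_group p" "g z \<in> V" by blast
      define U where "U = uhp \<inter> g -` V"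
      have "continuous_on uhp g" by (rule holomorphic_on_imp_continuous_on[OF deck_holomorphic[OF g(1)]])
      then have U: "open U" unfolding U_def using open_uhp V(1) by (simp add: continuous_open_preimage)
      have "Ck_on k U (pushforward p \<psi>)"
        by (rule Ck_on_cong[OF U _ Ck_on_pullback[OF g(1) U]])
          (use pushforward_single_term[OF _ g(1)] in \<open>auto simp: U_def\<close>)
      then show ?thesis using U z g(2) by (auto simp: U_def)
    next
      case False
      define U where "U = uhp \<inter> p -` (- p ` closure {z. \<psi> z \<noteq> 0})"
      have "open (- p ` closure {z. \<psi> z \<noteq> 0})" using compact_push_support compact_imp_closed by blast
      then have U: "open U"
        unfolding U_def using open_uhp surface_continuous[OF M] by (simp add: continuous_open_preimage)
      have "p z \<notin> p ` V"
      proof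
        assume "p z \<in> p ` V"
        then obtain w where "w \<in> V" "p z = p w" by blast
        then show False using surface_transitive[OF M z, of w] V(2) False by auto
      qed
      then have zU: "z \<in> U" using z \<psi>(2) by (auto simp: U_def)
      have "Ck_on k U (pushforward p \<psi>)"
        by (rule Ck_on_cong[OF U _ Ck_on_const[of k U 0]]) (use pushforward_nonzero in \<open>force simp: U_def\<close>)
      then show ?thesis using U zU by blast
    qed
  qed
qed

lemma pullback_pushforward:
  assumes g: "g \<in> deck_group p" and z: "z \<in> uhp"
  shows "pullback g (pushforward p \<psi>) z = pushforward p \<psi> z"
proof (cases "\<exists>h\<in>deck_group p. h (g z) \<in> V")
  case True
  then obtain h where h: "h \<in> deck_group p" "h (g z) \<in> V" by blast
  obtain k where k: "k \<in> deck_group p" "\<And>w. w \<in> uhp \<Longrightarrow> k w = h (g w)" using deck_compose[OF h(1) g] by blast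
  have gz: "g z \<in> uhp" by (rule deck_uhp[OF g z])
  have "deriv k z = deriv h (g z) * deriv g z"
  proof -
    have dg: "(g has_field_derivative deriv g z) (at z)"
      by (rule holomorphic_derivI[OF deck_holomorphic[OF g] open_uhp z])
    have dh: "(h has_field_derivative deriv h (g z)) (at (g z))"
      by (rule holomorphic_derivI[OF deck_holomorphic[OF h(1)] open_uhp gz])
    have "((\<lambda>w. h (g w)) has_field_derivative deriv h (g z) * deriv g z) (at z)" by (rule DERIV_chain2[OF dh dg])
    then have "(k has_field_derivative deriv h (g z) * deriv g z) (at z)"
      by (rule has_field_derivative_transform_within_open[OF _ open_uhp z]) (simp add: k(2))
    then show ?thesis by (rule DERIV_imp_deriv)
  qed
  moreover have "pushforward p \<psi> (g z) = pullback h \<psi> (g z)" by (rule pushforward_single_term[OF gz h])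
  moreover have "pushforward p \<psi> z = pullback k \<psi> z"
    by (rule pushforward_single_term[OF z k(1)]) (use h k(2)[OF z] in simp)
  ultimately show ?thesis by (simp add: pullback_def k(2)[OF z] mult_ac)
next
  case False
  have gz: "g z \<in> uhp" by (rule deck_uhp[OF g z])
  have 1: "pushforward p \<psi> (g z) = 0" by (rule pushforward_no_term) (use False push_support in blast)
  have "pushforward p \<psi> z = 0"
  proof (rule pushforward_no_term, rule ccontr)
    fix h assume h: "h \<in> deck_group p" "\<psi> (h z) \<noteq> 0"
    obtain k where k: "k \<in> deck_group p" "k (g z) = z" using deck_inverse[OF g] z by blast
    obtain l where l: "l \<in> deck_group p" "l (g z) = h (k (g z))" using deck_compose[OF h(1) k(1)] gz by blast
    then show False using False push_support[OF h(2)] k(2) by auto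
  qed
  then show ?thesis using 1 by (simp add: pullback_def)
qed

lemma one_form_pushforward: "one_form p (pushforward p \<psi>)"
  unfolding one_form_def using smooth_on_pushforward pullback_pushforward by (auto simp: pushforward_def)

end

lemma one_form_zero: "one_form p (\<lambda>_. 0)"
  by (simp add: one_form_def smooth_on_def Ck_on_const pullback_def)

section \<open>Flow boxes and their lifts\<close>

text \<open>
  The tangents \<open>G'\<close> of the plaques are carried along as a continuous function on the closed
  box, since the current integrates over all plaques.
\<close>
definition adapted_lift ::
  "'m::metric_space set \<Rightarrow> (complex \<Rightarrow> 'm) \<Rightarrow> 'm set \<Rightarrow> 'm set set \<Rightarrow> ('m set \<Rightarrow> real \<Rightarrow> 'm)
     \<Rightarrow> 'm flow_box \<Rightarrow> (real \<times> real \<Rightarrow> complex) \<Rightarrow> (real \<times> real \<Rightarrow> complex) \<Rightarrow> bool" where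
  "adapted_lift M p S L dir B G G' \<longleftrightarrow> oriented_flow_box M p S L dir B \<and> chart_lift p B G \<and>
    (\<forall>t s. (t, s) \<in> rect B \<longrightarrow> ((\<lambda>\<tau>. G (\<tau>, s)) has_vector_derivative G' (t, s)) (at t within {tmin B..tmax B})) \<and>
    continuous_on (rect B) G'"

lemma open_open_rect: "open (open_rect B)" by (simp add: open_rect_def open_Times)

lemma open_rect_subset: "open_rect B \<subseteq> rect B" by (auto simp: open_rect_def rect_def)

lemma oriented_flow_boxD: "oriented_flow_box M p S L dir B \<Longrightarrow> flow_box M p S B"
  by (simp add: oriented_flow_box_def)

lemma flow_box_bilipschitz:
  assumes "flow_box M p S B"
  shows "\<exists>C>0. \<forall>x\<in>rect B. \<forall>y\<in>rect B. dist x y \<le> C * dist (chart B x) (chart B y) \<and>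
    dist (chart B x) (chart B y) \<le> C * dist x y"
proof -
  obtain C where C: "C > 0" "\<forall>x\<in>rect B. \<forall>y\<in>rect B.
        dist x y / C \<le> dist (chart B x) (chart B y) \<and> dist (chart B x) (chart B y) \<le> C * dist x y"
    using assms unfolding flow_box_def by auto
  then show ?thesis by (intro exI[of _ C]) (auto simp: divide_le_eq mult.commute)
qed

lemma flow_box_inj:
  assumes "flow_box M p S B" shows "inj_on (chart B) (rect B)"
proof (rule inj_onI)
  fix x y assume xy: "x \<in> rect B" "y \<in> rect B" "chart B x = chart B y"
  obtain C where "\<forall>x\<in>rect B. \<forall>y\<in>rect B. dist x y \<le> C * dist (chart B x) (chart B y) \<and>
    dist (chart B x) (chart B y) \<le> C * dist x y" using flow_box_bilipschitz[OF assms] by blast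
  then have "dist x y \<le> C * dist (chart B x) (chart B y)" using xy by blast
  then show "x = y" using xy(3) by simp
qed

lemma flow_box_leafset:
  assumes "flow_box M p S B" "x \<in> rect B"
  shows "chart B x \<in> S \<longleftrightarrow> snd x \<in> leafset B"
proof -
  have "{x \<in> rect B. chart B x \<in> S} = {tmin B..tmax B} \<times> leafset B" using assms(1) by (simp add: flow_box_def)
  then show ?thesis using assms(2) by (cases x) (auto simp: rect_def set_eq_iff)
qed

lemma chart_lift_facts:
  assumes "chart_lift p B G"
  shows "continuous_on (rect B) G" "x \<in> rect B \<Longrightarrow> G x \<in> uhp" "x \<in> rect B \<Longrightarrow> p (G x) = chart B x"
  using assms by (auto simp: chart_lift_def)

lemma lift_inj:
  assumes "flow_box M p S B" "chart_lift p B G"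
  shows "inj_on (p \<circ> G) (rect B)" "inj_on G (rect B)" "inj_on p (G ` rect B)"
proof -
  show 1: "inj_on (p \<circ> G) (rect B)"
    using flow_box_inj[OF assms(1)] chart_lift_facts(3)[OF assms(2)] by (simp add: inj_on_def)
  show "inj_on G (rect B)" using 1 by (rule inj_on_imageI2)
  show "inj_on p (G ` rect B)" using 1 by (rule inj_on_imageI)
qed

text \<open>
Invariance of domain.
\<close>
lemma lift_open_image:
  assumes "flow_box M p S B" "chart_lift p B G" "open W" "W \<subseteq> rect B"
  shows "open (G ` W)"
proof (rule invariance_of_domain_gen[OF assms(3)])
  show "continuous_on W G" using chart_lift_facts(1)[OF assms(2)] assms(4) by (rule continuous_on_subset)
  show "inj_on G W" using lift_inj(2)[OF assms(1,2)] assms(4) by (rule inj_on_subset)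
qed simp

lemma chart_image: "chart_lift p B G \<Longrightarrow> W \<subseteq> rect B \<Longrightarrow> chart B ` W = p ` G ` W"
  by (force simp: chart_lift_def image_iff)

lemma chart_open_image:
  assumes M: "closed_hyperbolic_surface M p" and B: "flow_box M p S B" and W: "open W" "W \<subseteq> rect B"
  shows "openin (top_of_set M) (chart B ` W)"
proof -
  obtain G where G: "chart_lift p B G" using B unfolding flow_box_def by blast
  have "G ` W \<subseteq> uhp" using chart_lift_facts(2)[OF G] W(2) by blast
  then have "openin (top_of_set uhp) (G ` W)"
    using lift_open_image[OF B G W] open_uhp by (simp add: openin_open_eq)
  then show ?thesis
    using covering_space_open_map[OF surface_covering[OF M]] chart_image[OF G W(2)] by simp
qed

lemma rect_connected: "connected (rect B)" and rect_compact: "compact (rect B)"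
  by (auto simp: rect_def intro: connected_Times compact_Times)

lemma chart_continuous:
  assumes M: "closed_hyperbolic_surface M p" and F: "flow_box M p S B"
  shows "continuous_on (rect B) (chart B)"
proof -
  obtain G where G: "chart_lift p B G" using F unfolding flow_box_def by blast
  have "continuous_on (rect B) (\<lambda>x. p (G x))"
    by (rule continuous_on_compose2[OF surface_continuous[OF M] chart_lift_facts(1)[OF G]])
      (use chart_lift_facts(2)[OF G] in auto)
  then show ?thesis by (rule continuous_on_eq) (simp add: chart_lift_facts(3)[OF G])
qed

text \<open>
  This allows the lift that is chosen in the definition of the current to be replaced by the one
  through a given point.
\<close>
lemma lifts_differ_by_deck:
  assumes M: "closed_hyperbolic_surface M p" and B: "flow_box M p S B"
    and G: "chart_lift p B G" and H: "chart_lift p B H"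
  shows "\<exists>h\<in>deck_group p. \<forall>x\<in>rect B. H x = h (G x)"
proof -
  define x0 where "x0 = (tmin B, smin B)"
  have x0: "x0 \<in> rect B" using B by (auto simp: x0_def rect_def flow_box_def)
  obtain h where h: "h \<in> deck_group p" "h (G x0) = H x0"
    using surface_transitive[OF M, of "G x0" "H x0"] chart_lift_facts[OF G] chart_lift_facts[OF H] x0 by auto
  have "H x = h (G x)" if x: "x \<in> rect B" for x
  proof (rule covering_space_lift_unique[OF surface_covering[OF M], of H x0 "\<lambda>x. h (G x)" "rect B" "chart B"])
    show "H x0 = h (G x0)" using h by simp
    show "continuous_on (rect B) (chart B)" by (rule chart_continuous[OF M B])
    show "chart B \<in> rect B \<rightarrow> M" using B by (auto simp: flow_box_def)
    show "continuous_on (rect B) (\<lambda>x. h (G x))"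
      by (rule continuous_on_compose2[OF holomorphic_on_imp_continuous_on[OF deck_holomorphic[OF h(1)]] chart_lift_facts(1)[OF G]])
        (use chart_lift_facts(2)[OF G] in auto)
  qed (use chart_lift_facts[OF G] chart_lift_facts[OF H] h(1) x x0 rect_connected in \<open>auto simp: deck_uhp deck_invariant\<close>)
  then show ?thesis using h(1) by blast
qed

lemma deck_vector_derivative:
  assumes h: "h \<in> deck_group p" and f: "(f has_vector_derivative f') (at t within A)" and t: "f t \<in> uhp"
  shows "((\<lambda>\<tau>. h (f \<tau>)) has_vector_derivative deriv h (f t) * f') (at t within A)"
proof -
  have "(h has_field_derivative deriv h (f t)) (at (f t) within f ` A)"
    using holomorphic_derivI[OF deck_holomorphic[OF h] open_uhp t] by (rule has_field_derivative_at_within)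
  from field_vector_diff_chain_within[OF f this] show ?thesis by (simp add: o_def mult.commute)
qed

text \<open>
Move the lift that comes with a flow box by a deck transformation.
\<close>
lemma box_through_point:
  assumes M: "closed_hyperbolic_surface M p" and O: "oriented_lamination M p S L dir"
    and z: "z \<in> uhp" "p z \<in> S"
  shows "\<exists>B G G' t0 s0. adapted_lift M p S L dir B G G' \<and> (t0, s0) \<in> open_rect B \<and> s0 \<in> leafset B \<and> G (t0, s0) = z"
proof -
  obtain B where B: "oriented_flow_box M p S L dir B" "p z \<in> chart B ` open_rect B"
    using O z(2) unfolding oriented_lamination_def by blast
  then obtain t0 s0 where x0: "(t0, s0) \<in> open_rect B" "chart B (t0, s0) = p z" by auto
  then have x0r: "(t0, s0) \<in> rect B" using open_rect_subset by blast
  have F: "flow_box M p S B" by (rule oriented_flow_boxD[OF B(1)])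
  obtain G G' C where G: "chart_lift p B G"
    "\<forall>(t, s)\<in>rect B. ((\<lambda>\<tau>. G (\<tau>, s)) has_vector_derivative G' (t, s)) (at t within {tmin B..tmax B})"
    "C-lipschitz_on (rect B) G'" using F unfolding flow_box_def by blast
  obtain g where g: "g \<in> deck_group p" "g (G (t0, s0)) = z"
    using surface_transitive[OF M, of "G (t0, s0)" z] chart_lift_facts[OF G(1)] x0 x0r z(1) by auto
  have cg: "continuous_on (rect B) (\<lambda>x. g (G x))"
    by (rule continuous_on_compose2[OF holomorphic_on_imp_continuous_on[OF deck_holomorphic[OF g(1)]] chart_lift_facts(1)[OF G(1)]])
      (use chart_lift_facts(2)[OF G(1)] in auto)
  have dg: "continuous_on uhp (deriv g)"
    by (intro holomorphic_on_imp_continuous_on holomorphic_deriv deck_holomorphic[OF g(1)] open_uhp)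
  have "adapted_lift M p S L dir B (\<lambda>x. g (G x)) (\<lambda>x. deriv g (G x) * G' x)"
    unfolding adapted_lift_def
  proof (intro conjI allI impI)
    show "chart_lift p B (\<lambda>x. g (G x))"
      using cg chart_lift_facts[OF G(1)] g(1) by (auto simp: chart_lift_def deck_uhp deck_invariant)
    show "continuous_on (rect B) (\<lambda>x. deriv g (G x) * G' x)"
      by (intro continuous_on_mult continuous_on_compose2[OF dg chart_lift_facts(1)[OF G(1)]]
          lipschitz_on_continuous_on[OF G(3)]) (use chart_lift_facts(2)[OF G(1)] in auto)
    fix t s assume ts: "(t, s) \<in> rect B"
    show "((\<lambda>\<tau>. g (G (\<tau>, s))) has_vector_derivative deriv g (G (t, s)) * G' (t, s)) (at t within {tmin B..tmax B})"
      by (rule deck_vector_derivative[OF g(1)]) (use G(2) ts chart_lift_facts(2)[OF G(1)] in auto)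
  qed (rule B(1))
  moreover have "s0 \<in> leafset B" using flow_box_leafset[OF F x0r] x0(2) z(2) by simp
  ultimately show ?thesis using x0(1) g(2)
    by (intro exI[of _ B] exI[of _ "\<lambda>x. g (G x)"] exI[of _ "\<lambda>x. deriv g (G x) * G' x"] exI[of _ t0] exI[of _ s0]) simp
qed

lemma adapted_facts:
  assumes "adapted_lift M p S L dir B G G'"
  shows "oriented_flow_box M p S L dir B" "flow_box M p S B" "chart_lift p B G" "continuous_on (rect B) G'"
    "(t, s) \<in> rect B \<Longrightarrow> ((\<lambda>\<tau>. G (\<tau>, s)) has_vector_derivative G' (t, s)) (at t within {tmin B..tmax B})"
  using assms oriented_flow_boxD by (auto simp: adapted_lift_def)

lemma sub_box_image:
  assumes A: "adapted_lift M p S L dir B G G'" and W: "open W" "W \<subseteq> rect B"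
  shows "open (G ` W)" "G ` W \<subseteq> uhp" "inj_on p (G ` W)"
proof -
  note B = adapted_facts(2)[OF A] and G = adapted_facts(3)[OF A]
  show "open (G ` W)" by (rule lift_open_image[OF B G W])
  show "G ` W \<subseteq> uhp" using chart_lift_facts(2)[OF G] W(2) by blast
  show "inj_on p (G ` W)" by (rule inj_on_subset[OF lift_inj(3)[OF B G] image_mono[OF W(2)]])
qed

lemma lift_in_lamination:
  assumes A: "adapted_lift M p S L dir B G G'" and x: "x \<in> rect B"
  shows "p (G x) \<in> S \<longleftrightarrow> snd x \<in> leafset B"
  using flow_box_leafset[OF adapted_facts(2)[OF A] x] chart_lift_facts(3)[OF adapted_facts(3)[OF A] x] by simp

text \<open>
  The covering map does not increase distances, and on the compact image of the box hyperbolic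
  distance is bounded by a multiple of Euclidean distance.
\<close>
lemma lift_expanding:
  assumes M: "closed_hyperbolic_surface M p" and B: "flow_box M p S B" and G: "chart_lift p B G"
  shows "\<exists>C>0. \<forall>x\<in>rect B. \<forall>y\<in>rect B. dist x y \<le> C * dist (G x) (G y)"
proof -
  obtain C where C: "C > 0" "\<forall>x\<in>rect B. \<forall>y\<in>rect B. dist x y \<le> C * dist (chart B x) (chart B y) \<and>
    dist (chart B x) (chart B y) \<le> C * dist x y" using flow_box_bilipschitz[OF B] by blast
  have "compact ((\<lambda>x. Im (G x)) ` rect B)"
    by (intro compact_continuous_image continuous_intros chart_lift_facts(1)[OF G] rect_compact)
  moreover have "rect B \<noteq> {}" using B by (auto simp: rect_def flow_box_def)
  ultimately obtain x0 where x0: "x0 \<in> rect B" "\<And>x. x \<in> rect B \<Longrightarrow> Im (G x0) \<le> Im (G x)"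
    using compact_attains_inf[of "(\<lambda>x. Im (G x)) ` rect B"] by auto
  define m where "m = Im (G x0)"
  have m: "m > 0" using chart_lift_facts(2)[OF G x0(1)] by (simp add: m_def uhp_def)
  have "dist x y \<le> C / m * dist (G x) (G y)" if xy: "x \<in> rect B" "y \<in> rect B" for x y
  proof -
    have u: "G x \<in> uhp" "G y \<in> uhp" using chart_lift_facts(2)[OF G] xy by auto
    have "dist (chart B x) (chart B y) \<le> hdist (G x) (G y)"
      using dist_le_hdist[OF M u] chart_lift_facts(3)[OF G] xy by simp
    also have "\<dots> \<le> cmod (G x - G y) / m" by (rule hdist_le_norm[OF u m]) (use x0(2) xy in \<open>auto simp: m_def\<close>)
    finally have "C * dist (chart B x) (chart B y) \<le> C * (cmod (G x - G y) / m)"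
      by (rule mult_left_mono) (use C(1) in simp)
    then show ?thesis using C(2) xy by (fastforce simp: dist_norm)
  qed
  then show ?thesis using C(1) m by (intro exI[of _ "C / m"]) auto
qed

lemma lift_locally_lipschitz:
  assumes M: "closed_hyperbolic_surface M p" and B: "flow_box M p S B" and G: "chart_lift p B G" and x: "x \<in> rect B"
  shows "\<exists>K>0. \<exists>T. open T \<and> x \<in> T \<and> (\<forall>y\<in>rect B \<inter> T. dist (G y) (G x) \<le> K * dist y x)"
proof -
  obtain C where C: "C > 0" "\<forall>x\<in>rect B. \<forall>y\<in>rect B. dist x y \<le> C * dist (chart B x) (chart B y) \<and>
    dist (chart B x) (chart B y) \<le> C * dist x y" using flow_box_bilipschitz[OF B] by blast
  have Gx: "G x \<in> uhp" by (rule chart_lift_facts(2)[OF G x])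
  obtain r where r: "r > 0" "ball (G x) r \<subseteq> uhp" "\<And>z w. z \<in> ball (G x) r \<Longrightarrow> w \<in> ball (G x) r \<Longrightarrow> hdist z w \<le> dist (p z) (p w)"
    using surface_local_isometry[OF M Gx] by blast
  obtain d where d: "d > 0" "\<And>y. y \<in> rect B \<Longrightarrow> dist y x < d \<Longrightarrow> dist (G y) (G x) < r"
    using chart_lift_facts(1)[OF G] x r(1) unfolding continuous_on_iff by blast
  define R where "R = Im (G x) + r"
  have R: "R > 0" using Gx r(1) by (simp add: R_def uhp_def)
  have "dist (G y) (G x) \<le> (2 * R * C) * dist y x" if y: "y \<in> rect B" "dist y x < min d (1 / C)" for y
  proof -
    have Gy: "G y \<in> ball (G x) r" using d(2)[of y] y by (simp add: dist_commute)
    then have Gyu: "G y \<in> uhp" using r(2) by blast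
    have "\<bar>Im (G y) - Im (G x)\<bar> < r" using Gy abs_Im_le_cmod[of "G x - G y"] by (simp add: dist_norm)
    then have Im: "Im (G y) \<le> R" "Im (G x) \<le> R" using r(1) by (auto simp: R_def)
    have "hdist (G y) (G x) \<le> dist (p (G y)) (p (G x))" using r Gy by simp
    also have "\<dots> \<le> C * dist y x" using C(2) y(1) x chart_lift_facts(3)[OF G] by simp
    finally have h: "hdist (G y) (G x) \<le> C * dist y x" .
    moreover have "C * dist y x \<le> 1" using y(2) C(1) by (simp add: field_simps)
    ultimately have "cmod (G y - G x) \<le> 2 * R * hdist (G y) (G x)" by (intro norm_le_hdist Gx Gyu Im) simp
    also have "\<dots> \<le> 2 * R * (C * dist y x)" using h R by (intro mult_left_mono) auto
    finally show ?thesis by (simp add: dist_norm mult.assoc)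
  qed
  moreover have "0 < min d (1 / C)" using d C by simp
  ultimately show ?thesis using R C(1)
    by (intro exI[of _ "2 * R * C"] conjI exI[of _ "ball x (min d (1 / C))"]) (auto simp: dist_commute)
qed

section \<open>The lamination is a null set\<close>

text \<open>
  Dimension 0 gives an exponent \<open>\<alpha> < 1\<close> with null measure.  For sets of diameter
  \<open>d \<le> 1\<close> one has \<open>d \<le> d powr \<alpha>\<close>, so efficient covers for the exponent
  \<open>\<alpha>\<close> have small total length.
\<close>
lemma hausdorff_dim_0_negligible:
  fixes K :: "real set"
  assumes "hausdorff_dim K = 0" shows "negligible K"
proof -
  have "(INF \<alpha> \<in> {\<alpha>. 0 < \<alpha> \<and> hausdorff_measure \<alpha> K = 0}. ennreal \<alpha>) < 1" using assms by (simp add: hausdorff_dim_def)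
  then obtain \<alpha> where \<alpha>: "0 < \<alpha>" "hausdorff_measure \<alpha> K = 0" "ennreal \<alpha> < 1" by (auto simp: INF_less_iff)
  then have \<alpha>1: "\<alpha> < 1" by (simp add: ennreal_less_one_iff)
  have "hausdorff_premeasure \<alpha> 1 K \<le> hausdorff_measure \<alpha> K" unfolding hausdorff_measure_def by (rule SUP_upper) simp
  then have pre: "hausdorff_premeasure \<alpha> 1 K = 0" using \<alpha>(2) by simp
  show ?thesis
    unfolding negligible_outer_le
  proof (intro allI impI)
    fix e :: real assume e: "e > 0"
    have "hausdorff_premeasure \<alpha> 1 K < ennreal (e / 2)" using e pre by simp
    then obtain U where U: "K \<subseteq> (\<Union>i. U i)" "\<And>i. bounded (U i) \<and> diameter (U i) \<le> 1"
      "(\<Sum>i. ennreal (diameter (U i) powr \<alpha>)) < ennreal (e / 2)"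
      unfolding hausdorff_premeasure_def INF_less_iff by blast
    define c where "c i = (SOME x. x \<in> U i)" for i
    define J where "J i = (if U i = {} then {} else cball (c i) (diameter (U i)))" for i
    have dn: "0 \<le> diameter (U i)" for i using U(2) by (simp add: diameter_ge_0)
    have UJ: "U i \<subseteq> J i" for i
    proof
      fix x assume x: "x \<in> U i"
      then have "c i \<in> U i" unfolding c_def by (rule someI)
      then show "x \<in> J i" using x U(2) diameter_bounded_bound[of "U i" "c i" x] by (auto simp: J_def)
    qed
    have mJ: "emeasure lborel (J i) \<le> 2 * ennreal (diameter (U i) powr \<alpha>)" for i
    proof (cases "U i = {}")
      case False
      have "emeasure lborel (J i) = ennreal (2 * diameter (U i))"
        using False dn[of i] by (simp add: J_def cball_eq_atLeastAtMost)
      also have "\<dots> \<le> ennreal (2 * diameter (U i) powr \<alpha>)"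
      proof (rule ennreal_leI)
        have "diameter (U i) \<le> diameter (U i) powr \<alpha>"
        proof (cases "diameter (U i) = 0")
          case False
          then have "diameter (U i) powr 1 \<le> diameter (U i) powr \<alpha>"
            using U(2)[of i] dn[of i] \<alpha>1 by (intro powr_mono') auto
          then show ?thesis using dn[of i] False by simp
        qed simp
        then show "2 * diameter (U i) \<le> 2 * diameter (U i) powr \<alpha>" by simp
      qed
      also have "\<dots> = 2 * ennreal (diameter (U i) powr \<alpha>)" by (simp add: ennreal_mult')
      finally show ?thesis .
    qed (simp add: J_def)
    have Jb[measurable]: "J i \<in> sets borel" for i by (simp add: J_def)
    define T where "T = (\<Union>i. J i)"
    have "emeasure lborel T \<le> (\<Sum>i. emeasure lborel (J i))"
      unfolding T_def by (rule emeasure_subadditive_countably) auto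
    also have "\<dots> \<le> (\<Sum>i. 2 * ennreal (diameter (U i) powr \<alpha>))" by (intro suminf_le mJ) auto
    also have "\<dots> = 2 * (\<Sum>i. ennreal (diameter (U i) powr \<alpha>))" by simp
    also have "\<dots> \<le> 2 * ennreal (e / 2)" using U(3) by (intro mult_left_mono) auto
    also have "\<dots> = ennreal e" using ennreal_mult'[of 2 "e / 2"] e by simp
    finally have T: "emeasure lborel T \<le> ennreal e" .
    have Ts: "T \<in> sets borel" by (simp add: T_def)
    have "T \<in> lmeasurable" by (rule fmeasurableI) (use Ts T in \<open>auto simp: less_top[symmetric] top_unique\<close>)
    moreover have "measure lebesgue T \<le> e"
      using T Ts e by (simp add: measure_completion measure_def enn2real_leI)
    moreover have "K \<subseteq> T" using U(1) UJ by (force simp: T_def)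
    ultimately show "\<exists>T. K \<subseteq> T \<and> T \<in> lmeasurable \<and> measure lebesgue T \<le> e" by blast
  qed
qed

lemma negligible_horizontal_strip:
  fixes K :: "real set"
  assumes "closed K" "negligible K" shows "negligible (UNIV \<times> K :: (real \<times> real) set)"
proof -
  have K: "K \<in> sets borel" using assms(1) by simp
  have "emeasure lborel K = 0" using assms K by (simp add: negligible_iff_null_sets null_sets_def)
  then have "emeasure (lborel \<Otimes>\<^sub>M lborel) (UNIV \<times> K :: (real \<times> real) set) = 0"
    using K lborel.emeasure_pair_measure_Times[of UNIV lborel K] by simp
  then have "emeasure lborel (UNIV \<times> K :: (real \<times> real) set) = 0" by (simp add: lborel_prod)
  moreover have "(UNIV \<times> K :: (real \<times> real) set) \<in> sets borel" using assms(1) by (simp add: closed_Times)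
  ultimately show ?thesis by (simp add: negligible_iff_null_sets null_sets_def)
qed

lemma plaques_negligible:
  assumes M: "closed_hyperbolic_surface M p" and B: "flow_box M p S B" and G: "chart_lift p B G"
  shows "negligible (G ` (rect B \<inter> UNIV \<times> leafset B))"
proof (rule negligible_locally_Lipschitz_image)
  have "negligible (leafset B)" using B hausdorff_dim_0_negligible by (auto simp: flow_box_def)
  then have "negligible (UNIV \<times> leafset B :: (real \<times> real) set)"
    using B by (intro negligible_horizontal_strip) (auto simp: flow_box_def)
  then show "negligible (rect B \<inter> UNIV \<times> leafset B)" by (rule negligible_subset) auto
  fix x assume "x \<in> rect B \<inter> UNIV \<times> leafset B"
  then show "\<exists>T K. open T \<and> x \<in> T \<and> (\<forall>y\<in>(rect B \<inter> UNIV \<times> leafset B) \<inter> T. norm (G y - G x) \<le> K * norm (y - x))"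
    using lift_locally_lipschitz[OF M B G, of x] by (auto simp: dist_norm)
qed simp

lemma lamination_preimage_negligible:
  assumes M: "closed_hyperbolic_surface M p" and O: "oriented_lamination M p S L dir"
  shows "negligible {z \<in> uhp. p z \<in> S}"
proof (rule locally_negligible_alt[THEN iffD2], rule ballI)
  fix z assume "z \<in> {z \<in> uhp. p z \<in> S}"
  then have z: "z \<in> uhp" "p z \<in> S" by auto
  obtain B G G' t0 s0 where A: "adapted_lift M p S L dir B G G'" and x0: "(t0, s0) \<in> open_rect B" "G (t0, s0) = z"
    using box_through_point[OF M O z] by blast
  note B = adapted_facts(2)[OF A] and G = adapted_facts(3)[OF A]
  let ?P = "{z \<in> uhp. p z \<in> S}" and ?V = "G ` open_rect B"
  have "open ?V" by (rule lift_open_image[OF B G open_open_rect open_rect_subset])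
  then have "openin (top_of_set ?P) (?P \<inter> ?V)" by (simp add: openin_open_Int)
  moreover have "z \<in> ?P \<inter> ?V" using z x0 by force
  moreover have "?P \<inter> ?V \<subseteq> G ` (rect B \<inter> UNIV \<times> leafset B)"
    using flow_box_leafset[OF B] chart_lift_facts(3)[OF G] open_rect_subset[of B] by fastforce
  then have "negligible (?P \<inter> ?V)" by (rule negligible_subset[OF plaques_negligible[OF M B G]])
  ultimately show "\<exists>U. openin (top_of_set ?P) U \<and> z \<in> U \<and> negligible U" by blast
qed

section \<open>The current in a flow box\<close>

lemma lamination_compact:
  assumes M: "closed_hyperbolic_surface M p" and O: "oriented_lamination M p S L dir"
  shows "compact S"
proof -
  have "S \<subseteq> M" "closed S" using O by (auto simp: oriented_lamination_def lamination_leaves_def)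
  then show ?thesis using surface_compact[OF M] by (metis compact_Int_closed inf.absorb2)
qed

text \<open>
  Compactness applies because the images of the open rectangles are open in \<open>M\<close>.
\<close>
lemma finite_box_cover:
  assumes M: "closed_hyperbolic_surface M p" and O: "oriented_lamination M p S L dir"
  shows "\<exists>\<B>. finite \<B> \<and> (\<forall>B\<in>\<B>. oriented_flow_box M p S L dir B) \<and> S \<subseteq> (\<Union>B\<in>\<B>. chart B ` open_rect B)"
proof -
  let ?F = "{B. oriented_flow_box M p S L dir B}"
  have "\<exists>T. open T \<and> chart B ` open_rect B = M \<inter> T" if "B \<in> ?F" for B
    using chart_open_image[OF M oriented_flow_boxD open_open_rect open_rect_subset, of S L dir B] that
    by (auto simp: openin_open)
  then obtain T where T: "\<And>B. B \<in> ?F \<Longrightarrow> open (T B) \<and> chart B ` open_rect B = M \<inter> T B" by metis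
  have SM: "S \<subseteq> M" and cov: "S \<subseteq> (\<Union>B\<in>?F. chart B ` open_rect B)"
    using O by (auto simp: oriented_lamination_def lamination_leaves_def)
  have "S \<subseteq> (\<Union>B\<in>?F. T B)"
  proof
    fix x assume "x \<in> S"
    then obtain B where "B \<in> ?F" "x \<in> chart B ` open_rect B" using cov by blast
    then show "x \<in> (\<Union>B\<in>?F. T B)" using T by blast
  qed
  then obtain \<B> where \<B>: "\<B> \<subseteq> ?F" "finite \<B>" "S \<subseteq> (\<Union>B\<in>\<B>. T B)"
    using compactE_image[OF lamination_compact[OF M O], of ?F T] T by metis
  have "S \<subseteq> (\<Union>B\<in>\<B>. chart B ` open_rect B)"
  proof
    fix x assume "x \<in> S"
    then obtain B where "B \<in> \<B>" "x \<in> T B" "x \<in> M" using \<B>(3) SM by blast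
    then show "x \<in> (\<Union>B\<in>\<B>. chart B ` open_rect B)" using T \<B>(1) by blast
  qed
  then show ?thesis using \<B> by blast
qed

text \<open>
The form counts as the part away from the lamination, and every box gets the form 0.
\<close>
lemma current_zero_off_lamination:
  assumes M: "closed_hyperbolic_surface M p" and O: "oriented_lamination M p S L dir"
    and T: "ruelle_sullivan_current M p S L dir \<nu> T"
    and V: "open V" "V \<subseteq> uhp" "inj_on p V" "\<And>z. z \<in> V \<Longrightarrow> p z \<notin> S"
    and \<psi>: "test_form \<psi>" "closure {z. \<psi> z \<noteq> 0} \<subseteq> V"
  shows "T (pushforward p \<psi>) = 0"
proof -
  obtain \<B> where \<B>: "finite \<B>" "\<forall>B\<in>\<B>. oriented_flow_box M p S L dir B" "S \<subseteq> (\<Union>B\<in>\<B>. chart B ` open_rect B)"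
    using finite_box_cover[OF M O] by blast
  have "form_support p (pushforward p \<psi>) \<inter> S = {}"
    using form_support_pushforward[OF M V(1-3) \<psi>] V(4) \<psi>(2) by fastforce
  moreover have "one_form p (pushforward p \<psi>)" by (rule one_form_pushforward[OF M V(1-3) \<psi>])
  moreover have "form_support p (\<lambda>_. 0) = {}" by (simp add: form_support_def)
  ultimately have "T (pushforward p \<psi>) = (\<Sum>B\<in>\<B>. box_current p \<nu> B (\<lambda>_. 0))"
    using T[unfolded ruelle_sullivan_current_def, rule_format, of \<B> "pushforward p \<psi>" "pushforward p \<psi>" "\<lambda>_ _. 0"] \<B>
    by (simp add: one_form_zero)
  then show ?thesis by (simp add: box_current_def)
qed

text \<open>
The box itself may be added to any finite cover and given the whole form.
\<close>
lemma current_single_box: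
  assumes M: "closed_hyperbolic_surface M p" and O: "oriented_lamination M p S L dir"
    and T: "ruelle_sullivan_current M p S L dir \<nu> T"
    and B: "oriented_flow_box M p S L dir B"
    and \<phi>: "one_form p \<phi>" "form_support p \<phi> \<subseteq> chart B ` open_rect B"
  shows "T \<phi> = box_current p \<nu> B \<phi>"
proof -
  obtain \<B>0 where \<B>0: "finite \<B>0" "\<forall>B\<in>\<B>0. oriented_flow_box M p S L dir B" "S \<subseteq> (\<Union>B\<in>\<B>0. chart B ` open_rect B)"
    using finite_box_cover[OF M O] by blast
  define \<B> where "\<B> = insert B \<B>0"
  define \<phi>s where "\<phi>s B' = (if B' = B then \<phi> else (\<lambda>_. 0))" for B'
  have fs0: "form_support p (\<lambda>_. 0) = {}" by (simp add: form_support_def)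
  have fin: "finite \<B>" using \<B>0 by (simp add: \<B>_def)
  have BB: "B \<in> \<B>" by (simp add: \<B>_def)
  have "(\<Sum>B'\<in>\<B>. \<phi>s B' z) = (\<Sum>B'\<in>\<B>. if B' = B then \<phi> z else 0)" for z
    by (rule sum.cong) (auto simp: \<phi>s_def)
  then have sum: "(\<Sum>B'\<in>\<B>. \<phi>s B' z) = \<phi> z" for z using fin BB by simp
  have "T \<phi> = (\<Sum>B'\<in>\<B>. box_current p \<nu> B' (\<phi>s B'))"
  proof (rule T[unfolded ruelle_sullivan_current_def, rule_format, of \<B> \<phi> "\<lambda>_. 0"], intro conjI ballI allI)
    show "S \<subseteq> (\<Union>B\<in>\<B>. chart B ` open_rect B)" using \<B>0(3) by (auto simp: \<B>_def)
    show "form_support p (\<lambda>_. 0) \<inter> S = {}" using fs0 by simp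
    show "\<phi> z = 0 + (\<Sum>B\<in>\<B>. \<phi>s B z)" for z by (simp add: sum)
  qed (use fin B \<B>0 \<phi> one_form_zero fs0 in \<open>auto simp: \<B>_def \<phi>s_def\<close>)
  also have "\<dots> = (\<Sum>B'\<in>\<B>. if B' = B then box_current p \<nu> B \<phi> else 0)"
    by (rule sum.cong) (auto simp: \<phi>s_def box_current_def)
  also have "\<dots> = box_current p \<nu> B \<phi>" using fin BB by simp
  finally show ?thesis .
qed

text \<open>
  The chosen lift is \<open>h \<circ> G\<close> with \<open>h\<close> a deck transformation; invariance of
  the pushed-forward form cancels \<open>h\<close>, and on the box the pushforward of \<open>\<psi>\<close> is
  \<open>\<psi>\<close>.
\<close>
lemma current_in_box:
  assumes M: "closed_hyperbolic_surface M p" and O: "oriented_lamination M p S L dir"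
    and T: "ruelle_sullivan_current M p S L dir \<nu> T"
    and A: "adapted_lift M p S L dir B G G'"
    and \<psi>: "test_form \<psi>" "closure {z. \<psi> z \<noteq> 0} \<subseteq> G ` open_rect B"
  shows "T (pushforward p \<psi>) = (LINT s:{smin B<..<smax B}|\<nu> B.
    integral {tmin B..tmax B} (\<lambda>t. \<psi> (G (t, s)) \<bullet> G' (t, s)))"
proof -
  note B = adapted_facts(2)[OF A] and G = adapted_facts(3)[OF A]
  let ?V = "G ` open_rect B" and ?\<phi> = "pushforward p \<psi>"
  note V = sub_box_image[OF A open_open_rect open_rect_subset]
  have one: "one_form p ?\<phi>" by (rule one_form_pushforward[OF M V \<psi>])
  have "form_support p ?\<phi> \<subseteq> chart B ` open_rect B"
    using form_support_pushforward[OF M V \<psi>] image_mono[OF \<psi>(2), of p] chart_image[OF G open_rect_subset]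
    by (metis order_trans)
  then have "T ?\<phi> = box_current p \<nu> B ?\<phi>"
    by (rule current_single_box[OF M O T adapted_facts(1)[OF A] one])
  also have "\<dots> = (LINT s:{smin B<..<smax B}|\<nu> B.
    integral {tmin B..tmax B} (\<lambda>t. \<psi> (G (t, s)) \<bullet> G' (t, s)))"
  proof -
    define H where "H = (SOME H. chart_lift p B H)"
    have H: "chart_lift p B H" unfolding H_def by (rule someI[of "chart_lift p B" G, OF G])
    obtain h where h: "h \<in> deck_group p" "\<forall>x\<in>rect B. H x = h (G x)"
      using lifts_differ_by_deck[OF M B G H] by blast
    have eq: "?\<phi> (H (t, s)) \<bullet> vector_derivative (\<lambda>\<tau>. H (\<tau>, s)) (at t within {tmin B..tmax B}) = \<psi> (G (t, s)) \<bullet> G' (t, s)"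
      if ts: "(t, s) \<in> rect B" for t s
    proof -
      have t: "t \<in> {tmin B..tmax B}" "s \<in> {smin B..smax B}" using ts by (auto simp: rect_def)
      have Gu: "G (t, s) \<in> uhp" by (rule chart_lift_facts(2)[OF G ts])
      have "((\<lambda>\<tau>. h (G (\<tau>, s))) has_vector_derivative deriv h (G (t, s)) * G' (t, s)) (at t within {tmin B..tmax B})"
        by (rule deck_vector_derivative[OF h(1) adapted_facts(5)[OF A ts] Gu])
      then have "((\<lambda>\<tau>. H (\<tau>, s)) has_vector_derivative deriv h (G (t, s)) * G' (t, s)) (at t within {tmin B..tmax B})"
        by (rule has_vector_derivative_transform[OF t(1), rotated]) (use h(2) t(2) in \<open>auto simp: rect_def\<close>)
      then have d: "vector_derivative (\<lambda>\<tau>. H (\<tau>, s)) (at t within {tmin B..tmax B}) = deriv h (G (t, s)) * G' (t, s)"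
        using B t(1) by (intro vector_derivative_within_closed_interval) (auto simp: flow_box_def)
      have "?\<phi> (H (t, s)) \<bullet> (deriv h (G (t, s)) * G' (t, s)) = pullback h ?\<phi> (G (t, s)) \<bullet> G' (t, s)"
        using h(2) ts by (simp add: pullback_def inner_complex_def algebra_simps)
      also have "pullback h ?\<phi> (G (t, s)) = ?\<phi> (G (t, s))" by (rule pullback_pushforward[OF M V \<psi> h(1) Gu])
      also have "?\<phi> (G (t, s)) = \<psi> (G (t, s))"
      proof (cases "G (t, s) \<in> ?V")
        case True
        then show ?thesis by (rule pushforward_on[OF M V \<psi>])
      next
        case False
        have "?\<phi> (G (t, s)) = 0"
        proof (rule ccontr)
          assume "?\<phi> (G (t, s)) \<noteq> 0"
          then have "p (G (t, s)) \<in> p ` closure {z. \<psi> z \<noteq> 0}" by (rule pushforward_nonzero[OF M V \<psi>])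
          then obtain y where y: "y \<in> open_rect B" "p (G (t, s)) = p (G y)" using \<psi>(2) by blast
          have "y \<in> rect B" using y(1) open_rect_subset by blast
          then have "(t, s) = y" by (intro inj_onD[OF lift_inj(1)[OF B G] _ ts]) (simp add: y(2))
          then show False using False y(1) by blast
        qed
        moreover have "\<psi> (G (t, s)) = 0" using push_support[OF M V \<psi>] False by blast
        ultimately show ?thesis by simp
      qed
      finally show ?thesis unfolding d .
    qed
    have "indicator {smin B<..<smax B} s *\<^sub>R integral {tmin B..tmax B}
          (\<lambda>t. ?\<phi> (H (t, s)) \<bullet> vector_derivative (\<lambda>\<tau>. H (\<tau>, s)) (at t within {tmin B..tmax B})) =
        indicator {smin B<..<smax B} s *\<^sub>R integral {tmin B..tmax B} (\<lambda>t. \<psi> (G (t, s)) \<bullet> G' (t, s))" for s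
    proof (cases "s \<in> {smin B<..<smax B}")
      case True
      then have "integral {tmin B..tmax B} (\<lambda>t. ?\<phi> (H (t, s)) \<bullet> vector_derivative (\<lambda>\<tau>. H (\<tau>, s)) (at t within {tmin B..tmax B})) =
        integral {tmin B..tmax B} (\<lambda>t. \<psi> (G (t, s)) \<bullet> G' (t, s))"
        by (intro integral_cong eq) (auto simp: rect_def)
      then show ?thesis by simp
    qed simp
    then show ?thesis unfolding box_current_def Let_def H_def[symmetric] set_lebesgue_integral_def by presburger
  qed
  finally show ?thesis .
qed

lemma adapted_derivative_bound:
  assumes A: "adapted_lift M p S L dir B G G'"
  shows "\<exists>K>0. \<forall>x\<in>rect B. cmod (G' x) \<le> K"
proof -
  have "bounded (G' ` rect B)"
    by (intro compact_imp_bounded compact_continuous_image adapted_facts(4)[OF A] rect_compact)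
  then show ?thesis unfolding bounded_pos by auto
qed

text \<open>
  Only plaques with parameter within \<open>C \<rho>\<close> of \<open>s0\<close> meet the disc, and each of
  them does so during a time of length at most \<open>2 C \<rho>\<close>.
\<close>
lemma current_bound:
  assumes M: "closed_hyperbolic_surface M p" and O: "oriented_lamination M p S L dir"
    and \<nu>: "transverse_measure M p S \<nu>"
    and T: "ruelle_sullivan_current M p S L dir \<nu> T"
    and A: "adapted_lift M p S L dir B G G'" and x0: "(t0, s0) \<in> open_rect B"
  shows "\<exists>C>0. \<forall>\<rho> \<psi>. 0 < \<rho> \<and> cball (G (t0, s0)) \<rho> \<subseteq> G ` open_rect B \<and> test_form \<psi> \<and>
     closure {z. \<psi> z \<noteq> 0} \<subseteq> cball (G (t0, s0)) \<rho> \<and> (\<forall>z. cmod (\<psi> z) \<le> 1) \<longrightarrow>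
     \<bar>T (pushforward p \<psi>)\<bar> \<le> C * \<rho> * measure (\<nu> B) (cball s0 (C * \<rho>))"
proof -
  note B = adapted_facts(2)[OF A] and G = adapted_facts(3)[OF A]
  obtain K where K: "K > 0" "\<And>x. x \<in> rect B \<Longrightarrow> cmod (G' x) \<le> K" using adapted_derivative_bound[OF A] by blast
  obtain C where C: "C > 0" "\<And>x y. x \<in> rect B \<Longrightarrow> y \<in> rect B \<Longrightarrow> dist x y \<le> C * dist (G x) (G y)"
    using lift_expanding[OF M B G] by blast
  have x0r: "(t0, s0) \<in> rect B" using x0 open_rect_subset by blast
  have sets: "sets (\<nu> B) = sets borel" and fin: "emeasure (\<nu> B) UNIV < \<infinity>"
    using \<nu> B by (auto simp: transverse_measure_def)
  have sp: "space (\<nu> B) = UNIV" using sets_eq_imp_space_eq[OF sets] by simp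
  interpret N: finite_measure "\<nu> B" by (rule finite_measureI) (use fin sp in auto)
  have bound: "\<bar>T (pushforward p \<psi>)\<bar> \<le> (2 * C * K * \<rho>) * measure (\<nu> B) (cball s0 (C * \<rho>))"
    if \<rho>: "0 < \<rho>" and sub: "cball (G (t0, s0)) \<rho> \<subseteq> G ` open_rect B" and \<psi>: "test_form \<psi>"
      "closure {z. \<psi> z \<noteq> 0} \<subseteq> cball (G (t0, s0)) \<rho>" "\<And>z. cmod (\<psi> z) \<le> 1" for \<rho> \<psi>
  proof -
    have near: "\<bar>t - t0\<bar> \<le> C * \<rho> \<and> \<bar>s - s0\<bar> \<le> C * \<rho>" if "(t, s) \<in> rect B" "\<psi> (G (t, s)) \<noteq> 0" for t s
    proof -
      have "G (t, s) \<in> cball (G (t0, s0)) \<rho>" using \<psi>(2) that(2) closure_subset[of "{z. \<psi> z \<noteq> 0}"] by blast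
      then have "C * dist (G (t, s)) (G (t0, s0)) \<le> C * \<rho>" using C(1) by (simp add: dist_commute)
      then have "dist (t, s) (t0, s0) \<le> C * \<rho>" using C(2)[OF that(1) x0r] by linarith
      moreover have "dist t t0 \<le> dist (t, s) (t0, s0)" "dist s s0 \<le> dist (t, s) (t0, s0)"
        using dist_fst_le[of "(t, s)" "(t0, s0)"] dist_snd_le[of "(t, s)" "(t0, s0)"] by auto
      ultimately show ?thesis by (simp add: dist_real_def)
    qed
    let ?F = "\<lambda>s. integral {tmin B..tmax B} (\<lambda>t. \<psi> (G (t, s)) \<bullet> G' (t, s))"
    have F: "\<bar>?F s\<bar> \<le> indicator (cball s0 (C * \<rho>)) s * (2 * C * K * \<rho>)" if s: "s \<in> {smin B<..<smax B}" for s
    proof (cases "\<bar>s - s0\<bar> \<le> C * \<rho>")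
      case False
      then have "\<psi> (G (t, s)) = 0" if "t \<in> {tmin B..tmax B}" for t
        using near[of t s] that s by (auto simp: rect_def)
      then have "?F s = integral {tmin B..tmax B} (\<lambda>t. 0)" by (intro integral_cong) simp
      then show ?thesis using C(1) K(1) \<rho> by (auto split: split_indicator)
    next
      case True
      define I where "I = {t0 - C * \<rho>..t0 + C * \<rho>}"
      let ?g = "\<lambda>t. if t \<in> I then K else 0"
      have Int: "{tmin B..tmax B} \<inter> I = {max (tmin B) (t0 - C * \<rho>)..min (tmax B) (t0 + C * \<rho>)}"
        by (auto simp: I_def)
      have gi: "?g integrable_on {tmin B..tmax B}"
        unfolding integrable_restrict_Int Int_commute[of I] Int by (rule integrable_const_ivl)
      have bnd: "norm (\<psi> (G (t, s)) \<bullet> G' (t, s)) \<le> ?g t" if t: "t \<in> {tmin B..tmax B}" for t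
      proof (cases "\<psi> (G (t, s)) = 0")
        case False
        have r: "(t, s) \<in> rect B" using t s by (auto simp: rect_def)
        have "\<bar>\<psi> (G (t, s)) \<bullet> G' (t, s)\<bar> \<le> cmod (\<psi> (G (t, s))) * cmod (G' (t, s))" by (rule Cauchy_Schwarz_ineq2)
        also have "\<dots> \<le> 1 * K" using \<psi>(3) K(2)[OF r] by (intro mult_mono) auto
        moreover have "t \<in> I" using near[OF r False] by (auto simp: I_def abs_le_iff)
        ultimately show ?thesis by simp
      qed (use K(1) in auto)
      have "integral {tmin B..tmax B} ?g \<le> 2 * C * K * \<rho>"
      proof -
        have "integral {tmin B..tmax B} ?g = integral ({tmin B..tmax B} \<inter> I) (\<lambda>t. K)"
          unfolding integral_restrict_Int Int_commute[of I] ..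
        also have "\<dots> = K * measure lborel {max (tmin B) (t0 - C * \<rho>)..min (tmax B) (t0 + C * \<rho>)}"
          unfolding Int by simp
        also have "\<dots> \<le> K * (2 * C * \<rho>)"
          using K(1) C(1) \<rho> by (intro mult_left_mono) (auto simp: content_real_if)
        finally show ?thesis by (simp add: mult_ac)
      qed
      moreover have "\<bar>?F s\<bar> \<le> integral {tmin B..tmax B} ?g"
      proof (cases "(\<lambda>t. \<psi> (G (t, s)) \<bullet> G' (t, s)) integrable_on {tmin B..tmax B}")
        case True
        then show ?thesis using integral_norm_bound_integral[OF True gi bnd] by simp
      next
        case False
        then show ?thesis using integral_nonneg[OF gi] K(1) by (simp add: not_integrable_integral)
      qed
      moreover have "s \<in> cball s0 (C * \<rho>)" using True by (simp add: dist_real_def abs_minus_commute)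
      ultimately show ?thesis by simp
    qed
    have sub': "closure {z. \<psi> z \<noteq> 0} \<subseteq> G ` open_rect B" using \<psi>(2) sub by blast
    have "\<bar>T (pushforward p \<psi>)\<bar> = \<bar>\<integral>s. indicator {smin B<..<smax B} s *\<^sub>R ?F s \<partial>\<nu> B\<bar>"
      unfolding current_in_box[OF M O T A \<psi>(1) sub'] set_lebesgue_integral_def ..
    also have "\<dots> \<le> (\<integral>s. \<bar>indicator {smin B<..<smax B} s *\<^sub>R ?F s\<bar> \<partial>\<nu> B)" by (rule integral_abs_bound)
    also have "\<dots> \<le> (\<integral>s. indicator (cball s0 (C * \<rho>)) s * (2 * C * K * \<rho>) \<partial>\<nu> B)"
    proof (rule integral_mono')
      show "integrable (\<nu> B) (\<lambda>s. indicator (cball s0 (C * \<rho>)) s * (2 * C * K * \<rho>))"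
        by (intro integrable_mult_left integrable_real_indicator) (auto simp: sets less_top[symmetric])
      show "\<bar>indicator {smin B<..<smax B} s *\<^sub>R ?F s\<bar> \<le> indicator (cball s0 (C * \<rho>)) s * (2 * C * K * \<rho>)" for s
        using F[of s] C(1) K(1) \<rho> by (auto split: split_indicator)
    qed (use C(1) K(1) \<rho> in auto)
    also have "\<dots> = (2 * C * K * \<rho>) * measure (\<nu> B) (cball s0 (C * \<rho>))"
      by (simp add: sets sp)
    finally show ?thesis .
  qed
  \<comment> \<open>One constant that serves as a factor and as a radius.\<close>
  define D where "D = max C (2 * C * K)"
  have D: "D > 0" "C \<le> D" "2 * C * K \<le> D" using C(1) by (auto simp: D_def)
  have "\<bar>T (pushforward p \<psi>)\<bar> \<le> D * \<rho> * measure (\<nu> B) (cball s0 (D * \<rho>))"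
    if \<rho>: "0 < \<rho>" and sub: "cball (G (t0, s0)) \<rho> \<subseteq> G ` open_rect B" and \<psi>: "test_form \<psi>"
      "closure {z. \<psi> z \<noteq> 0} \<subseteq> cball (G (t0, s0)) \<rho>" "\<And>z. cmod (\<psi> z) \<le> 1" for \<rho> \<psi>
  proof -
    have "cball s0 (C * \<rho>) \<subseteq> cball s0 (D * \<rho>)" using D \<rho> by (intro subset_cball) simp
    then have m: "measure (\<nu> B) (cball s0 (C * \<rho>)) \<le> measure (\<nu> B) (cball s0 (D * \<rho>))"
      by (intro N.finite_measure_mono) (auto simp: sets)
    have "(2 * C * K * \<rho>) * measure (\<nu> B) (cball s0 (C * \<rho>)) \<le> (D * \<rho>) * measure (\<nu> B) (cball s0 (D * \<rho>))"
      using D \<rho> m by (intro mult_mono) auto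
    then show ?thesis using bound[OF that] by linarith
  qed
  then show ?thesis using D(1) by (intro exI[of _ D]) blast
qed

lemma blow_form_in_box:
  assumes n: "cmod n = 1" and r: "r > 0" and sub: "cball z (2 * r) \<subseteq> G ` open_rect B" and u: "G ` open_rect B \<subseteq> uhp"
  shows "test_form (blow_form z n r)" "closure {w. blow_form z n r w \<noteq> 0} \<subseteq> cball z (2 * r)"
  using test_form_blow_form[OF n r order_trans[OF sub u]] .

lemma eventually_ball_in_open:
  fixes z :: complex
  assumes "open V" "z \<in> V"
  shows "\<forall>\<^sub>F r in at_right 0. cball z (2 * r) \<subseteq> V"
proof -
  obtain e where e: "e > 0" "cball z e \<subseteq> V" using assms open_contains_cball by blast
  have "cball z (2 * r) \<subseteq> V" if "r < e / 2" for r using e(2) subset_cball[of "2 * r" e z] that by auto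
  then show ?thesis unfolding eventually_at_right_field using e(1) by (intro exI[of _ "e / 2"]) auto
qed

text \<open>
The transverse measure of shrinking intervals around \<open>s0\<close> tends to the mass of \<open>s0\<close>.
\<close>
lemma current_blow_small:
  assumes M: "closed_hyperbolic_surface M p" and O: "oriented_lamination M p S L dir"
    and \<nu>: "transverse_measure M p S \<nu>"
    and T: "ruelle_sullivan_current M p S L dir \<nu> T"
    and A: "adapted_lift M p S L dir B G G'" and x0: "(t0, s0) \<in> open_rect B"
    and zero: "emeasure (\<nu> B) {s0} = 0" and n: "cmod n = 1"
  shows "((\<lambda>r. T (pushforward p (blow_form (G (t0, s0)) n r)) / r) \<longlongrightarrow> 0) (at_right 0)"
proof -
  note B = adapted_facts(2)[OF A] and G = adapted_facts(3)[OF A]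
  let ?z = "G (t0, s0)" and ?V = "G ` open_rect B"
  have V: "open ?V" "?z \<in> ?V" "?V \<subseteq> uhp"
    using lift_open_image[OF B G open_open_rect open_rect_subset] x0 chart_lift_facts(2)[OF G] open_rect_subset[of B] by auto
  obtain C where C: "C > 0" "\<And>\<rho> \<psi>. 0 < \<rho> \<Longrightarrow> cball ?z \<rho> \<subseteq> ?V \<Longrightarrow> test_form \<psi> \<Longrightarrow>
     closure {z. \<psi> z \<noteq> 0} \<subseteq> cball ?z \<rho> \<Longrightarrow> (\<And>z. cmod (\<psi> z) \<le> 1) \<Longrightarrow>
     \<bar>T (pushforward p \<psi>)\<bar> \<le> C * \<rho> * measure (\<nu> B) (cball s0 (C * \<rho>))"
    using current_bound[OF M O \<nu> T A x0] by blast
  have sets: "sets (\<nu> B) = sets borel" and fin: "emeasure (\<nu> B) UNIV < \<infinity>"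
    using \<nu> B by (auto simp: transverse_measure_def)
  have sp: "space (\<nu> B) = UNIV" using sets_eq_imp_space_eq[OF sets] by simp
  interpret N: finite_measure "\<nu> B" by (rule finite_measureI) (use fin sp in auto)
  let ?m = "\<lambda>r. measure (\<nu> B) (cball s0 (C * (2 * r)))"
  have lim: "(?m \<longlongrightarrow> 0) (at_right 0)"
  proof (rule tendstoI)
    fix e :: real assume e: "e > 0"
    have "(\<lambda>k. measure (\<nu> B) (cball s0 (1 / Suc k))) \<longlonglongrightarrow> measure (\<nu> B) (\<Inter>k. cball s0 (1 / Suc k))"
    proof (rule N.finite_Lim_measure_decseq)
      show "range (\<lambda>k. cball s0 (1 / real (Suc k))) \<subseteq> sets (\<nu> B)" by (auto simp: sets)
      show "decseq (\<lambda>k. cball s0 (1 / real (Suc k)))"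
        unfolding decseq_def by (intro allI impI subset_cball) (simp add: frac_le)
    qed
    moreover have "(\<Inter>k. cball s0 (1 / real (Suc k))) = {s0}"
    proof -
      have "x = s0" if "\<forall>k. dist s0 x \<le> 1 / real (Suc k)" for x
      proof (rule ccontr)
        assume "x \<noteq> s0"
        then obtain k where "inverse (real (Suc k)) < dist s0 x" using reals_Archimedean[of "dist s0 x"] by auto
        then show False using that[rule_format, of k] by (simp add: inverse_eq_divide)
      qed
      then show ?thesis by auto
    qed
    ultimately have "(\<lambda>k. measure (\<nu> B) (cball s0 (1 / Suc k))) \<longlonglongrightarrow> 0" using zero by (simp add: measure_def)
    then have "\<forall>\<^sub>F k in sequentially. measure (\<nu> B) (cball s0 (1 / Suc k)) < e" using e by (rule order_tendstoD)
    then obtain k where k: "measure (\<nu> B) (cball s0 (1 / Suc k)) < e" by (auto simp: eventually_sequentially)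
    have "?m r < e" if r: "0 < r" "r < 1 / Suc k / (2 * C)" for r
    proof -
      have "r * (2 * C) < 1 / Suc k / (2 * C) * (2 * C)" using r(2) C(1) by (intro mult_strict_right_mono) auto
      also have "\<dots> = 1 / Suc k" using C(1) by simp
      finally have "r * (2 * C) < 1 / Suc k" .
      then have "C * (2 * r) \<le> 1 / Suc k" by (simp add: mult_ac)
      then have "?m r \<le> measure (\<nu> B) (cball s0 (1 / Suc k))"
        by (intro N.finite_measure_mono subset_cball) (auto simp: sets)
      then show ?thesis using k by simp
    qed
    then show "\<forall>\<^sub>F r in at_right 0. dist (?m r) 0 < e"
      unfolding eventually_at_right_field using C(1) by (intro exI[of _ "1 / Suc k / (2 * C)"]) auto
  qed
  show ?thesis
  proof (rule Lim_null_comparison)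
    show "((\<lambda>r. C * 2 * ?m r) \<longlongrightarrow> 0) (at_right 0)" using tendsto_mult_left[OF lim, of "C * 2"] by simp
    show "\<forall>\<^sub>F r in at_right 0. norm (T (pushforward p (blow_form ?z n r)) / r) \<le> C * 2 * ?m r"
      using eventually_ball_in_open[OF V(1,2)] eventually_at_right_less[of 0]
    proof eventually_elim
      case (elim r)
      then have "\<bar>T (pushforward p (blow_form ?z n r))\<bar> \<le> C * (2 * r) * ?m r"
        using blow_form_in_box[OF n _ elim(1) V(3)] by (intro C(2) norm_blow_form_le[OF n]) auto
      then show ?case using elim(2) by (simp add: divide_le_eq mult_ac)
    qed
  qed
qed

lemma bell_lower_bound: "\<exists>h>0. \<forall>x. \<bar>x\<bar> \<le> 1/2 \<longrightarrow> h \<le> hump (- 1) 1 x"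
proof -
  have "continuous_on {-1/2..1/2} (hump (-1) 1)"
    using continuous_on_subset[OF smooth_real_continuous[OF smooth_real_hump]] by blast
  then obtain x0 where x0: "x0 \<in> {-1/2..1/2}" "\<forall>x\<in>{-1/2..1/2}. hump (-1) 1 x0 \<le> hump (-1) 1 x"
    using continuous_attains_inf[of "{-1/2..1/2::real}" "hump (-1) 1"] by auto
  have "hump (-1) 1 x0 > 0" using x0(1) by (simp add: hump_pos_iff)
  moreover have "hump (-1) 1 x0 \<le> hump (-1) 1 x" if "\<bar>x\<bar> \<le> 1/2" for x
    by (rule x0(2)[rule_format]) (use that in auto)
  ultimately show ?thesis by blast
qed

text \<open>
A vanishing derivative would contradict the lower Lipschitz bound.
\<close>
lemma lift_tangent_nonzero:
  assumes M: "closed_hyperbolic_surface M p" and A: "adapted_lift M p S L dir B G G'" and ts: "(t, s) \<in> rect B"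
  shows "G' (t, s) \<noteq> 0"
proof
  assume 0: "G' (t, s) = 0"
  note B = adapted_facts(2)[OF A] and G = adapted_facts(3)[OF A]
  obtain C where C: "C > 0" "\<And>x y. x \<in> rect B \<Longrightarrow> y \<in> rect B \<Longrightarrow> dist x y \<le> C * dist (G x) (G y)"
    using lift_expanding[OF M B G] by blast
  let ?I = "{tmin B..tmax B}"
  have t: "t \<in> ?I" "s \<in> {smin B..smax B}" using ts by (auto simp: rect_def)
  have "((\<lambda>\<tau>. G (\<tau>, s)) has_derivative (\<lambda>h. h *\<^sub>R 0)) (at t within ?I)"
    using adapted_facts(5)[OF A ts] 0 by (simp add: has_vector_derivative_def)
  then have "\<forall>e>0. \<exists>d>0. \<forall>\<tau>\<in>?I. norm (\<tau> - t) < d \<longrightarrow> norm (G (\<tau>, s) - G (t, s)) \<le> e * norm (\<tau> - t)"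
    unfolding has_derivative_within_alt by simp
  then obtain d where d: "d > 0" "\<And>\<tau>. \<tau> \<in> ?I \<Longrightarrow> norm (\<tau> - t) < d \<Longrightarrow> norm (G (\<tau>, s) - G (t, s)) \<le> 1 / (2 * C) * norm (\<tau> - t)"
    using C(1) by (metis zero_less_divide_1_iff zero_less_mult_iff zero_less_numeral)
  have "tmin B < tmax B" using B by (simp add: flow_box_def)
  then obtain \<tau> where \<tau>: "\<tau> \<in> ?I" "norm (\<tau> - t) < d" "\<tau> \<noteq> t"
  proof (cases "t < tmax B")
    case True
    then show ?thesis using d(1) t by (intro that[of "min (tmax B) (t + d / 2)"]) auto
  next
    case False
    then show ?thesis using d(1) t \<open>tmin B < tmax B\<close> by (intro that[of "max (tmin B) (t - d / 2)"]) auto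
  qed
  have "(\<tau>, s) \<in> rect B" using \<tau>(1) t(2) by (auto simp: rect_def)
  then have "dist (\<tau>, s) (t, s) \<le> C * dist (G (\<tau>, s)) (G (t, s))" using C(2) ts by blast
  also have "dist (\<tau>, s) (t, s) = \<bar>\<tau> - t\<bar>" by (simp add: dist_Pair_Pair dist_real_def)
  also have "C * dist (G (\<tau>, s)) (G (t, s)) \<le> C * (1 / (2 * C) * \<bar>\<tau> - t\<bar>)"
    using d(2)[OF \<tau>(1,2)] C(1) by (intro mult_left_mono) (auto simp: dist_norm)
  also have "\<dots> = \<bar>\<tau> - t\<bar> / 2" using C(1) by simp
  finally show False using \<tau>(3) by simp
qed

text \<open>
  For small \<open>r\<close> only the plaque \<open>s0\<close> contributes, with its mass as a factor.  The
  covector \<open>\<i> n\<close> is the unit tangent of the plaque, so the integrand is nonnegative, and it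
  is bounded below during a time proportional to \<open>r\<close>.
\<close>
lemma current_blow_large:
  assumes M: "closed_hyperbolic_surface M p" and O: "oriented_lamination M p S L dir"
    and \<nu>: "transverse_measure M p S \<nu>"
    and T: "ruelle_sullivan_current M p S L dir \<nu> T"
    and A: "adapted_lift M p S L dir B G G'" and x0: "(t0, s0) \<in> open_rect B"
    and pos: "emeasure (\<nu> B) {s0} \<noteq> 0"
    and iso: "\<delta> > 0" "\<And>s. s \<in> leafset B \<Longrightarrow> \<bar>s - s0\<bar> < \<delta> \<Longrightarrow> s = s0"
    and n: "cmod n = 1" "\<i> * n = G' (t0, s0) / of_real (cmod (G' (t0, s0)))"
  shows "\<exists>c>0. \<forall>\<^sub>F r in at_right 0. T (pushforward p (blow_form (G (t0, s0)) n r)) / r \<ge> c"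
proof -
  note B = adapted_facts(2)[OF A] and G = adapted_facts(3)[OF A]
  let ?z = "G (t0, s0)" and ?V = "G ` open_rect B" and ?\<tau> = "G' (t0, s0)"
  have x0r: "(t0, s0) \<in> rect B" using x0 open_rect_subset by blast
  have V: "open ?V" "?z \<in> ?V" "?V \<subseteq> uhp"
    using lift_open_image[OF B G open_open_rect open_rect_subset] x0 chart_lift_facts(2)[OF G] open_rect_subset[of B] by auto
  have tau: "?\<tau> \<noteq> 0" by (rule lift_tangent_nonzero[OF M A x0r])
  obtain C where C: "C > 0" "\<And>x y. x \<in> rect B \<Longrightarrow> y \<in> rect B \<Longrightarrow> dist x y \<le> C * dist (G x) (G y)"
    using lift_expanding[OF M B G] by blast
  obtain h where h: "h > 0" "\<And>x. \<bar>x\<bar> \<le> 1/2 \<Longrightarrow> h \<le> hump (- 1) 1 x" using bell_lower_bound by blast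
  obtain K W where K: "K > 0" "open W" "(t0, s0) \<in> W" "\<And>y. y \<in> rect B \<inter> W \<Longrightarrow> dist (G y) ?z \<le> K * dist y (t0, s0)"
    using lift_locally_lipschitz[OF M B G x0r] by blast
  obtain d1 where d1: "d1 > 0" "ball (t0, s0) d1 \<subseteq> W" using K(2,3) open_contains_ball by blast
  have s0: "s0 \<in> {smin B<..<smax B}" "t0 \<in> {tmin B<..<tmax B}" using x0 by (auto simp: open_rect_def)
  have cG': "continuous_on {tmin B..tmax B} (\<lambda>t. G' (t, s0))"
    by (rule continuous_on_compose2[OF adapted_facts(4)[OF A]]) (use s0 in \<open>auto intro!: continuous_intros simp: rect_def\<close>)
  moreover have "cmod ?\<tau> / 2 > 0" using tau by simp
  moreover have "t0 \<in> {tmin B..tmax B}" using s0 by auto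
  ultimately obtain d2 where d2': "d2 > 0"
    "\<forall>t\<in>{tmin B..tmax B}. dist t t0 < d2 \<longrightarrow> dist (G' (t, s0)) ?\<tau> < cmod ?\<tau> / 2"
    unfolding continuous_on_iff by blast
  then have d2: "d2 > 0" "\<And>t. t \<in> {tmin B..tmax B} \<Longrightarrow> \<bar>t - t0\<bar> < d2 \<Longrightarrow> cmod (G' (t, s0) - ?\<tau>) < cmod ?\<tau> / 2"
    by (auto simp: dist_norm)
  obtain d3 where d3: "d3 > 0" "\<And>t. \<bar>t - t0\<bar> \<le> d3 \<Longrightarrow> t \<in> {tmin B..tmax B}"
  proof
    show "min (t0 - tmin B) (tmax B - t0) > 0" using s0 by auto
    show "t \<in> {tmin B..tmax B}" if "\<bar>t - t0\<bar> \<le> min (t0 - tmin B) (tmax B - t0)" for t using that by auto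
  qed
  have sets: "sets (\<nu> B) = sets borel" and fin: "emeasure (\<nu> B) UNIV < \<infinity>" and conc: "emeasure (\<nu> B) (- leafset B) = 0"
    using \<nu> B by (auto simp: transverse_measure_def)
  have sp: "space (\<nu> B) = UNIV" using sets_eq_imp_space_eq[OF sets] by simp
  interpret N: finite_measure "\<nu> B" by (rule finite_measureI) (use fin sp in auto)
  have m: "measure (\<nu> B) {s0} > 0" using pos by (simp add: N.emeasure_eq_measure zero_less_measure_iff)
  have ae: "AE s in \<nu> B. s \<in> leafset B"
  proof (rule AE_I')
    show "- leafset B \<in> null_sets (\<nu> B)" using conc B by (simp add: null_sets_def sets flow_box_def)
  qed (auto simp: sp)
  let ?\<zeta> = "\<i> * n"
  have zt: "?\<zeta> \<bullet> w \<ge> cmod ?\<tau> / 2" if "cmod (w - ?\<tau>) < cmod ?\<tau> / 2" for w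
  proof -
    have "?\<zeta> = ?\<tau> /\<^sub>R cmod ?\<tau>" unfolding n(2) by (simp add: scaleR_conv_of_real divide_inverse mult.commute)
    then have "?\<zeta> \<bullet> ?\<tau> = cmod ?\<tau>" using tau by (simp add: dot_square_norm power2_eq_square)
    moreover have "\<bar>?\<zeta> \<bullet> (w - ?\<tau>)\<bar> \<le> cmod ?\<zeta> * cmod (w - ?\<tau>)" by (rule Cauchy_Schwarz_ineq2)
    moreover have "cmod ?\<zeta> = 1" using n(1) by (simp add: norm_mult)
    ultimately show ?thesis using that by (simp add: inner_diff_right)
  qed
  define c where "c = measure (\<nu> B) {s0} * (h * h * (cmod ?\<tau> / 2)) * (1 / K)"
  have c: "c > 0" using m h K tau by (simp add: c_def)
  \<comment> \<open>The disc of radius \<open>2 r\<close> only contains points with parameters within \<open>2 r C\<close> of \<open>(t0, s0)\<close>, and times within \<open>r / (2 K)\<close> of \<open>t0\<close> lead to points within \<open>r / 2\<close> of the centre, where both factors of the bump are at least \<open>h\<close>.\<close>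
  define r0 where "r0 = Min {\<delta> / (4 * C), d2 / (4 * C), d1 * K, d3 * K}"
  have r0: "r0 > 0" using iso(1) C(1) d2(1) d1(1) d3(1) K(1) by (simp add: r0_def)
  have main: "c \<le> T (pushforward p (blow_form ?z n r)) / r" if r: "0 < r" "r < r0" and sub: "cball ?z (2 * r) \<subseteq> ?V" for r
  proof -
    have rr: "2 * r * C < \<delta>" "2 * r * C < d2" "r / (2 * K) < d1" "r / (2 * K) \<le> d3"
      using r iso(1) C(1) K(1) d1(1) d2(1) d3(1) by (auto simp: r0_def field_simps)
    let ?\<psi> = "blow_form ?z n r"
    note tf = blow_form_in_box[OF n(1) r(1) sub V(3)]
    let ?\<eta> = "\<lambda>w. hump (- 1) 1 (((w - ?z) \<bullet> n) / r) * hump (- 1) 1 (((w - ?z) \<bullet> ?\<zeta>) / r)"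
    have psi: "?\<psi> w \<bullet> u = ?\<eta> w * (?\<zeta> \<bullet> u)" for w u
      unfolding blow_form_def by (simp only: scaleR_conv_of_real[symmetric] inner_scaleR_left)
    have eta: "?\<eta> w \<ge> 0" for w by (simp add: hump_nonneg)
    have near: "\<bar>t - t0\<bar> \<le> 2 * r * C \<and> \<bar>s - s0\<bar> \<le> 2 * r * C" if "(t, s) \<in> rect B" "?\<psi> (G (t, s)) \<noteq> 0" for t s
    proof -
      have "G (t, s) \<in> cball ?z (2 * r)" using tf(2) that(2) closure_subset[of "{w. ?\<psi> w \<noteq> 0}"] by blast
      then have "C * dist (G (t, s)) ?z \<le> C * (2 * r)" using C(1) by (simp add: dist_commute)
      then have "dist (t, s) (t0, s0) \<le> 2 * r * C" using C(2)[OF that(1) x0r] by (simp add: mult_ac)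
      moreover have "dist t t0 \<le> dist (t, s) (t0, s0)" "dist s s0 \<le> dist (t, s) (t0, s0)"
        using dist_fst_le[of "(t, s)" "(t0, s0)"] dist_snd_le[of "(t, s)" "(t0, s0)"] by auto
      ultimately show ?thesis by (simp add: dist_real_def)
    qed
    let ?F = "\<lambda>s. integral {tmin B..tmax B} (\<lambda>t. ?\<psi> (G (t, s)) \<bullet> G' (t, s))"
    have F0: "?F s = 0" if "s \<in> {smin B<..<smax B}" "\<bar>s - s0\<bar> \<ge> \<delta>" for s
    proof -
      have "?\<psi> (G (t, s)) = 0" if "t \<in> {tmin B..tmax B}" for t
        using near[of t s] that \<open>s \<in> _\<close> \<open>\<bar>s - s0\<bar> \<ge> \<delta>\<close> rr(1) by (auto simp: rect_def)
      then have "?F s = integral {tmin B..tmax B} (\<lambda>t. 0)" by (intro integral_cong) simp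
      then show ?thesis by simp
    qed
    have c\<psi>: "continuous_on UNIV ?\<psi>"
      using tf(1) unfolding test_form_def smooth_on_def by (metis Ck_on.simps(1))
    have cont: "continuous_on (rect B) (\<lambda>x. ?\<psi> (G x) \<bullet> G' x)"
      by (intro continuous_on_inner adapted_facts(4)[OF A] continuous_on_compose2[OF c\<psi> chart_lift_facts(1)[OF G]]) auto
    have "continuous_on ({smin B..smax B} \<times> cbox (tmin B) (tmax B)) (\<lambda>x. ?\<psi> (G (snd x, fst x)) \<bullet> G' (snd x, fst x))"
      by (rule continuous_on_compose2[OF cont, of _ "\<lambda>x. (snd x, fst x)"])
        (auto intro!: continuous_intros simp: rect_def)
    then have "continuous_on ({smin B..smax B} \<times> cbox (tmin B) (tmax B)) (\<lambda>(s, t). ?\<psi> (G (t, s)) \<bullet> G' (t, s))"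
      by (simp add: case_prod_unfold)
    then have cF: "continuous_on {smin B..smax B} ?F" by (drule_tac integral_continuous_on_param) simp
    have "T (pushforward p ?\<psi>) = (\<integral>s. indicator {smin B<..<smax B} s *\<^sub>R ?F s \<partial>\<nu> B)"
      unfolding set_lebesgue_integral_def[symmetric]
      by (rule current_in_box[OF M O T A tf(1)]) (use tf(2) sub in blast)
    also have "\<dots> = (\<integral>s. indicator {s0} s *\<^sub>R ?F s0 \<partial>\<nu> B)"
    proof (rule integral_cong_AE)
      have "(\<lambda>s. indicator {smin B<..<smax B} s *\<^sub>R ?F s) \<in> borel_measurable borel"
        by (rule borel_measurable_continuous_on_indicator) (auto intro: continuous_on_subset[OF cF])
      then show "(\<lambda>s. indicator {smin B<..<smax B} s *\<^sub>R ?F s) \<in> borel_measurable (\<nu> B)"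
        using measurable_cong_sets[OF sets refl] by blast
      have "(\<lambda>s. indicator {s0} s *\<^sub>R ?F s0) \<in> borel_measurable borel" by measurable
      then show "(\<lambda>s. indicator {s0} s *\<^sub>R ?F s0) \<in> borel_measurable (\<nu> B)"
        using measurable_cong_sets[OF sets refl] by blast
      show "AE s in \<nu> B. indicator {smin B<..<smax B} s *\<^sub>R ?F s = indicator {s0} s *\<^sub>R ?F s0"
        using ae
      proof eventually_elim
        case (elim s)
        show ?case
        proof (cases "s = s0")
          case False
          then have "\<bar>s - s0\<bar> \<ge> \<delta>" using iso(2)[OF elim] by fastforce
          then show ?thesis using False F0[of s] by (simp split: split_indicator)
        qed (use s0 in simp)
      qed
    qed
    also have "\<dots> = measure (\<nu> B) {s0} * ?F s0" by (simp add: sp sets)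
    finally have TF: "T (pushforward p ?\<psi>) = measure (\<nu> B) {s0} * ?F s0" .
    have "(h * h * (cmod ?\<tau> / 2)) * (r / K) \<le> ?F s0"
    proof -
      define I where "I = {t0 - r / (2 * K)..t0 + r / (2 * K)}"
      let ?f = "\<lambda>t. ?\<psi> (G (t, s0)) \<bullet> G' (t, s0)"
      have fi: "?f integrable_on {tmin B..tmax B}"
      proof (rule integrable_continuous_real)
        show "continuous_on {tmin B..tmax B} ?f"
          by (rule continuous_on_compose2[OF cont]) (use s0 in \<open>auto intro!: continuous_intros simp: rect_def\<close>)
      qed
      have IS: "I \<subseteq> {tmin B..tmax B}" using d3(2) rr(4) by (force simp: I_def abs_le_iff)
      have f0: "?f t \<ge> 0" if t: "t \<in> {tmin B..tmax B}" for t
      proof (cases "?\<psi> (G (t, s0)) = 0")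
        case False
        then have "\<bar>t - t0\<bar> < d2" using near[of t s0] t s0 rr(2) by (auto simp: rect_def)
        then have "?\<zeta> \<bullet> G' (t, s0) \<ge> cmod ?\<tau> / 2" by (intro zt d2(2) t)
        then have "?\<zeta> \<bullet> G' (t, s0) \<ge> 0" using norm_ge_zero[of ?\<tau>] by linarith
        then show ?thesis unfolding psi by (intro mult_nonneg_nonneg hump_nonneg)
      qed simp
      have fI: "h * h * (cmod ?\<tau> / 2) \<le> ?f t" if t: "t \<in> I" for t
      proof -
        have ti: "\<bar>t - t0\<bar> \<le> r / (2 * K)" using t by (auto simp: I_def abs_le_iff)
        have tS: "t \<in> {tmin B..tmax B}" using t IS by blast
        have rb: "(t, s0) \<in> rect B" using tS s0 by (auto simp: rect_def)
        have dd: "dist (t, s0) (t0, s0) = \<bar>t - t0\<bar>" by (simp add: dist_Pair_Pair dist_real_def)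
        then have "(t, s0) \<in> W" using d1(2) ti rr(3) by (force simp: dist_commute)
        then have "dist (G (t, s0)) ?z \<le> K * \<bar>t - t0\<bar>" using K(4)[of "(t, s0)"] rb dd by simp
        also have "\<dots> \<le> K * (r / (2 * K))" using ti K(1) by (intro mult_left_mono) auto
        finally have gz: "cmod (G (t, s0) - ?z) \<le> r / 2" using K(1) by (simp add: dist_norm)
        have one: "\<bar>((G (t, s0) - ?z) \<bullet> u) / r\<bar> \<le> 1 / 2" if "cmod u = 1" for u
        proof -
          have "\<bar>(G (t, s0) - ?z) \<bullet> u\<bar> \<le> cmod (G (t, s0) - ?z) * cmod u" by (rule Cauchy_Schwarz_ineq2)
          then show ?thesis using gz that r(1) by (simp add: divide_le_eq)
        qed
        have "h * h \<le> ?\<eta> (G (t, s0))"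
          using h one[OF n(1)] one[of ?\<zeta>] n(1) by (intro mult_mono) (auto simp: norm_mult hump_nonneg)
        moreover have "cmod ?\<tau> / 2 \<le> ?\<zeta> \<bullet> G' (t, s0)"
        proof (rule zt[OF d2(2)[OF tS]])
          show "\<bar>t - t0\<bar> < d2"
          proof -
            have "dist (t, s0) (t0, s0) \<le> C * dist (G (t, s0)) ?z" by (rule C(2)[OF rb x0r])
            also have "\<dots> \<le> C * (r / 2)" using gz C(1) by (intro mult_left_mono) (auto simp: dist_norm)
            also have "\<dots> \<le> 2 * r * C" using C(1) r(1) by simp
            finally show ?thesis using rr(2) dd by simp
          qed
        qed
        ultimately show ?thesis unfolding psi by (rule mult_mono) (simp_all add: hump_nonneg)
      qed
      have fiI: "?f integrable_on I"
        using integrable_subinterval_real[OF fi IS[unfolded I_def]] by (simp add: I_def)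
      have "integral I (\<lambda>t. h * h * (cmod ?\<tau> / 2)) \<le> integral I ?f"
        by (rule integral_le[OF _ fiI fI]) (unfold I_def, rule integrable_const_ivl)
      moreover have "integral I ?f \<le> integral {tmin B..tmax B} ?f"
        by (rule integral_subset_le[OF IS fiI fi]) (use f0 in blast)
      moreover have "integral I (\<lambda>t. h * h * (cmod ?\<tau> / 2)) = (h * h * (cmod ?\<tau> / 2)) * (r / K)"
      proof -
        have "measure lborel I = r / K" using r(1) K(1) by (simp add: I_def)
        then show ?thesis unfolding I_def integral_const_real by (simp add: mult_ac)
      qed
      ultimately show ?thesis by linarith
    qed
    then have "measure (\<nu> B) {s0} * ((h * h * (cmod ?\<tau> / 2)) * (r / K)) \<le> T (pushforward p ?\<psi>)"
      unfolding TF by (intro mult_left_mono) auto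
    moreover have "measure (\<nu> B) {s0} * ((h * h * (cmod ?\<tau> / 2)) * (r / K)) = c * r" by (simp add: c_def)
    ultimately show ?thesis using r(1) by (simp add: le_divide_eq)
  qed
  have "\<forall>\<^sub>F r in at_right 0. r < r0" using r0 by (simp add: eventually_at_right_field) (meson dense)
  then have "\<forall>\<^sub>F r in at_right 0. T (pushforward p (blow_form ?z n r)) / r \<ge> c"
    using eventually_ball_in_open[OF V(1,2)] eventually_at_right_less[of 0]
    by eventually_elim (rule main)
  then show ?thesis using c by blast
qed

section \<open>The mass of a leaf\<close>

lemma oriented_lamination_leaves:
  assumes "oriented_lamination M p S L dir"
  shows "lamination_leaves M p S L" "l \<in> L \<Longrightarrow> complete_geodesic p (dir l)" "l \<in> L \<Longrightarrow> simple_geodesic (dir l)"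
    "l \<in> L \<Longrightarrow> range (dir l) = l" "disjoint L" "\<Union>L = S" "closed S" "S \<subseteq> M"
  using assms by (auto simp: oriented_lamination_def lamination_leaves_def)

lemma simple_geodesic_periodic:
  fixes c :: "real \<Rightarrow> 'a"
  assumes "simple_geodesic c" "c u = c u'" "u \<noteq> u'"
  shows "\<exists>T>0. \<forall>w. c (w + T) = c w"
proof -
  have per: "c (u + x) = c (u' + x)" for x using assms unfolding simple_geodesic_def by blast
  have "c (w + \<bar>u - u'\<bar>) = c w" for w
  proof (cases "u \<ge> u'")
    case True
    then have "w + \<bar>u - u'\<bar> = u + (w - u')" "u' + (w - u') = w" by auto
    then show ?thesis using per[of "w - u'"] by (simp only:)
  next
    case False
    then have "w + \<bar>u - u'\<bar> = u' + (w - u)" "u + (w - u) = w" by auto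
    then show ?thesis using per[of "w - u"] by (simp only:)
  qed
  then show ?thesis using assms(3) by (intro exI[of _ "\<bar>u - u'\<bar>"]) auto
qed

lemma dir_continuous:
  assumes M: "closed_hyperbolic_surface M p" and c: "complete_geodesic p c"
  shows "continuous_on UNIV c"
proof -
  obtain g where g: "hyperbolic_line g" "c = p \<circ> g" using c by (auto simp: complete_geodesic_def)
  then have u: "g t \<in> uhp" "hdist (g s) (g t) = \<bar>s - t\<bar>" for s t by (auto simp: hyperbolic_line_def)
  have "dist (c s) (c t) \<le> dist s t" for s t
    using dist_le_hdist[OF M u(1) u(1), of s t] u(2) by (simp add: g(2) dist_real_def)
  then show ?thesis unfolding continuous_on_iff by (meson le_less_trans)
qed

text \<open>
  The leaf is parametrized along the plaque by a strictly increasing continuous function, whose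
  values fill a neighbourhood by the intermediate value theorem; simplicity of the leaf transports
  this to any other parameter of the same point.
\<close>
lemma plaque_covers_leaf:
  assumes O: "oriented_lamination M p S L dir" and B: "oriented_flow_box M p S L dir B"
    and l: "l \<in> L" and t0: "t0 \<in> {tmin B<..<tmax B}" and s0: "s0 \<in> leafset B" and eq: "chart B (t0, s0) = dir l u"
  shows "\<exists>\<epsilon>>0. \<forall>u'. \<bar>u' - u\<bar> < \<epsilon> \<longrightarrow> (\<exists>t\<in>{tmin B<..<tmax B}. dir l u' = chart B (t, s0))"
proof -
  obtain l' \<theta> where \<theta>: "l' \<in> L" "continuous_on {tmin B..tmax B} \<theta>" "strict_mono_on {tmin B..tmax B} \<theta>"
    "\<forall>t\<in>{tmin B..tmax B}. chart B (t, s0) = dir l' (\<theta> t)"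
    using B s0 unfolding oriented_flow_box_def by blast
  have "dir l' (\<theta> t0) = dir l u" using \<theta>(4) t0 eq by auto
  moreover have "dir l' (\<theta> t0) \<in> l'" "dir l u \<in> l" using oriented_lamination_leaves(4)[OF O] l \<theta>(1) by blast+
  ultimately have "l \<inter> l' \<noteq> {}" by auto
  then have ll: "l' = l" using oriented_lamination_leaves(5)[OF O] l \<theta>(1) by (auto dest: disjointD)
  have per: "dir l (\<theta> t0 + x) = dir l (u + x)" for x
    using oriented_lamination_leaves(3)[OF O l] \<open>dir l' (\<theta> t0) = dir l u\<close> ll unfolding simple_geodesic_def by blast
  have mono: "\<theta> (tmin B) < \<theta> t0" "\<theta> t0 < \<theta> (tmax B)"
    using \<theta>(3) t0 by (auto simp: strict_mono_on_def)
  define \<epsilon> where "\<epsilon> = min (\<theta> t0 - \<theta> (tmin B)) (\<theta> (tmax B) - \<theta> t0)"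
  have "\<exists>t\<in>{tmin B<..<tmax B}. dir l u' = chart B (t, s0)" if u': "\<bar>u' - u\<bar> < \<epsilon>" for u'
  proof -
    define y where "y = \<theta> t0 + (u' - u)"
    have y: "\<theta> (tmin B) < y" "y < \<theta> (tmax B)" using u' by (auto simp: y_def \<epsilon>_def)
    obtain t where t: "tmin B \<le> t" "t \<le> tmax B" "\<theta> t = y"
      using IVT'[of \<theta> "tmin B" y "tmax B"] y t0 \<theta>(2) by auto
    then have "t \<in> {tmin B<..<tmax B}" using y by (auto simp: less_le)
    moreover have "chart B (t, s0) = dir l u'" using \<theta>(4) t ll per[of "u' - u"] by (simp add: y_def)
    ultimately show ?thesis by metis
  qed
  moreover have "\<epsilon> > 0" using mono by (simp add: \<epsilon>_def)
  ultimately show ?thesis by blast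
qed

lemma box_at_leaf_point:
  assumes O: "oriented_lamination M p S L dir" and x: "x \<in> S"
  shows "\<exists>B t s. oriented_flow_box M p S L dir B \<and> (t, s) \<in> open_rect B \<and> s \<in> leafset B \<and> chart B (t, s) = x"
proof -
  obtain B t s where B: "oriented_flow_box M p S L dir B" "(t, s) \<in> open_rect B" "chart B (t, s) = x"
    using O x unfolding oriented_lamination_def by force
  then have "s \<in> leafset B"
    using flow_box_leafset[OF oriented_flow_boxD[OF B(1)], of "(t, s)"] open_rect_subset[of B] x by auto
  then show ?thesis using B by blast
qed

text \<open>
Invariance of the transverse measure, applied to the set \<open>{s}\<close>.
\<close>
lemma mass_same_point:
  assumes \<nu>: "transverse_measure M p S \<nu>" and B: "flow_box M p S B" and B': "flow_box M p S B'"
    and x: "(t, s) \<in> open_rect B" "s \<in> leafset B" and x': "(t', s') \<in> open_rect B'"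
    and eq: "chart B (t, s) = chart B' (t', s')"
  shows "emeasure (\<nu> B) {s} = emeasure (\<nu> B') {s'}"
proof -
  have r': "(t', s') \<in> rect B'" using x' open_rect_subset by blast
  have tr: "leaf_transition B B' t s = s'"
    unfolding leaf_transition_def eq by (simp add: the_inv_into_f_f[OF flow_box_inj[OF B'] r'])
  have "t \<in> {tmin B<..<tmax B}" using x by (simp add: open_rect_def)
  then have "emeasure (\<nu> B) {s} = emeasure (\<nu> B') (leaf_transition B B' t ` {s})"
    using \<nu>[unfolded transverse_measure_def, THEN conjunct2, rule_format, of B B' t "{s}"] B B' x x' eq
    by (simp add: tr)
  then show ?thesis by (simp add: tr)
qed

text \<open>
  The mass of the plaque through \<open>dir l u\<close> is a well-defined and locally constant function of
  \<open>u\<close>.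
\<close>
lemma mass_constant_on_leaf:
  assumes M: "closed_hyperbolic_surface M p" and O: "oriented_lamination M p S L dir"
    and \<nu>: "transverse_measure M p S \<nu>" and l: "l \<in> L"
    and B: "oriented_flow_box M p S L dir B" "(t, s) \<in> open_rect B" "s \<in> leafset B" "chart B (t, s) \<in> l"
    and B': "oriented_flow_box M p S L dir B'" "(t', s') \<in> open_rect B'" "s' \<in> leafset B'" "chart B' (t', s') \<in> l"
  shows "emeasure (\<nu> B) {s} = emeasure (\<nu> B') {s'}"
proof -
  define Q where "Q u m \<longleftrightarrow> (\<exists>B t s. oriented_flow_box M p S L dir B \<and> (t, s) \<in> open_rect B \<and> s \<in> leafset B \<and>
     chart B (t, s) = dir l u \<and> m = emeasure (\<nu> B) {s})" for u m
  have lS: "dir l u \<in> S" for u using oriented_lamination_leaves(4,6)[OF O] l by blast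
  have Qex: "\<exists>m. Q u m" for u using box_at_leaf_point[OF O lS[of u]] unfolding Q_def by metis
  have Quniq: "m = m'" if "Q u m" "Q u m'" for u m m'
    using that mass_same_point[OF \<nu>] oriented_flow_boxD unfolding Q_def by metis
  define f where "f u = (THE m. Q u m)" for u
  have f: "f u = m" if "Q u m" for u m unfolding f_def using Quniq that by blast
  have const: "f u = f u'" for u u'
  proof (rule connected_local_const[where A = UNIV and f = f])
    show "\<forall>a\<in>UNIV. \<forall>\<^sub>F b in at a within UNIV. f a = f b"
    proof
      fix u
      obtain B t s where B: "oriented_flow_box M p S L dir B" "(t, s) \<in> open_rect B" "s \<in> leafset B" "chart B (t, s) = dir l u"
        using box_at_leaf_point[OF O lS[of u]] by blast
      obtain \<epsilon> where \<epsilon>: "\<epsilon> > 0" "\<And>u'. \<bar>u' - u\<bar> < \<epsilon> \<Longrightarrow> \<exists>t\<in>{tmin B<..<tmax B}. dir l u' = chart B (t, s)"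
        using plaque_covers_leaf[OF O B(1) l _ B(3,4)] B(2) by (auto simp: open_rect_def)
      have "f u = f u'" if u': "\<bar>u' - u\<bar> < \<epsilon>" for u'
      proof -
        obtain t' where "t' \<in> {tmin B<..<tmax B}" "dir l u' = chart B (t', s)" using \<epsilon>(2)[OF u'] by blast
        then have "Q u' (emeasure (\<nu> B) {s})" unfolding Q_def using B by (auto simp: open_rect_def intro!: exI[of _ B])
        moreover have "Q u (emeasure (\<nu> B) {s})" unfolding Q_def using B by blast
        ultimately show ?thesis using f by metis
      qed
      then show "\<forall>\<^sub>F b in at u within UNIV. f u = f b"
        unfolding eventually_at using \<epsilon>(1) by (intro exI[of _ \<epsilon>]) (auto simp: dist_real_def)
    qed
  qed auto
  obtain u u' where "chart B (t, s) = dir l u" "chart B' (t', s') = dir l u'"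
    using B(4) B'(4) oriented_lamination_leaves(4)[OF O l] by (metis imageE)
  then have "Q u (emeasure (\<nu> B) {s})" "Q u' (emeasure (\<nu> B') {s'})" unfolding Q_def using B B' by blast+
  then show ?thesis using f const by metis
qed

text \<open>
  A leaf that is not periodic is injectively parametrized.  The points \<open>dir l k\<close> with
  \<open>k\<close> a natural number accumulate at a point of the lamination.  In a flow box there, each plaque
  meets the leaf in a bounded set of parameters, so infinitely many plaques are needed, and all have
  the same mass, against finiteness of the measure.
\<close>
lemma atom_imp_periodic:
  assumes M: "closed_hyperbolic_surface M p" and O: "oriented_lamination M p S L dir"
    and \<nu>: "transverse_measure M p S \<nu>" and l: "l \<in> L"
    and B: "oriented_flow_box M p S L dir B" "(t, s) \<in> open_rect B" "s \<in> leafset B" "chart B (t, s) \<in> l"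
    and pos: "emeasure (\<nu> B) {s} \<noteq> 0"
  shows "\<exists>T>0. \<forall>u. dir l (u + T) = dir l u"
proof (rule ccontr)
  assume np: "\<not> ?thesis"
  have inj: "u = u'" if "dir l u = dir l u'" for u u'
    using simple_geodesic_periodic[OF oriented_lamination_leaves(3)[OF O l] that] np by blast
  have lS: "dir l u \<in> S" for u using oriented_lamination_leaves(4,6)[OF O] l by blast
  obtain x r where x: "x \<in> S" "strict_mono r" "((\<lambda>k. dir l (real k)) \<circ> r) \<longlonglongrightarrow> x"
    by (rule seq_compactE[OF lamination_compact[OF M O, unfolded compact_eq_seq_compact_metric], of "\<lambda>k. dir l (real k)"])
      (use lS in auto)
  obtain A ta sa where A: "oriented_flow_box M p S L dir A" "(ta, sa) \<in> open_rect A" "sa \<in> leafset A" "chart A (ta, sa) = x"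
    using box_at_leaf_point[OF O x(1)] by blast
  have FA: "flow_box M p S A" by (rule oriented_flow_boxD[OF A(1)])
  obtain U where U: "open U" "chart A ` open_rect A = M \<inter> U"
    using chart_open_image[OF M FA open_open_rect open_rect_subset] by (auto simp: openin_open)
  have "\<forall>\<^sub>F k in sequentially. dir l (real (r k)) \<in> U"
    using topological_tendstoD[OF x(3) U(1)] A(2,4) U(2) by (auto simp: o_def)
  moreover have "dir l (real (r k)) \<in> M" for k using lS oriented_lamination_leaves(8)[OF O] by blast
  ultimately have "\<forall>\<^sub>F k in sequentially. dir l (real (r k)) \<in> chart A ` open_rect A"
    unfolding U(2) by (auto elim: eventually_mono)
  then obtain N where N: "\<forall>k\<ge>N. dir l (real (r k)) \<in> chart A ` open_rect A"
    unfolding eventually_sequentially by blast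
  have "\<exists>t s. (t, s) \<in> open_rect A \<and> chart A (t, s) = dir l (real (r k))" if "k \<ge> N" for k
  proof -
    have "dir l (real (r k)) \<in> chart A ` open_rect A" using N that by blast
    then show ?thesis by force
  qed
  then obtain tt ss where ts: "\<And>k. k \<ge> N \<Longrightarrow> (tt k, ss k) \<in> open_rect A \<and> chart A (tt k, ss k) = dir l (real (r k))"
    by metis
  have leaf: "ss k \<in> leafset A" if "k \<ge> N" for k
    using flow_box_leafset[OF FA, of "(tt k, ss k)"] ts[OF that] lS open_rect_subset[of A] by auto
  define m where "m = emeasure (\<nu> B) {s}"
  have inl: "dir l u \<in> l" for u using oriented_lamination_leaves(4)[OF O l] by blast
  have mass: "emeasure (\<nu> A) {ss k} = m" if "k \<ge> N" for k
    unfolding m_def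
    by (rule mass_constant_on_leaf[OF M O \<nu> l A(1) _ leaf[OF that] _ B]) (use ts[OF that] inl in auto)
  have sets: "sets (\<nu> A) = sets borel" and fin: "emeasure (\<nu> A) UNIV < \<infinity>"
    using \<nu> FA by (auto simp: transverse_measure_def)
  have sp: "space (\<nu> A) = UNIV" using sets_eq_imp_space_eq[OF sets] by simp
  interpret NA: finite_measure "\<nu> A" by (rule finite_measureI) (use fin sp in auto)
  have "finite (ss ` {N..})"
  proof (rule ccontr)
    assume inf: "infinite (ss ` {N..})"
    have m: "measure (\<nu> A) {y} = enn2real m" if "y \<in> ss ` {N..}" for y using that mass by (auto simp: measure_def)
    have m0: "enn2real m > 0"
    proof -
      have "m < \<infinity>" using mass[of N] NA.emeasure_finite[of "{ss N}"] by (simp add: less_top)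
      then show ?thesis using pos by (simp add: m_def enn2real_positive_iff zero_less_iff_neq_zero)
    qed
    obtain k :: nat where k: "real k * enn2real m > measure (\<nu> A) UNIV" using m0 reals_Archimedean3 by blast
    obtain Y where Y: "finite Y" "card Y = k" "Y \<subseteq> ss ` {N..}" using infinite_arbitrarily_large[OF inf] by blast
    have "measure (\<nu> A) Y = (\<Sum>y\<in>Y. measure (\<nu> A) {y})"
      by (rule NA.finite_measure_eq_sum_singleton[OF Y(1)]) (simp add: sets)
    also have "\<dots> = real k * enn2real m" using Y m by (simp add: subset_iff)
    finally have "measure (\<nu> A) Y = real k * enn2real m" .
    moreover have "measure (\<nu> A) Y \<le> measure (\<nu> A) UNIV" by (rule NA.finite_measure_mono) (auto simp: sets)
    ultimately show False using k by simp
  qed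
  then obtain s1 where s1: "s1 \<in> ss ` {N..}" "infinite {k \<in> {N..}. ss k = s1}"
    using pigeonhole_infinite[of "{N..}" ss] by (auto simp: infinite_Ici)
  have "s1 \<in> leafset A" using s1(1) leaf by auto
  then obtain l' \<theta> where \<theta>: "l' \<in> L" "continuous_on {tmin A..tmax A} \<theta>"
    "\<forall>t\<in>{tmin A..tmax A}. chart A (t, s1) = dir l' (\<theta> t)"
    using A(1) unfolding oriented_flow_box_def by blast
  have "bounded (\<theta> ` {tmin A..tmax A})" by (intro compact_imp_bounded compact_continuous_image \<theta>(2)) simp
  then obtain R where "\<forall>t\<in>{tmin A..tmax A}. \<bar>\<theta> t\<bar> \<le> R" unfolding bounded_iff by auto
  then have R: "\<And>t. t \<in> {tmin A..tmax A} \<Longrightarrow> \<bar>\<theta> t\<bar> \<le> R" by blast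
  obtain n where n: "real n > R" using reals_Archimedean2 by blast
  obtain k where k: "k \<ge> N" "ss k = s1" "k \<ge> n"
    using s1(2) unfolding infinite_nat_iff_unbounded_le by auto
  have tk: "tt k \<in> {tmin A..tmax A}" using ts[OF k(1)] by (auto simp: open_rect_def)
  have "dir l' (\<theta> (tt k)) = dir l (real (r k))" using \<theta>(3) tk ts[OF k(1)] k(2) by simp
  moreover have "dir l' (\<theta> (tt k)) \<in> l'" using oriented_lamination_leaves(4)[OF O \<theta>(1)] by blast
  ultimately have "l \<inter> l' \<noteq> {}" using inl[of "real (r k)"] by auto
  then have "l' = l" using oriented_lamination_leaves(5)[OF O] l \<theta>(1) by (auto dest: disjointD)
  then have "\<theta> (tt k) = real (r k)" using inj \<open>dir l' (\<theta> (tt k)) = dir l (real (r k))\<close> by blast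
  moreover have "real (r k) \<ge> real k" using seq_suble[OF x(2)] by simp
  ultimately show False using R[OF tk] n k(3) by linarith
qed

section \<open>Periodic leaves are isolated\<close>

lemma periodic_mod:
  fixes c :: "real \<Rightarrow> 'a"
  assumes T: "T > 0" and per: "\<And>u. c (u + T) = c u"
  shows "\<exists>w\<in>{0..T}. c w = c u"
proof -
  have nat: "c (u + real k * T) = c u" for k :: nat and u
  proof (induction k)
    case (Suc k)
    have "u + real (Suc k) * T = (u + real k * T) + T" by (simp add: algebra_simps)
    then show ?case using per[of "u + real k * T"] Suc by (simp only:)
  qed simp
  have int: "c (u + of_int k * T) = c u" for k :: int and u
  proof (cases "k \<ge> 0")
    case True
    then show ?thesis using nat[of u "nat k"] by simp
  next
    case False
    then show ?thesis using nat[of "u + of_int k * T" "nat (- k)"] by (simp add: algebra_simps)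
  qed
  define w where "w = u + of_int (- \<lfloor>u / T\<rfloor>) * T"
  have "of_int \<lfloor>u / T\<rfloor> * T \<le> u"
    using mult_right_mono[OF of_int_floor_le[of "u / T"], of T] T by simp
  moreover have "u \<le> (of_int \<lfloor>u / T\<rfloor> + 1) * T"
    using mult_right_mono[OF real_of_int_floor_add_one_ge[of "u / T"], of T] T by simp
  ultimately have "w \<in> {0..T}" by (auto simp: w_def algebra_simps)
  moreover have "c w = c u" unfolding w_def by (rule int)
  ultimately show ?thesis by blast
qed

lemma periodic_leaf_compact:
  assumes M: "closed_hyperbolic_surface M p" and O: "oriented_lamination M p S L dir" and l: "l \<in> L"
    and T: "T > 0" "\<And>u. dir l (u + T) = dir l u"
  shows "compact l" "dir l ` {0..T} = l"
proof -
  show im: "dir l ` {0..T} = l"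
  proof
    show "dir l ` {0..T} \<subseteq> l" using oriented_lamination_leaves(4)[OF O l] by blast
    show "l \<subseteq> dir l ` {0..T}"
    proof
      fix x assume "x \<in> l"
      then obtain u where "x = dir l u" using oriented_lamination_leaves(4)[OF O l] by blast
      moreover obtain w where "w \<in> {0..T}" "dir l w = dir l u" using periodic_mod[of T "dir l", OF T] by blast
      ultimately show "x \<in> dir l ` {0..T}" by (metis image_eqI)
    qed
  qed
  have "compact (dir l ` {0..T})"
    by (intro compact_continuous_image continuous_on_subset[OF dir_continuous[OF M oriented_lamination_leaves(2)[OF O l]]]) auto
  then show "compact l" by (simp add: im)
qed

lemma connected_in_one_closed:
  assumes "finite \<N>" "disjoint \<N>" "\<And>N. N \<in> \<N> \<Longrightarrow> closed N" "connected A" "A \<subseteq> \<Union>\<N>" "N \<in> \<N>" "A \<inter> N \<noteq> {}"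
  shows "A \<subseteq> N"
proof (rule ccontr)
  assume "\<not> A \<subseteq> N"
  let ?R = "\<Union>(\<N> - {N})"
  have "closed ?R" using assms by (intro closed_Union) auto
  moreover have "N \<inter> ?R = {}" using assms(2,6) by (auto dest: disjointD)
  moreover have "A \<subseteq> N \<union> ?R" using assms(5) by auto
  moreover have "A \<inter> ?R \<noteq> {}" using \<open>\<not> A \<subseteq> N\<close> \<open>A \<subseteq> N \<union> ?R\<close> by auto
  ultimately show False using assms(4,7) assms(3)[OF assms(6)] unfolding connected_closed by blast
qed

lemma minimal_closed: "minimal_lamination M p N \<Longrightarrow> closed N"
  by (auto simp: minimal_lamination_def geodesic_lamination_def lamination_leaves_def)

text \<open>
  The leaf is connected, so it lies in one component; being compact it is a lamination by itself,
  and minimality of the component gives equality.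
\<close>
lemma periodic_leaf_is_minimal:
  assumes M: "closed_hyperbolic_surface M p" and O: "oriented_lamination M p S L dir" and l: "l \<in> L"
    and T: "T > 0" "\<And>u. dir l (u + T) = dir l u"
    and \<N>: "finite \<N>" "disjoint \<N>" "\<And>N. N \<in> \<N> \<Longrightarrow> minimal_lamination M p N" "\<Union>\<N> = S"
    and N: "N \<in> \<N>" "l \<inter> N \<noteq> {}"
  shows "N = l"
proof -
  have "connected l"
    using connected_continuous_image[OF dir_continuous[OF M oriented_lamination_leaves(2)[OF O l]]]
      oriented_lamination_leaves(4)[OF O l] by auto
  moreover have "l \<subseteq> \<Union>\<N>" using oriented_lamination_leaves(6)[OF O] l \<N>(4) by auto
  ultimately have lN: "l \<subseteq> N" 
    by (intro connected_in_one_closed[OF \<N>(1,2) minimal_closed[OF \<N>(3)] _ _ N])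
  have "lamination_leaves M p l {l}"
    unfolding lamination_leaves_def
  proof (intro conjI ballI)
    show "l \<subseteq> M" using oriented_lamination_leaves(6,8)[OF O] l by blast
    show "closed l" by (rule compact_imp_closed[OF periodic_leaf_compact(1)[OF M O l T]])
    show "\<exists>c. complete_geodesic p c \<and> simple_geodesic c \<and> range c = k" if "k \<in> {l}" for k
      using oriented_lamination_leaves(2-4)[OF O l] that by blast
  qed (auto simp: disjoint_def)
  then have "geodesic_lamination M p l" by (auto simp: geodesic_lamination_def)
  then show ?thesis using \<N>(3)[OF N(1)] lN N(2) unfolding minimal_lamination_def by blast
qed

text \<open>
  Suppose plaques \<open>s \<noteq> s0\<close> of the lamination accumulate at \<open>s0\<close>.  The other
  components are closed, so these plaques belong to the leaf.  Their parameters in one period have a limit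
  point, at which the leaf passes through the plaque \<open>s0\<close> and stays in it for a while.
\<close>
lemma periodic_leaf_isolated_in_box:
  assumes M: "closed_hyperbolic_surface M p" and O: "oriented_lamination M p S L dir" and l: "l \<in> L"
    and T: "T > 0" "\<And>u. dir l (u + T) = dir l u"
    and \<N>: "finite \<N>" "disjoint \<N>" "\<And>N. N \<in> \<N> \<Longrightarrow> minimal_lamination M p N" "\<Union>\<N> = S"
    and B: "oriented_flow_box M p S L dir B" "(t0, s0) \<in> open_rect B" "s0 \<in> leafset B" "chart B (t0, s0) \<in> l"
  shows "\<exists>\<delta>>0. \<forall>s\<in>leafset B. \<bar>s - s0\<bar> < \<delta> \<longrightarrow> s = s0"
proof (rule ccontr)
  assume neg: "\<not> ?thesis"
  have F: "flow_box M p S B" by (rule oriented_flow_boxD[OF B(1)])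
  have "\<exists>s\<in>leafset B. \<bar>s - s0\<bar> < inverse (real (Suc k)) \<and> s \<noteq> s0" for k
    using neg by (meson inverse_positive_iff_positive of_nat_0_less_iff zero_less_Suc)
  then obtain ss where ss: "\<And>k. ss k \<in> leafset B \<and> \<bar>ss k - s0\<bar> < inverse (real (Suc k)) \<and> ss k \<noteq> s0" by metis
  have lim: "ss \<longlonglongrightarrow> s0"
  proof (rule LIM_zero_cancel, rule Lim_null_comparison)
    show "\<forall>\<^sub>F k in sequentially. norm (ss k - s0) \<le> inverse (real (Suc k))"
      using ss by (intro always_eventually allI) (simp add: less_imp_le)
  qed (rule LIMSEQ_inverse_real_of_nat)
  obtain N where N: "N \<in> \<N>" "chart B (t0, s0) \<in> N"
    using B(4) \<N>(4) oriented_lamination_leaves(6)[OF O] l by (metis Union_iff)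
  have Nl: "N = l" by (rule periodic_leaf_is_minimal[OF M O l T \<N> N(1)]) (use N B(4) in auto)
  have t0: "t0 \<in> {tmin B<..<tmax B}" using B(2) by (simp add: open_rect_def)
  have rk: "(t0, ss k) \<in> rect B" for k
  proof -
    have "leafset B \<subseteq> {smin B<..<smax B}" using F by (simp add: flow_box_def)
    then have "ss k \<in> {smin B<..<smax B}" using ss by blast
    then show ?thesis using t0 by (auto simp: rect_def)
  qed
  have r0: "(t0, s0) \<in> rect B" using B(2) open_rect_subset by blast
  have contc: "continuous_on (rect B) (chart B)" by (rule chart_continuous[OF M F])
  have "(\<lambda>k. (t0, ss k)) \<longlonglongrightarrow> (t0, s0)" by (intro tendsto_intros lim)
  then have limc: "(\<lambda>k. chart B (t0, ss k)) \<longlonglongrightarrow> chart B (t0, s0)"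
    by (rule continuous_on_tendsto_compose[OF contc _ r0]) (simp add: rk)
  let ?R = "\<Union>(\<N> - {N})"
  have "closed ?R" using \<N> minimal_closed by (intro closed_Union) auto
  moreover have "chart B (t0, s0) \<notin> ?R" using \<N>(2) N by (auto dest: disjointD)
  ultimately have "\<forall>\<^sub>F k in sequentially. chart B (t0, ss k) \<in> - ?R"
    using topological_tendstoD[OF limc, of "- ?R"] by auto
  then obtain k0 where k0: "\<And>k. k \<ge> k0 \<Longrightarrow> chart B (t0, ss k) \<in> - ?R" by (auto simp: eventually_sequentially)
  have inS: "chart B (t0, ss k) \<in> S" for k using flow_box_leafset[OF F rk] ss by simp
  have inl: "chart B (t0, ss k) \<in> l" if "k \<ge> k0" for k
    using inS[of k] k0[OF that] \<N>(4) Nl by blast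
  have "\<exists>u\<in>{0..T}. chart B (t0, ss k) = dir l u" if "k \<ge> k0" for k
    using inl[OF that] periodic_leaf_compact(2)[OF M O l T] by (metis imageE)
  then obtain uu where uu: "\<And>k. k \<ge> k0 \<Longrightarrow> uu k \<in> {0..T} \<and> chart B (t0, ss k) = dir l (uu k)" by metis
  have "\<forall>k. uu (k + k0) \<in> {0..T}" using uu by simp
  then obtain u r where u: "u \<in> {0..T}" "strict_mono r" "((\<lambda>k. uu (k + k0)) \<circ> r) \<longlonglongrightarrow> u"
    by (rule seq_compactE[OF compact_Icc[of 0 T, unfolded compact_eq_seq_compact_metric], of "\<lambda>k. uu (k + k0)"]) auto
  have dc: "continuous_on UNIV (dir l)" by (rule dir_continuous[OF M oriented_lamination_leaves(2)[OF O l]])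
  have "(\<lambda>k. dir l (uu (r k + k0))) \<longlonglongrightarrow> dir l u"
    using continuous_on_tendsto_compose[OF dc u(3)] by (simp add: o_def)
  moreover have "(\<lambda>k. dir l (uu (r k + k0))) \<longlonglongrightarrow> chart B (t0, s0)"
  proof -
    have "(\<lambda>k. chart B (t0, ss (r k + k0))) \<longlonglongrightarrow> chart B (t0, s0)"
      using LIMSEQ_subseq_LIMSEQ[OF LIMSEQ_ignore_initial_segment[OF limc, of k0] u(2)] by (simp add: o_def)
    then show ?thesis using uu by simp
  qed
  ultimately have eq: "chart B (t0, s0) = dir l u" using LIMSEQ_unique by blast
  obtain \<epsilon> where \<epsilon>: "\<epsilon> > 0" "\<And>u'. \<bar>u' - u\<bar> < \<epsilon> \<Longrightarrow> \<exists>t\<in>{tmin B<..<tmax B}. dir l u' = chart B (t, s0)"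
    using plaque_covers_leaf[OF O B(1) l t0 B(3) eq] by blast
  have "\<forall>\<^sub>F k in sequentially. dist (uu (r k + k0)) u < \<epsilon>" using tendstoD[OF u(3) \<epsilon>(1)] by (simp add: o_def)
  then obtain k where "dist (uu (r k + k0)) u < \<epsilon>" by (auto simp: eventually_sequentially)
  then have "\<exists>t\<in>{tmin B<..<tmax B}. dir l (uu (r k + k0)) = chart B (t, s0)"
    by (intro \<epsilon>(2)) (simp add: dist_real_def)
  then obtain t where t: "t \<in> {tmin B<..<tmax B}" "dir l (uu (r k + k0)) = chart B (t, s0)"
    by blast
  then have "chart B (t0, ss (r k + k0)) = chart B (t, s0)" using uu[of "r k + k0"] by simp
  moreover have "(t, s0) \<in> rect B" using t(1) r0 by (auto simp: rect_def)
  ultimately have "(t0, ss (r k + k0)) = (t, s0)" using inj_onD[OF flow_box_inj[OF F]] rk by blast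
  then show False using ss by simp
qed

text \<open>
  In normalized coordinates the map is \<open>(x, y) \<mapsto> (x sqrt (1 - y\<^sup>2), y)\<close>.
\<close>
lemma square_disc_homeomorphism:
  fixes t0 s0 \<epsilon> :: real
  assumes "\<epsilon> > 0"
  defines "Q \<equiv> {t0 - \<epsilon><..<t0 + \<epsilon>} \<times> {s0 - \<epsilon><..<s0 + \<epsilon>}"
  shows "\<exists>h k. homeomorphism Q (ball (0::complex) 1) h k \<and> h ` (Q \<inter> UNIV \<times> {s0}) = {z \<in> ball 0 1. Im z = 0}"
proof -
  define h where "h = (\<lambda>x. Complex (((fst x - t0) / \<epsilon>) * sqrt (1 - ((snd x - s0) / \<epsilon>)\<^sup>2)) ((snd x - s0) / \<epsilon>))"
  define k where "k = (\<lambda>z. (t0 + \<epsilon> * (Re z / sqrt (1 - (Im z)\<^sup>2)), s0 + \<epsilon> * Im z))"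
  have inQ: "x \<in> Q \<longleftrightarrow> \<bar>(fst x - t0) / \<epsilon>\<bar> < 1 \<and> \<bar>(snd x - s0) / \<epsilon>\<bar> < 1" for x
    using assms(1) by (cases x) (auto simp: Q_def abs_less_iff field_simps)
  have sq: "1 - y\<^sup>2 > 0" if "\<bar>y\<bar> < 1" for y :: real using that by (simp add: abs_square_less_1)
  have hb: "h x \<in> ball 0 1" if x: "x \<in> Q" for x
  proof -
    let ?a = "(fst x - t0) / \<epsilon>" and ?b = "(snd x - s0) / \<epsilon>"
    have ab: "\<bar>?a\<bar> < 1" "\<bar>?b\<bar> < 1" using x inQ by auto
    have "(cmod (h x))\<^sup>2 = ?a\<^sup>2 * (1 - ?b\<^sup>2) + ?b\<^sup>2"
      unfolding h_def cmod_power2 complex.sel power_mult_distrib using sq[OF ab(2)] by simp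
    also have "\<dots> < 1 * (1 - ?b\<^sup>2) + ?b\<^sup>2"
      using sq[OF ab(2)] sq[OF ab(1)] by (intro add_strict_right_mono mult_strict_right_mono) auto
    finally have "(cmod (h x))\<^sup>2 < 1\<^sup>2" by simp
    then have "cmod (h x) < 1" by (rule power2_less_imp_less) simp
    then show ?thesis by simp
  qed
  have ball: "\<bar>Im z\<bar> < 1 \<and> (Re z)\<^sup>2 < 1 - (Im z)\<^sup>2" if "z \<in> ball 0 1" for z
  proof -
    have "(cmod z)\<^sup>2 < 1" using that by (simp add: power_less_one_iff abs_square_less_1)
    then have *: "(Re z)\<^sup>2 + (Im z)\<^sup>2 < 1" by (simp add: cmod_power2)
    then have "(Im z)\<^sup>2 < 1" using zero_le_power2[of "Re z"] by linarith
    then show ?thesis using * by (simp add: abs_square_less_1)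
  qed
  have kQ: "k z \<in> Q" if z: "z \<in> ball 0 1" for z
  proof -
    have "\<bar>Re z / sqrt (1 - (Im z)\<^sup>2)\<bar> < 1"
    proof -
      have "\<bar>Re z\<bar> < sqrt (1 - (Im z)\<^sup>2)" using ball[OF z] by (intro real_less_rsqrt) simp
      moreover have "sqrt (1 - (Im z)\<^sup>2) > 0" using ball[OF z] sq by simp
      ultimately show ?thesis by (simp only: abs_divide) (simp add: divide_less_eq)
    qed
    then show ?thesis using ball[OF z] assms(1) by (simp add: inQ k_def)
  qed
  have kh: "k (h x) = x" if x: "x \<in> Q" for x
  proof -
    have "\<bar>(snd x - s0) / \<epsilon>\<bar> < 1" using x inQ by auto
    then have "sqrt (1 - ((snd x - s0) / \<epsilon>)\<^sup>2) > 0" using sq by simp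
    then show ?thesis using assms(1) by (cases x) (simp add: h_def k_def)
  qed
  have hk: "h (k z) = z" if z: "z \<in> ball 0 1" for z
  proof -
    have "sqrt (1 - (Im z)\<^sup>2) > 0" using ball[OF z] sq by simp
    then show ?thesis using assms(1) by (simp add: h_def k_def complex_eq_iff)
  qed
  have hom: "homeomorphism Q (ball 0 1) h k"
    unfolding homeomorphism_def
  proof (intro conjI ballI)
    show "continuous_on Q h" unfolding h_def by (intro continuous_intros) (use assms(1) in auto)
    show "continuous_on (ball 0 1) k"
      unfolding k_def by (intro continuous_intros ballI) (use ball sq in force)
    show "h ` Q = ball 0 1" using hb hk kQ by (metis (no_types, lifting) image_eqI image_subsetI subsetI subset_antisym)
    show "k ` ball 0 1 = Q" using kh hb kQ by (metis (no_types, lifting) image_eqI image_subsetI subsetI subset_antisym)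
  qed (use kh hk in auto)
  have "h ` (Q \<inter> UNIV \<times> {s0}) = {z \<in> ball 0 1. Im z = 0}"
  proof
    show "h ` (Q \<inter> UNIV \<times> {s0}) \<subseteq> {z \<in> ball 0 1. Im z = 0}" using hb by (auto simp: h_def)
    show "{z \<in> ball 0 1. Im z = 0} \<subseteq> h ` (Q \<inter> UNIV \<times> {s0})"
    proof
      fix z :: complex assume "z \<in> {z \<in> ball 0 1. Im z = 0}"
      then have z: "z \<in> ball 0 1" "Im z = 0" by auto
      then have "k z \<in> Q \<inter> UNIV \<times> {s0}" using kQ[OF z(1)] by (simp add: k_def)
      then show "z \<in> h ` (Q \<inter> UNIV \<times> {s0})" using hk[OF z(1)] by (metis image_eqI)
    qed
  qed
  then show ?thesis using hom by blast
qed

text \<open>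
  A square around the point in flow box coordinates, so small that its only plaque is the middle one.
\<close>
lemma periodic_leaf_isolated:
  assumes M: "closed_hyperbolic_surface M p" and O: "oriented_lamination M p S L dir" and l: "l \<in> L"
    and T: "T > 0" "\<And>u. dir l (u + T) = dir l u"
    and \<N>: "finite \<N>" "disjoint \<N>" "\<And>N. N \<in> \<N> \<Longrightarrow> minimal_lamination M p N" "\<Union>\<N> = S"
  shows "l \<in> closed_isolated_leaves M p S L"
proof -
  have "isolated_leaf M S l"
    unfolding isolated_leaf_def
  proof
    fix x assume x: "x \<in> l"
    then have xS: "x \<in> S" using oriented_lamination_leaves(6)[OF O] l by blast
    obtain B t0 s0 where B: "oriented_flow_box M p S L dir B" "(t0, s0) \<in> open_rect B" "s0 \<in> leafset B" "chart B (t0, s0) = x"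
      using box_at_leaf_point[OF O xS] by blast
    have F: "flow_box M p S B" by (rule oriented_flow_boxD[OF B(1)])
    obtain \<delta> where \<delta>: "\<delta> > 0" "\<And>s. s \<in> leafset B \<Longrightarrow> \<bar>s - s0\<bar> < \<delta> \<Longrightarrow> s = s0"
      using periodic_leaf_isolated_in_box[OF M O l T \<N> B(1-3)] x B(4) by blast
    define \<epsilon> where "\<epsilon> = Min {\<delta>, t0 - tmin B, tmax B - t0, s0 - smin B, smax B - s0}"
    have \<epsilon>: "\<epsilon> > 0" "\<epsilon> \<le> \<delta>" "\<epsilon> \<le> t0 - tmin B" "\<epsilon> \<le> tmax B - t0" "\<epsilon> \<le> s0 - smin B" "\<epsilon> \<le> smax B - s0"
      using \<delta>(1) B(2) by (auto simp: \<epsilon>_def open_rect_def)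
    define Q where "Q = {t0 - \<epsilon><..<t0 + \<epsilon>} \<times> {s0 - \<epsilon><..<s0 + \<epsilon>}"
    have Qr: "Q \<subseteq> rect B" using \<epsilon> by (auto simp: Q_def rect_def)
    have Qo: "open Q" by (simp add: Q_def open_Times)
    obtain h k where hk: "homeomorphism Q (ball (0::complex) 1) h k" "h ` (Q \<inter> UNIV \<times> {s0}) = {z \<in> ball 0 1. Im z = 0}"
      using square_disc_homeomorphism[OF \<epsilon>(1), of t0 s0] unfolding Q_def by blast
    have contc: "continuous_on (rect B) (chart B)" by (rule chart_continuous[OF M F])
    obtain g where g: "homeomorphism (rect B) (chart B ` rect B) (chart B) g"
      using homeomorphism_compact[OF rect_compact contc refl flow_box_inj[OF F]] by blast
    have gQ: "homeomorphism Q (chart B ` Q) (chart B) g"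
      by (rule homeomorphism_of_subsets[OF g Qr]) (use Qr in auto)
    have hom: "homeomorphism (chart B ` Q) (ball 0 1) (h \<circ> g) (chart B \<circ> k)"
      by (rule homeomorphism_compose[OF homeomorphism_symD[OF gQ] hk(1)])
    have US: "chart B ` Q \<inter> S = chart B ` (Q \<inter> UNIV \<times> {s0})"
    proof -
      have "chart B y \<in> S \<longleftrightarrow> snd y = s0" if y: "y \<in> Q" for y
      proof -
        have "\<bar>snd y - s0\<bar> < \<delta>" using y \<epsilon>(2) by (auto simp: Q_def abs_less_iff)
        then show ?thesis using flow_box_leafset[OF F] Qr y \<delta>(2) B(3) by blast
      qed
      then show ?thesis by auto
    qed
    have "(h \<circ> g) ` (chart B ` Q \<inter> S) = {z \<in> ball 0 1. Im z = 0}"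
    proof -
      have "(h \<circ> g) ` (chart B ` (Q \<inter> UNIV \<times> {s0})) = h ` (Q \<inter> UNIV \<times> {s0})"
        using homeomorphism_apply1[OF gQ] by (force simp: image_iff)
      then show ?thesis unfolding US hk(2) .
    qed
    moreover have "openin (top_of_set M) (chart B ` Q)" by (rule chart_open_image[OF M F Qo Qr])
    moreover have "x \<in> chart B ` Q" using B(4) \<epsilon>(1) by (auto simp: Q_def intro!: image_eqI[of _ _ "(t0, s0)"])
    ultimately show "\<exists>U. openin (top_of_set M) U \<and> x \<in> U \<and>
        (\<exists>h k. homeomorphism U (ball (0::complex) 1) h k \<and> h ` (U \<inter> S) = {z \<in> ball 0 1. Im z = 0})"
      using hom by blast
  qed
  moreover have "closed_leaf p l"
    unfolding closed_leaf_def using oriented_lamination_leaves(2,4)[OF O l] T by blast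
  ultimately show ?thesis using l by (simp add: closed_isolated_leaves_def)
qed

section \<open>One-sided approximate limits along a curve with a tangent\<close>

definition sector :: "complex \<Rightarrow> complex \<Rightarrow> real \<Rightarrow> real \<Rightarrow> complex set" where
  "sector z m \<epsilon> r = {w \<in> ball z r. \<epsilon> * cmod (w - z) < (w - z) \<bullet> m}"

lemma open_sector: "open (sector z m \<epsilon> r)"
proof -
  have "sector z m \<epsilon> r = ball z r \<inter> {w. \<epsilon> * cmod (w - z) < (w - z) \<bullet> m}" by (auto simp: sector_def)
  moreover have "open {w. \<epsilon> * cmod (w - z) < (w - z) \<bullet> m}" by (intro open_Collect_less continuous_intros)
  ultimately show ?thesis by (metis open_Int open_ball)
qed

lemma convex_sector:
  assumes "\<epsilon> \<ge> 0" shows "convex (sector z m \<epsilon> r)"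
proof -
  have "convex {w. \<epsilon> * cmod (w - z) < (w - z) \<bullet> m}"
  proof (rule convexI)
    fix x y u v assume xy: "x \<in> {w. \<epsilon> * cmod (w - z) < (w - z) \<bullet> m}" "y \<in> {w. \<epsilon> * cmod (w - z) < (w - z) \<bullet> m}"
      and uv: "0 \<le> u" "0 \<le> v" "u + v = (1::real)"
    have eq: "u *\<^sub>R x + v *\<^sub>R y - z = u *\<^sub>R (x - z) + v *\<^sub>R (y - z)"
    proof -
      have "z = (u + v) *\<^sub>R z" using uv by simp
      then show ?thesis by (simp add: algebra_simps)
    qed
    have "\<epsilon> * cmod (u *\<^sub>R (x - z) + v *\<^sub>R (y - z)) \<le> \<epsilon> * (u * cmod (x - z) + v * cmod (y - z))"
      using assms uv norm_triangle_ineq[of "u *\<^sub>R (x - z)" "v *\<^sub>R (y - z)"] by (intro mult_left_mono) auto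
    also have "\<dots> = u * (\<epsilon> * cmod (x - z)) + v * (\<epsilon> * cmod (y - z))" by (simp add: algebra_simps)
    also have "\<dots> < u * ((x - z) \<bullet> m) + v * ((y - z) \<bullet> m)"
    proof (cases "u = 0")
      case True then show ?thesis using xy uv by simp
    next
      case False
      then have "u * (\<epsilon> * cmod (x - z)) < u * ((x - z) \<bullet> m)" using xy uv by simp
      moreover have "v * (\<epsilon> * cmod (y - z)) \<le> v * ((y - z) \<bullet> m)" using xy uv by (intro mult_left_mono) auto
      ultimately show ?thesis by linarith
    qed
    also have "\<dots> = (u *\<^sub>R (x - z) + v *\<^sub>R (y - z)) \<bullet> m" by (simp add: inner_add_left)
    finally show "u *\<^sub>R x + v *\<^sub>R y \<in> {w. \<epsilon> * cmod (w - z) < (w - z) \<bullet> m}" by (simp only: eq mem_Collect_eq)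
  qed
  moreover have "sector z m \<epsilon> r = ball z r \<inter> {w. \<epsilon> * cmod (w - z) < (w - z) \<bullet> m}" by (auto simp: sector_def)
  ultimately show ?thesis by (metis convex_Int convex_ball)
qed

lemma axis_in_sector:
  assumes "cmod m = 1" "\<epsilon> < 1" "0 < t" "t < r"
  shows "z + t *\<^sub>R m \<in> sector z m \<epsilon> r"
  using assms by (simp add: sector_def dist_norm dot_square_norm)

text \<open>
The part of the half-disc close to its diameter.
\<close>
definition thin_cone :: "complex \<Rightarrow> complex \<Rightarrow> real \<Rightarrow> real \<Rightarrow> complex set" where
  "thin_cone z m \<epsilon> r = half_ball z r m - sector z m \<epsilon> r"

lemma borel_thin_cone: "thin_cone z m \<epsilon> r \<in> sets borel"
  by (simp add: thin_cone_def open_half_ball open_sector)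

lemma thin_cone_iff: "w \<in> thin_cone z m \<epsilon> r \<longleftrightarrow> dist z w < r \<and> 0 < (w - z) \<bullet> m \<and> (w - z) \<bullet> m \<le> \<epsilon> * cmod (w - z)"
  by (auto simp: thin_cone_def half_ball_def sector_def)

lemma measure_thin_cone_scale:
  assumes "r > 0"
  shows "measure lebesgue (thin_cone z m \<epsilon> (2 * r)) = r\<^sup>2 * measure lebesgue (thin_cone 0 m \<epsilon> 2)"
proof -
  have [measurable]: "thin_cone z m \<epsilon> r \<in> sets borel" for z r by (rule borel_thin_cone)
  have i: "indicator (thin_cone z m \<epsilon> (2 * r)) (z + r *\<^sub>R x) = (indicator (thin_cone 0 m \<epsilon> 2) x :: real)" for x
    using assms by (auto simp: thin_cone_iff dist_norm zero_less_mult_iff mult.left_commute[of _ r] split: split_indicator)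
  have "measure lebesgue (thin_cone z m \<epsilon> (2 * r)) = (\<integral>x. indicator (thin_cone z m \<epsilon> (2 * r)) x \<partial>lborel)"
    by (simp add: measure_completion)
  also have "\<dots> = r\<^sup>2 * (\<integral>x. indicator (thin_cone z m \<epsilon> (2 * r)) (z + r *\<^sub>R x) \<partial>lborel)"
    by (rule lborel_integral_affine) (use assms in auto)
  also have "\<dots> = r\<^sup>2 * measure lebesgue (thin_cone 0 m \<epsilon> 2)"
    by (simp add: i measure_completion)
  finally show ?thesis .
qed

text \<open>
The cones decrease to the empty set.
\<close>
lemma thin_cone_tendsto: "(\<lambda>k. measure lebesgue (thin_cone 0 m (1 / (real k + 2)) 2)) \<longlonglongrightarrow> 0"
proof -
  have bounded: "emeasure lborel (thin_cone 0 m \<epsilon> 2) \<noteq> \<infinity>" for \<epsilon>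
    using emeasure_bounded_finite[of "thin_cone 0 m \<epsilon> 2"] bounded_subset[of "ball 0 2" "thin_cone 0 m \<epsilon> 2"]
    by (force simp: thin_cone_iff)
  have dec: "decseq (\<lambda>k. thin_cone 0 m (1 / (real k + 2)) 2)"
  proof (rule decseq_SucI, rule subsetI)
    fix k w assume w: "w \<in> thin_cone 0 m (1 / (real (Suc k) + 2)) 2"
    have "1 / (real (Suc k) + 2) * cmod w \<le> 1 / (real k + 2) * cmod w"
      by (intro mult_right_mono divide_left_mono) auto
    then show "w \<in> thin_cone 0 m (1 / (real k + 2)) 2" using w by (auto simp: thin_cone_iff)
  qed
  have "(\<Inter>k. thin_cone 0 m (1 / (real k + 2)) 2) = {}"
  proof (rule ccontr)
    assume "\<not> ?thesis"
    then obtain w where w: "\<And>k. w \<in> thin_cone 0 m (1 / (real k + 2)) 2" by blast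
    then have p: "0 < w \<bullet> m" by (auto simp: thin_cone_iff)
    have "w \<bullet> m \<le> 1 / (real k + 2) * cmod w" for k using w[of k] by (simp add: thin_cone_iff)
    moreover have "(\<lambda>k. 1 / (real k + 2) * cmod w) \<longlonglongrightarrow> 0" by real_asymp
    ultimately have "w \<bullet> m \<le> 0" by (intro LIMSEQ_le_const) auto
    then show False using p by simp
  qed
  moreover have "(\<lambda>k. measure lborel (thin_cone 0 m (1 / (real k + 2)) 2)) \<longlonglongrightarrow>
    measure lborel (\<Inter>k. thin_cone 0 m (1 / (real k + 2)) 2)"
    by (rule Lim_measure_decseq) (use dec bounded borel_thin_cone in auto)
  ultimately show ?thesis using borel_thin_cone by (simp add: measure_completion)
qed

text \<open>
  A curve with tangent orthogonal to \<open>m\<close> misses every sector around \<open>m\<close> close to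
  \<open>z\<close>.  Sectors are convex, so each lies on one side of the curve, and the function is constant on
  it, with a constant that does not depend on the opening.  The rest of the half-disc is a
  thin cone on which the function is bounded.
\<close>
lemma approx_limit_two_sides:
  assumes W: "open W" "z \<in> W" and U: "open U1" "open U2" "U1 \<inter> U2 = {}" and cov: "W \<subseteq> U1 \<union> U2 \<union> \<Gamma>"
    and c: "AE w in lebesgue. w \<in> U1 \<longrightarrow> v w = c1" "AE w in lebesgue. w \<in> U2 \<longrightarrow> v w = c2"
    and \<Gamma>: "AE w in lebesgue. w \<notin> \<Gamma>"
    and m: "cmod m = 1"
    and tangent: "\<And>\<epsilon>. \<epsilon> > 0 \<Longrightarrow> \<exists>r>0. \<forall>w\<in>\<Gamma> \<inter> ball z r. \<bar>(w - z) \<bullet> m\<bar> \<le> \<epsilon> * cmod (w - z)"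
  shows "\<exists>a. approx_limit_along v z m a"
proof -
  obtain rW where rW: "rW > 0" "ball z rW \<subseteq> W" using W open_contains_ball by blast
  have "\<exists>r c. r > 0 \<and> r \<le> rW \<and> (AE w in lebesgue. w \<in> sector z m \<epsilon> r \<longrightarrow> v w = c)" if "\<epsilon> > 0" for \<epsilon>
  proof -
    obtain r1 where r1: "r1 > 0" "\<And>w. w \<in> \<Gamma> \<Longrightarrow> w \<in> ball z r1 \<Longrightarrow> \<bar>(w - z) \<bullet> m\<bar> \<le> \<epsilon> * cmod (w - z)"
      using tangent[OF \<open>\<epsilon> > 0\<close>] by blast
    define r where "r = min r1 rW"
    have r: "r > 0" "r \<le> rW" "r \<le> r1" using r1 rW by (auto simp: r_def)
    have "sector z m \<epsilon> r \<subseteq> U1 \<union> U2"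
    proof
      fix w assume w: "w \<in> sector z m \<epsilon> r"
      then have "w \<in> W" using r(2) rW(2) by (auto simp: sector_def)
      moreover have "w \<notin> \<Gamma>"
      proof
        assume "w \<in> \<Gamma>"
        then have "\<bar>(w - z) \<bullet> m\<bar> \<le> \<epsilon> * cmod (w - z)" by (rule r1(2)) (use w r(3) in \<open>auto simp: sector_def\<close>)
        then show False using w by (auto simp: sector_def)
      qed
      ultimately show "w \<in> U1 \<union> U2" using cov by blast
    qed
    moreover have "connected (sector z m \<epsilon> r)" using \<open>\<epsilon> > 0\<close> by (intro convex_connected convex_sector) auto
    ultimately have "U1 \<inter> sector z m \<epsilon> r = {} \<or> U2 \<inter> sector z m \<epsilon> r = {}"
      using connectedD[of "sector z m \<epsilon> r" U1 U2] U by blast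
    then have "sector z m \<epsilon> r \<subseteq> U2 \<or> sector z m \<epsilon> r \<subseteq> U1" using \<open>sector z m \<epsilon> r \<subseteq> U1 \<union> U2\<close> by blast
    then have "\<exists>c. AE w in lebesgue. w \<in> sector z m \<epsilon> r \<longrightarrow> v w = c"
    proof
      assume "sector z m \<epsilon> r \<subseteq> U2"
      then show ?thesis by (intro exI[of _ c2] eventually_mono[OF c(2)]) blast
    next
      assume "sector z m \<epsilon> r \<subseteq> U1"
      then show ?thesis by (intro exI[of _ c1] eventually_mono[OF c(1)]) blast
    qed
    then show ?thesis using r by blast
  qed
  then obtain R cc where R: "\<And>\<epsilon>. \<epsilon> > 0 \<Longrightarrow> R \<epsilon> > 0 \<and> R \<epsilon> \<le> rW \<and> (AE w in lebesgue. w \<in> sector z m \<epsilon> (R \<epsilon>) \<longrightarrow> v w = cc \<epsilon>)"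
    by metis
  define a where "a = cc (1/2)"
  \<comment> \<open>Sectors of different openings share their axis near \<open>z\<close>.\<close>
  have cca: "cc \<epsilon> = a" if e: "0 < \<epsilon>" "\<epsilon> < 1" for \<epsilon>
    unfolding a_def
  proof (rule AE_constant_unique[OF _ _ open_sector open_sector])
    show "AE w in lebesgue. w \<in> sector z m \<epsilon> (R \<epsilon>) \<longrightarrow> v w = cc \<epsilon>" using R e by blast
    show "AE w in lebesgue. w \<in> sector z m (1/2) (R (1/2)) \<longrightarrow> v w = cc (1/2)" using R by simp
    define t where "t = min (R \<epsilon>) (R (1/2)) / 2"
    have "0 < t" "t < R \<epsilon>" "t < R (1/2)" using R[OF e(1)] R[of "1/2"] by (auto simp: t_def)
    then have "z + t *\<^sub>R m \<in> sector z m \<epsilon> (R \<epsilon>) \<inter> sector z m (1/2) (R (1/2))"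
      using axis_in_sector[OF m] e by auto
    then show "sector z m \<epsilon> (R \<epsilon>) \<inter> sector z m (1/2) (R (1/2)) \<noteq> {}" by blast
  qed
  define M0 where "M0 = \<bar>c1\<bar> + \<bar>c2\<bar> + \<bar>a\<bar>"
  have M0: "M0 \<ge> 0" by (simp add: M0_def)
  define \<mu>0 where "\<mu>0 = measure lebesgue (half_ball 0 2 m)"
  have \<mu>0: "\<mu>0 > 0" unfolding \<mu>0_def by (rule measure_half_ball_pos[OF m])
  have est: "(LINT w:half_ball z (2 * r) m|lebesgue. \<bar>v w - a\<bar>) / measure lebesgue (half_ball z (2 * r) m)
      \<le> M0 * measure lebesgue (thin_cone 0 m \<epsilon> 2) / \<mu>0"
    if e: "0 < \<epsilon>" "\<epsilon> < 1" and r: "0 < r" "2 * r \<le> R \<epsilon>" for \<epsilon> r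
  proof -
    have sub: "half_ball z (2 * r) m \<subseteq> W" using r(2) R[OF e(1)] rW(2) by (auto simp: half_ball_def)
    have fin: "emeasure lebesgue (thin_cone z m \<epsilon> (2 * r)) < \<infinity>"
      using emeasure_bounded_finite[of "thin_cone z m \<epsilon> (2 * r)"] bounded_subset[of "ball z (2 * r)" "thin_cone z m \<epsilon> (2 * r)"]
        borel_thin_cone by (force simp: thin_cone_iff)
    have "(LINT w:half_ball z (2 * r) m|lebesgue. \<bar>v w - a\<bar>) \<le> (\<integral>w. M0 * indicator (thin_cone z m \<epsilon> (2 * r)) w \<partial>lebesgue)"
      unfolding set_lebesgue_integral_def
    proof (rule integral_mono_AE')
      show "integrable lebesgue (\<lambda>w. M0 * indicator (thin_cone z m \<epsilon> (2 * r)) w)"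
        using fin borel_thin_cone by (intro integrable_mult_right integrable_real_indicator) auto
      have "AE w in lebesgue. w \<in> sector z m \<epsilon> (R \<epsilon>) \<longrightarrow> v w = a" using R[OF e(1)] cca[OF e] by simp
      then show "AE w in lebesgue. indicator (half_ball z (2 * r) m) w *\<^sub>R \<bar>v w - a\<bar> \<le> M0 * indicator (thin_cone z m \<epsilon> (2 * r)) w"
        using c \<Gamma>
      proof eventually_elim
        case (elim w)
        show ?case
        proof (cases "w \<in> half_ball z (2 * r) m")
          case True
          show ?thesis
          proof (cases "w \<in> sector z m \<epsilon> (2 * r)")
            case s: True
            then have "w \<in> sector z m \<epsilon> (R \<epsilon>)" using r(2) by (auto simp: sector_def)
            then show ?thesis using elim(1) M0 by (auto split: split_indicator)
          next
            case False
            then have "w \<in> thin_cone z m \<epsilon> (2 * r)" using True by (simp add: thin_cone_def)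
            moreover have "w \<in> U1 \<or> w \<in> U2" using True sub cov elim(4) by blast
            then have "\<bar>v w - a\<bar> \<le> M0" using elim(2,3) by (auto simp: M0_def)
            ultimately show ?thesis using True by simp
          qed
        qed (use M0 in \<open>auto split: split_indicator\<close>)
      qed
    qed (use M0 in auto)
    also have "\<dots> = M0 * (r\<^sup>2 * measure lebesgue (thin_cone 0 m \<epsilon> 2))"
      using measure_thin_cone_scale[OF r(1)] borel_thin_cone by simp
    finally have "(LINT w:half_ball z (2 * r) m|lebesgue. \<bar>v w - a\<bar>) / (r\<^sup>2 * \<mu>0)
      \<le> M0 * (r\<^sup>2 * measure lebesgue (thin_cone 0 m \<epsilon> 2)) / (r\<^sup>2 * \<mu>0)"
      using r(1) \<mu>0 by (intro divide_right_mono) auto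
    also have "\<dots> = M0 * measure lebesgue (thin_cone 0 m \<epsilon> 2) / \<mu>0" using r(1) by simp
    finally show ?thesis unfolding measure_half_ball_scale[OF r(1)] \<mu>0_def .
  qed
  have "approx_limit_along v z m a"
    unfolding approx_limit_along_def
  proof (rule tendstoI)
    fix e :: real assume e: "e > 0"
    have "(\<lambda>k. M0 * measure lebesgue (thin_cone 0 m (1 / (real k + 2)) 2) / \<mu>0) \<longlonglongrightarrow> M0 * 0 / \<mu>0"
      by (intro tendsto_intros thin_cone_tendsto) (use \<mu>0 in simp)
    then have "\<forall>\<^sub>F k in sequentially. M0 * measure lebesgue (thin_cone 0 m (1 / (real k + 2)) 2) / \<mu>0 < e"
      using e by (intro order_tendstoD(2)) simp_all
    then obtain k where k: "M0 * measure lebesgue (thin_cone 0 m (1 / (real k + 2)) 2) / \<mu>0 < e"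
      by (auto simp: eventually_sequentially)
    \<comment> \<open>The shift by 2 keeps the opening below 1, so that the sector contains its axis.\<close>
    let ?e = "1 / (real k + 2)"
    have ke: "0 < ?e" "?e < 1" by auto
    let ?q = "\<lambda>r. (LINT w:half_ball z r m|lebesgue. \<bar>v w - a\<bar>) / measure lebesgue (half_ball z r m)"
    have "dist (?q r) 0 < e" if r: "0 < r" "r < R ?e" for r
    proof -
      have "?q (2 * (r / 2)) \<le> M0 * measure lebesgue (thin_cone 0 m ?e 2) / \<mu>0"
        by (rule est[OF ke]) (use r in auto)
      moreover have "?q r \<ge> 0"
        by (intro divide_nonneg_nonneg) (auto simp: set_lebesgue_integral_def intro!: Bochner_Integration.integral_nonneg)
      ultimately show ?thesis using k by simp
    qed
    then show "\<forall>\<^sub>F r in at_right 0. dist (?q r) 0 < e"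
      unfolding eventually_at_right_field using R[OF ke(1)] by (intro exI[of _ "R ?e"]) auto
  qed
  then show ?thesis by blast
qed

text \<open>
A null set of reals contains no interval.
\<close>
lemma negligible_connected_constant:
  fixes A :: "real set"
  assumes "negligible A" "connected I" "I \<subseteq> A" "x \<in> I" "y \<in> I"
  shows "x = y"
proof (rule ccontr)
  assume "x \<noteq> y"
  define a where "a = min x y" define b where "b = max x y"
  have ab: "a < b" "a \<in> I" "b \<in> I" using \<open>x \<noteq> y\<close> assms(4,5) by (auto simp: a_def b_def min_def max_def)
  have "{a..b} \<subseteq> I" using connected_contains_Icc[OF assms(2) ab(2,3)] .
  then have "negligible {a..b}" using assms(1,3) negligible_subset by blast
  then show False using negligible_interval(1)[of a b] ab(1) by (simp add: not_less[symmetric])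
qed

text \<open>
  That a leaf is the image of some periodic geodesic \<open>c\<close> has to be transferred to its given
  parametrization.  The leaf space is totally disconnected, so locally \<open>c\<close> stays in one plaque.
  By compactness of a period the whole leaf is therefore covered by a bounded set of parameters of
  \<open>dir l\<close>, which cannot be injective.
\<close>
lemma closed_leaf_periodic:
  assumes M: "closed_hyperbolic_surface M p" and O: "oriented_lamination M p S L dir" and l: "l \<in> L"
    and cl: "closed_leaf p l"
  shows "\<exists>T>0. \<forall>u. dir l (u + T) = dir l u"
proof -
  obtain c T where c: "complete_geodesic p c" "range c = l" "0 < T" "\<And>t. c (t + T) = c t"
    using cl unfolding closed_leaf_def by blast
  have cc: "continuous_on UNIV c" by (rule dir_continuous[OF M c(1)])
  have lS: "c w \<in> S" for w using c(2) l oriented_lamination_leaves(6)[OF O] by blast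
  have "\<exists>V R. open V \<and> w0 \<in> V \<and> (\<forall>w\<in>V. \<exists>u. \<bar>u\<bar> \<le> R \<and> c w = dir l u)" for w0
  proof -
    obtain B t0 s0 where B: "oriented_flow_box M p S L dir B" "(t0, s0) \<in> open_rect B" "s0 \<in> leafset B" "chart B (t0, s0) = c w0"
      using box_at_leaf_point[OF O lS] by blast
    have F: "flow_box M p S B" by (rule oriented_flow_boxD[OF B(1)])
    obtain U where U: "open U" "chart B ` open_rect B = M \<inter> U"
      using chart_open_image[OF M F open_open_rect open_rect_subset] by (auto simp: openin_open)
    have "open (c -` U)" using cc U(1) by (simp add: open_vimage)
    moreover have "w0 \<in> c -` U" using U(2) B(2,4) by (metis IntD2 image_eqI vimageI)
    ultimately obtain \<epsilon> where \<epsilon>: "\<epsilon> > 0" "ball w0 \<epsilon> \<subseteq> c -` U" using open_contains_ball by blast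
    have cV: "c w \<in> chart B ` open_rect B" if "w \<in> ball w0 \<epsilon>" for w
      using that \<epsilon>(2) lS[of w] oriented_lamination_leaves(8)[OF O] unfolding U(2) by blast
    obtain g where g: "homeomorphism (rect B) (chart B ` rect B) (chart B) g"
      using homeomorphism_compact[OF rect_compact chart_continuous[OF M F] refl flow_box_inj[OF F]] by blast
    have cV': "c w \<in> chart B ` rect B" if "w \<in> ball w0 \<epsilon>" for w
      using cV[OF that] open_rect_subset[of B] by blast
    have gr: "g (c w) \<in> rect B" "chart B (g (c w)) = c w" if "w \<in> ball w0 \<epsilon>" for w
      using g cV'[OF that] by (auto simp: homeomorphism_def)
    have "continuous_on (ball w0 \<epsilon>) (\<lambda>w. snd (g (c w)))"
      by (intro continuous_on_snd continuous_on_compose2[OF homeomorphism_cont2[OF g] continuous_on_subset[OF cc]])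
        (use cV' in auto)
    then have conn: "connected ((\<lambda>w. snd (g (c w))) ` ball w0 \<epsilon>)" by (intro connected_continuous_image) auto
    have leaf: "(\<lambda>w. snd (g (c w))) ` ball w0 \<epsilon> \<subseteq> leafset B"
      using flow_box_leafset[OF F gr(1)] gr(2) lS by auto
    have neg: "negligible (leafset B)" using F hausdorff_dim_0_negligible by (auto simp: flow_box_def)
    have w0: "w0 \<in> ball w0 \<epsilon>" using \<epsilon>(1) by simp
    have "g (c w0) = (t0, s0)"
    proof -
      have "(t0, s0) \<in> rect B" using B(2) open_rect_subset by blast
      then show ?thesis using inj_onD[OF flow_box_inj[OF F]] gr[OF w0] B(4) by metis
    qed
    then have const: "snd (g (c w)) = s0" if "w \<in> ball w0 \<epsilon>" for w
      using negligible_connected_constant[OF neg conn leaf imageI[OF that] imageI[OF w0]] by simp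
    obtain l' \<theta> where \<theta>: "l' \<in> L" "continuous_on {tmin B..tmax B} \<theta>"
      "\<forall>t\<in>{tmin B..tmax B}. chart B (t, s0) = dir l' (\<theta> t)"
      using B(1,3) unfolding oriented_flow_box_def by blast
    have t0: "t0 \<in> {tmin B..tmax B}" using B(2) by (auto simp: open_rect_def)
    have "c w0 = dir l' (\<theta> t0)" using \<theta>(3) t0 B(4) by simp
    then have "c w0 \<in> l'" using oriented_lamination_leaves(4)[OF O \<theta>(1)] by auto
    moreover have "c w0 \<in> l" using c(2) by blast
    ultimately have ll: "l' = l" using oriented_lamination_leaves(5)[OF O] l \<theta>(1) by (auto dest: disjointD)
    have "bounded (\<theta> ` {tmin B..tmax B})" by (intro compact_imp_bounded compact_continuous_image \<theta>(2)) simp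
    then obtain R where R: "\<forall>t\<in>{tmin B..tmax B}. \<bar>\<theta> t\<bar> \<le> R" unfolding bounded_iff by auto
    have "\<exists>u. \<bar>u\<bar> \<le> R \<and> c w = dir l u" if w: "w \<in> ball w0 \<epsilon>" for w
    proof -
      define t where "t = fst (g (c w))"
      have "g (c w) = (t, s0)" using const[OF w] by (simp add: t_def prod_eq_iff)
      then have "t \<in> {tmin B..tmax B}" "chart B (t, s0) = c w" using gr[OF w] by (auto simp: rect_def)
      then show ?thesis using R \<theta>(3) ll by metis
    qed
    then show ?thesis using w0 by (intro exI[of _ "ball w0 \<epsilon>"] exI[of _ R]) auto
  qed
  then obtain V R where V: "\<And>w0. open (V w0) \<and> w0 \<in> V w0 \<and> (\<forall>w\<in>V w0. \<exists>u. \<bar>u\<bar> \<le> R w0 \<and> c w = dir l u)" by metis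
  have "{0..T} \<subseteq> (\<Union>w0\<in>{0..T}. V w0)" using V by blast
  then obtain C' where C': "C' \<subseteq> {0..T}" "finite C'" "{0..T} \<subseteq> (\<Union>w0\<in>C'. V w0)"
    using compactE_image[OF compact_Icc[of 0 T], of "{0..T}" V] V by metis
  define R0 where "R0 = Max (insert 0 (R ` C'))"
  have R0: "R0 \<ge> 0" "\<And>w0. w0 \<in> C' \<Longrightarrow> R w0 \<le> R0" using C'(2) by (auto simp: R0_def)
  have "dir l (R0 + 1) \<in> range c" using c(2) oriented_lamination_leaves(4)[OF O l] by blast
  then obtain w where "dir l (R0 + 1) = c w" by blast
  moreover obtain w' where w': "w' \<in> {0..T}" "c w' = c w" using periodic_mod[of T c, OF c(3,4)] by blast
  moreover obtain w0 where w0: "w0 \<in> C'" "w' \<in> V w0" using C'(3) w'(1) by blast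
  moreover obtain u where u: "\<bar>u\<bar> \<le> R w0" "c w' = dir l u" using V w0(2) by blast
  ultimately have "dir l (R0 + 1) = dir l u" by simp
  moreover have "R0 + 1 \<noteq> u" using u(1) R0(2)[OF w0(1)] by auto
  ultimately show ?thesis by (rule simple_geodesic_periodic[OF oriented_lamination_leaves(3)[OF O l]])
qed

section \<open>The jump set of the primitive\<close>

context
  fixes M S :: "'m::metric_space set" and p :: "complex \<Rightarrow> 'm"
    and L :: "'m set set" and dir :: "'m set \<Rightarrow> real \<Rightarrow> 'm"
    and \<nu> :: "'m flow_box \<Rightarrow> real measure"
    and T :: "(complex \<Rightarrow> complex) \<Rightarrow> real" and v :: "complex \<Rightarrow> real"
  assumes M: "closed_hyperbolic_surface M p" and O: "oriented_lamination M p S L dir"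
    and \<nu>: "transverse_measure M p S \<nu>" and RS: "ruelle_sullivan_current M p S L dir \<nu> T"
    and prim: "primitive p T v"
begin

lemma primitive_locally_integrable: "locally_integrable v"
  using prim by (simp add: primitive_def BV_loc_def)

lemma d_current_primitive: "test_form \<psi> \<Longrightarrow> d_current v \<psi> = T (pushforward p \<psi>)"
  using prim by (simp add: primitive_def)

lemma d_current_zero_off:
  assumes "open V" "V \<subseteq> uhp" "inj_on p V" "\<And>z. z \<in> V \<Longrightarrow> p z \<notin> S"
    "test_form \<psi>" "closure {z. \<psi> z \<noteq> 0} \<subseteq> V"
  shows "d_current v \<psi> = 0"
  using current_zero_off_lamination[OF M O RS assms] d_current_primitive[OF assms(5)] by simp

lemma open_off_lamination: "open {z \<in> uhp. p z \<notin> S}"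
proof -
  have "{z \<in> uhp. p z \<notin> S} = uhp \<inter> p -` (- S)" by auto
  moreover have "open (- S)" using oriented_lamination_leaves(7)[OF O] by auto
  ultimately show ?thesis using surface_continuous[OF M] open_uhp by (simp add: continuous_open_preimage)
qed

lemma off_lamination_nbhd:
  assumes "z \<in> uhp" "p z \<notin> S"
  shows "\<exists>V. open V \<and> z \<in> V \<and> V \<subseteq> uhp \<and> inj_on p V \<and> (\<forall>w\<in>V. p w \<notin> S)"
proof -
  obtain V where V: "open V" "z \<in> V" "V \<subseteq> uhp" "inj_on p V" using surface_locally_injective[OF M assms(1)] .
  let ?V = "V \<inter> {z \<in> uhp. p z \<notin> S}"
  have "open ?V" using V(1) open_off_lamination by blast
  moreover have "inj_on p ?V" using V(4) by (rule inj_on_subset) blast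
  ultimately show ?thesis using V assms by (intro exI[of _ ?V]) auto
qed

lemma not_jump_of_small_current:
  assumes z: "z \<in> uhp"
    and small: "\<And>n. cmod n = 1 \<Longrightarrow> ((\<lambda>r. d_current v (blow_form z n r) / r) \<longlongrightarrow> 0) (at_right 0)"
  shows "z \<notin> jump_set v"
proof
  assume "z \<in> jump_set v"
  then obtain a b n where *: "a \<noteq> b" "cmod n = 1" "approx_limit_along v z n a" "approx_limit_along v z (- n) b"
    by (auto simp: jump_set_def)
  have "((\<lambda>r. d_current v (blow_form z n r) / r) \<longlongrightarrow> (a - b) * blow_constant n) (at_right 0)"
    by (rule blow_up[OF primitive_locally_integrable *(2) z *(3,4)])
  then have "(a - b) * blow_constant n = 0"
    using small[OF *(2)] by (rule tendsto_unique[rotated 1]) simp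
  then show False using *(1) blow_constant_neg[OF *(2)] by simp
qed

lemma blow_form_eventually:
  assumes "open V" "z \<in> V" "V \<subseteq> uhp" "cmod n = 1"
  shows "\<forall>\<^sub>F r in at_right 0. test_form (blow_form z n r) \<and> closure {w. blow_form z n r w \<noteq> 0} \<subseteq> V"
  using eventually_ball_in_open[OF assms(1,2)] eventually_at_right_less[of 0]
proof eventually_elim
  case (elim r)
  then show ?case using test_form_blow_form[OF assms(4) elim(2) order_trans[OF elim(1) assms(3)]] by auto
qed

lemma not_jump_of_zero_nbhd:
  assumes V: "open V" "z \<in> V" "V \<subseteq> uhp"
    and zero: "\<And>\<psi>. test_form \<psi> \<Longrightarrow> closure {z. \<psi> z \<noteq> 0} \<subseteq> V \<Longrightarrow> d_current v \<psi> = 0"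
  shows "z \<notin> jump_set v"
proof (rule not_jump_of_small_current)
  show "z \<in> uhp" using V by blast
  fix n :: complex assume n: "cmod n = 1"
  have "\<forall>\<^sub>F r in at_right 0. 0 = d_current v (blow_form z n r) / r"
    using blow_form_eventually[OF V n] by eventually_elim (simp add: zero)
  then show "((\<lambda>r. d_current v (blow_form z n r) / r) \<longlongrightarrow> 0) (at_right 0)"
    by (rule Lim_transform_eventually[OF tendsto_const])
qed

lemma not_jump_off_lamination:
  assumes "z \<in> uhp" "p z \<notin> S" shows "z \<notin> jump_set v"
proof -
  obtain V where "open V" "z \<in> V" "V \<subseteq> uhp" "inj_on p V" "\<forall>w\<in>V. p w \<notin> S"
    using off_lamination_nbhd[OF assms] by blast
  then show ?thesis by (intro not_jump_of_zero_nbhd[of V] d_current_zero_off[of V]) auto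
qed

lemma not_jump_of_null_leaf:
  assumes A: "adapted_lift M p S L dir B G G'" and x0: "(t0, s0) \<in> open_rect B"
    and zero: "emeasure (\<nu> B) {s0} = 0"
  shows "G (t0, s0) \<notin> jump_set v"
proof (rule not_jump_of_small_current)
  let ?V = "G ` open_rect B"
  note V = sub_box_image[OF A open_open_rect open_rect_subset]
  show "G (t0, s0) \<in> uhp" using V(2) x0 by blast
  fix n :: complex assume n: "cmod n = 1"
  have "\<forall>\<^sub>F r in at_right 0. T (pushforward p (blow_form (G (t0, s0)) n r)) / r = d_current v (blow_form (G (t0, s0)) n r) / r"
    using blow_form_eventually[OF V(1) imageI[OF x0] V(2) n] by eventually_elim (simp add: d_current_primitive)
  then show "((\<lambda>r. d_current v (blow_form (G (t0, s0)) n r) / r) \<longlongrightarrow> 0) (at_right 0)"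
    by (rule Lim_transform_eventually[OF current_blow_small[OF M O \<nu> RS A x0 zero n]])
qed

text \<open>
  In the support of the form the lamination consists of the plaque \<open>s0\<close>, which has mass 0.
\<close>
lemma current_zero_near_null_isolated:
  assumes A: "adapted_lift M p S L dir B G G'"
    and zero: "emeasure (\<nu> B) {s0} = 0"
    and iso: "\<And>s. s \<in> leafset B \<Longrightarrow> \<bar>s - s0\<bar> < \<delta> \<Longrightarrow> s = s0"
    and \<psi>: "test_form \<psi>" "closure {z. \<psi> z \<noteq> 0} \<subseteq> G ` (open_rect B \<inter> UNIV \<times> {s0 - \<delta><..<s0 + \<delta>})"
  shows "d_current v \<psi> = 0"
proof -
  note B = adapted_facts(2)[OF A] and G = adapted_facts(3)[OF A]
  have sets: "sets (\<nu> B) = sets borel" and conc: "emeasure (\<nu> B) (- leafset B) = 0"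
    using \<nu> B by (auto simp: transverse_measure_def)
  have sp: "space (\<nu> B) = UNIV" using sets_eq_imp_space_eq[OF sets] by simp
  have "- leafset B \<union> {s0} \<in> null_sets (\<nu> B)"
    using conc B zero by (intro null_sets.Un) (auto simp: null_sets_def sets flow_box_def)
  then have ae: "AE s in \<nu> B. s \<notin> - leafset B \<union> {s0}" by (rule AE_not_in)
  let ?F = "\<lambda>s. integral {tmin B..tmax B} (\<lambda>t. \<psi> (G (t, s)) \<bullet> G' (t, s))"
  have "AE s in \<nu> B. indicator {smin B<..<smax B} s *\<^sub>R ?F s = 0"
    using ae
  proof eventually_elim
    case (elim s)
    then have s: "s \<in> leafset B" "\<bar>s - s0\<bar> \<ge> \<delta>" using iso[of s] by force+
    show ?case
    proof (cases "s \<in> {smin B<..<smax B}")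
      case True
      have "\<psi> (G (t, s)) = 0" if t: "t \<in> {tmin B..tmax B}" for t
      proof (rule ccontr)
        assume "\<psi> (G (t, s)) \<noteq> 0"
        then have "G (t, s) \<in> G ` (open_rect B \<inter> UNIV \<times> {s0 - \<delta><..<s0 + \<delta>})"
          using \<psi>(2) closure_subset[of "{z. \<psi> z \<noteq> 0}"] by blast
        then obtain y where y: "y \<in> open_rect B" "snd y \<in> {s0 - \<delta><..<s0 + \<delta>}" "G (t, s) = G y" by auto
        have "(t, s) \<in> rect B" "y \<in> rect B" using True t y(1) open_rect_subset by (auto simp: rect_def)
        then have "(t, s) = y" using inj_onD[OF lift_inj(2)[OF B G] y(3)] by blast
        then have "\<bar>s - s0\<bar> < \<delta>" using y(2) by auto
        then show False using s(2) by simp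
      qed
      then have "?F s = integral {tmin B..tmax B} (\<lambda>t. 0)" by (intro integral_cong) simp
      then show ?thesis by simp
    qed simp
  qed
  then have "(LINT s:{smin B<..<smax B}|\<nu> B. ?F s) = 0"
    unfolding set_lebesgue_integral_def by (rule integral_eq_zero_AE)
  moreover have "closure {z. \<psi> z \<noteq> 0} \<subseteq> G ` open_rect B" using \<psi>(2) by blast
  ultimately show ?thesis
    using current_in_box[OF M O RS A \<psi>(1)] d_current_primitive[OF \<psi>(1)] by simp
qed

text \<open>
  On both sides of the plaque \<open>v\<close> is constant, so the approximate limits exist; were they
  equal, the blow-up would contradict \<open>current_blow_large\<close>.
\<close>
lemma jump_at_isolated_atom:
  assumes A: "adapted_lift M p S L dir B G G'" and x0: "(t0, s0) \<in> open_rect B"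
    and pos: "emeasure (\<nu> B) {s0} \<noteq> 0"
    and iso: "\<delta> > 0" "\<And>s. s \<in> leafset B \<Longrightarrow> \<bar>s - s0\<bar> < \<delta> \<Longrightarrow> s = s0" and s0: "s0 \<in> leafset B"
  shows "G (t0, s0) \<in> jump_set v"
proof -
  note B = adapted_facts(2)[OF A] and G = adapted_facts(3)[OF A]
  let ?z = "G (t0, s0)" and ?\<tau> = "G' (t0, s0)"
  have x0r: "(t0, s0) \<in> rect B" using x0 open_rect_subset by blast
  have z: "?z \<in> uhp" by (rule chart_lift_facts(2)[OF G x0r])
  have tau: "?\<tau> \<noteq> 0" by (rule lift_tangent_nonzero[OF M A x0r])
  \<comment> \<open>The unit normal for which \<open>\<i> n\<close> is the unit tangent of the plaque.\<close>
  define n where "n = - \<i> * (?\<tau> / of_real (cmod ?\<tau>))"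
  have n1: "cmod n = 1" using tau by (simp add: n_def norm_mult norm_divide)
  have n2: "\<i> * n = ?\<tau> / of_real (cmod ?\<tau>)" by (simp add: n_def)
  have ort: "?\<tau> \<bullet> n = 0"
  proof -
    have "n = inverse (cmod ?\<tau>) *\<^sub>R (- \<i> * ?\<tau>)" by (simp add: n_def scaleR_conv_of_real divide_inverse)
    moreover have "?\<tau> \<bullet> (- \<i> * ?\<tau>) = 0" by (simp add: inner_complex_def)
    ultimately show ?thesis by simp
  qed
  define \<eta> where "\<eta> = min \<delta> (min (s0 - smin B) (smax B - s0))"
  have \<eta>: "\<eta> > 0" "\<eta> \<le> \<delta>" "\<eta> \<le> s0 - smin B" "\<eta> \<le> smax B - s0"
    using iso(1) x0 by (auto simp: \<eta>_def open_rect_def)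
  define I where "I = {tmin B<..<tmax B}"
  define Q1 where "Q1 = I \<times> {s0<..<s0 + \<eta>}"
  define Q2 where "Q2 = I \<times> {s0 - \<eta><..<s0}"
  define Q where "Q = I \<times> {s0 - \<eta><..<s0 + \<eta>}"
  define \<Gamma> where "\<Gamma> = G ` (I \<times> {s0})"
  have sub: "Q \<subseteq> rect B" "Q1 \<subseteq> rect B" "Q2 \<subseteq> rect B" using \<eta> by (auto simp: Q_def Q1_def Q2_def I_def rect_def)
  have opn: "open Q" "open Q1" "open Q2" by (auto simp: Q_def Q1_def Q2_def I_def open_Times)
  have const: "\<exists>c. AE w in lebesgue. w \<in> G ` R \<longrightarrow> v w = c"
    if R: "open R" "R \<subseteq> rect B" "connected R" "\<And>x. x \<in> R \<Longrightarrow> \<bar>snd x - s0\<bar> < \<delta> \<and> snd x \<noteq> s0" for R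
  proof (rule AE_constant_on_connected[OF primitive_locally_integrable])
    note V = sub_box_image[OF A R(1,2)]
    show "open (G ` R)" "G ` R \<subseteq> uhp" using V by auto
    show "connected (G ` R)"
      using chart_lift_facts(1)[OF G] R(2,3) by (metis connected_continuous_image continuous_on_subset)
    have "p w \<notin> S" if "w \<in> G ` R" for w
      using that lift_in_lamination[OF A] R(2,4) iso(2) by blast
    then show "d_current v \<psi> = 0" if "test_form \<psi>" "closure {z. \<psi> z \<noteq> 0} \<subseteq> G ` R" for \<psi>
      using d_current_zero_off[OF V _ that] by blast
  qed
  obtain c1 where c1: "AE w in lebesgue. w \<in> G ` Q1 \<longrightarrow> v w = c1"
    using const[OF opn(2) sub(2)] \<eta>(2) by (auto simp: Q1_def I_def connected_Times)
  obtain c2 where c2: "AE w in lebesgue. w \<in> G ` Q2 \<longrightarrow> v w = c2"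
    using const[OF opn(3) sub(3)] \<eta>(2) by (auto simp: Q2_def I_def connected_Times)
  have "negligible \<Gamma>"
    by (rule negligible_subset[OF plaques_negligible[OF M B G]]) (use s0 x0r in \<open>auto simp: \<Gamma>_def I_def rect_def\<close>)
  then have \<Gamma>0: "AE w in lebesgue. w \<notin> \<Gamma>" by (intro AE_not_in) (simp add: negligible_iff_null_sets)
  obtain C where C: "C > 0" "\<And>x y. x \<in> rect B \<Longrightarrow> y \<in> rect B \<Longrightarrow> dist x y \<le> C * dist (G x) (G y)"
    using lift_expanding[OF M B G] by blast
  have tangent: "\<exists>r>0. \<forall>w\<in>\<Gamma> \<inter> ball ?z r. \<bar>(w - ?z) \<bullet> n\<bar> \<le> \<epsilon> * cmod (w - ?z)" if \<epsilon>: "\<epsilon> > 0" for \<epsilon>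
  proof -
    have "((\<lambda>\<tau>. G (\<tau>, s0)) has_derivative (\<lambda>h. h *\<^sub>R ?\<tau>)) (at t0 within {tmin B..tmax B})"
      using adapted_facts(5)[OF A x0r] by (simp add: has_vector_derivative_def)
    then have "\<forall>e>0. \<exists>d>0. \<forall>t\<in>{tmin B..tmax B}. norm (t - t0) < d \<longrightarrow>
        norm (G (t, s0) - ?z - (t - t0) *\<^sub>R ?\<tau>) \<le> e * norm (t - t0)"
      unfolding has_derivative_within_alt by blast
    then obtain d where d: "d > 0" "\<And>t. t \<in> {tmin B..tmax B} \<Longrightarrow> norm (t - t0) < d \<Longrightarrow>
        norm (G (t, s0) - ?z - (t - t0) *\<^sub>R ?\<tau>) \<le> \<epsilon> / C * norm (t - t0)"
      using divide_pos_pos[OF \<epsilon> C(1)] by blast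
    have "\<bar>(w - ?z) \<bullet> n\<bar> \<le> \<epsilon> * cmod (w - ?z)" if w: "w \<in> \<Gamma>" "w \<in> ball ?z (d / C)" for w
    proof -
      obtain t where t: "t \<in> I" "w = G (t, s0)" using w(1) by (auto simp: \<Gamma>_def)
      have ts: "t \<in> {tmin B..tmax B}" "(t, s0) \<in> rect B" using t(1) x0r by (auto simp: I_def rect_def)
      have "\<bar>t - t0\<bar> = dist (t, s0) (t0, s0)" by (simp add: dist_Pair_Pair dist_real_def)
      also have "\<dots> \<le> C * dist w ?z" using C(2)[OF ts(2) x0r] t(2) by simp
      finally have tb: "\<bar>t - t0\<bar> \<le> C * cmod (w - ?z)" by (simp add: dist_norm)
      moreover have "C * cmod (w - ?z) < d" using w(2) C(1) by (simp add: dist_norm norm_minus_commute field_simps)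
      ultimately have "norm (t - t0) < d" by simp
      then have "norm (w - ?z - (t - t0) *\<^sub>R ?\<tau>) \<le> \<epsilon> / C * \<bar>t - t0\<bar>" using d(2)[OF ts(1)] t(2) by simp
      also have "\<dots> \<le> \<epsilon> / C * (C * cmod (w - ?z))" using tb \<epsilon> C(1) by (intro mult_left_mono) auto
      also have "\<dots> = \<epsilon> * cmod (w - ?z)" using C(1) by simp
      finally have "norm (w - ?z - (t - t0) *\<^sub>R ?\<tau>) \<le> \<epsilon> * cmod (w - ?z)" .
      moreover have "(w - ?z) \<bullet> n = (w - ?z - (t - t0) *\<^sub>R ?\<tau>) \<bullet> n" using ort by (simp add: inner_diff_left)
      moreover have "\<bar>(w - ?z - (t - t0) *\<^sub>R ?\<tau>) \<bullet> n\<bar> \<le> norm (w - ?z - (t - t0) *\<^sub>R ?\<tau>) * cmod n"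
        by (rule Cauchy_Schwarz_ineq2)
      ultimately show ?thesis using n1 by simp
    qed
    then show ?thesis using d(1) C(1) by (intro exI[of _ "d / C"]) auto
  qed
  have disj: "G ` Q1 \<inter> G ` Q2 = {}"
  proof -
    have "Q1 \<inter> Q2 = {}" by (auto simp: Q1_def Q2_def)
    then show ?thesis using inj_on_image_Int[OF lift_inj(2)[OF B G] sub(2,3)] by simp
  qed
  have cov: "G ` Q \<subseteq> G ` Q1 \<union> G ` Q2 \<union> \<Gamma>"
  proof -
    have "Q \<subseteq> Q1 \<union> Q2 \<union> I \<times> {s0}" by (auto simp: Q_def Q1_def Q2_def)
    then show ?thesis unfolding \<Gamma>_def by blast
  qed
  have zQ: "?z \<in> G ` Q" using x0 \<eta>(1) by (auto simp: Q_def I_def open_rect_def)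
  have lim: "\<exists>a. approx_limit_along v ?z m a" if m: "m = n \<or> m = - n" for m
    by (rule approx_limit_two_sides[OF sub_box_image(1)[OF A opn(1) sub(1)] zQ
          sub_box_image(1)[OF A opn(2) sub(2)] sub_box_image(1)[OF A opn(3) sub(3)] disj cov c1 c2 \<Gamma>0])
      (use m n1 tangent in auto)
  obtain a where a: "approx_limit_along v ?z n a" using lim by blast
  obtain b where b: "approx_limit_along v ?z (- n) b" using lim by blast
  have "a \<noteq> b"
  proof
    assume "a = b"
    then have l0: "((\<lambda>r. d_current v (blow_form ?z n r) / r) \<longlongrightarrow> 0) (at_right 0)"
      using blow_up[OF primitive_locally_integrable n1 z a b] by simp
    obtain c where c: "c > 0" "\<forall>\<^sub>F r in at_right 0. T (pushforward p (blow_form ?z n r)) / r \<ge> c"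
      using current_blow_large[OF M O \<nu> RS A x0 pos iso n1 n2] by blast
    note V = sub_box_image[OF A open_open_rect open_rect_subset]
    have "\<forall>\<^sub>F r in at_right 0. c \<le> d_current v (blow_form ?z n r) / r"
      using c(2) blow_form_eventually[OF V(1) imageI[OF x0] V(2) n1]
      by eventually_elim (simp add: d_current_primitive)
    then have "c \<le> 0" by (rule tendsto_lowerbound[OF l0]) simp
    then show False using c(1) by simp
  qed
  then show ?thesis using z n1 a b unfolding jump_set_def by blast
qed

text \<open>
  The proof distinguishes by the mass of the plaque through \<open>z\<close>.  Positive mass gives a jump
  point on a periodic and hence isolated leaf, and the nearby points of the lamination lie on the same plaque.  Mass
  0 gives no jump; if moreover the leaf is closed, it is isolated and the current vanishes nearby.
\<close>
lemma jump_classification: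
  assumes \<N>: "finite \<N>" "disjoint \<N>" "\<And>N. N \<in> \<N> \<Longrightarrow> minimal_lamination M p N" "\<Union>\<N> = S"
    and z: "z \<in> uhp" "p z \<in> S"
  shows "z \<in> jump_set v \<longrightarrow> p z \<in> \<Union>(closed_isolated_leaves M p S L)"
    and "z \<in> jump_set v \<longrightarrow> (\<exists>V. open V \<and> z \<in> V \<and> V \<inter> {z \<in> uhp. p z \<in> S} \<subseteq> jump_set v)"
    and "z \<notin> jump_set v \<and> l \<in> L \<and> p z \<in> l \<and> closed_leaf p l \<longrightarrow>
      (\<exists>V. open V \<and> z \<in> V \<and> V \<subseteq> uhp \<and>
        (\<forall>\<psi>. test_form \<psi> \<and> closure {z. \<psi> z \<noteq> 0} \<subseteq> V \<longrightarrow> d_current v \<psi> = 0))"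
proof -
  obtain B G G' t0 s0 where A: "adapted_lift M p S L dir B G G'" and x0: "(t0, s0) \<in> open_rect B"
    and s0: "s0 \<in> leafset B" and Gz: "G (t0, s0) = z"
    using box_through_point[OF M O z] by blast
  note OB = adapted_facts(1)[OF A] and B = adapted_facts(2)[OF A] and G = adapted_facts(3)[OF A]
  have x0r: "(t0, s0) \<in> rect B" using x0 open_rect_subset by blast
  have cz: "chart B (t0, s0) = p z" using chart_lift_facts(3)[OF G x0r] Gz by simp
  define W where "W \<delta> = open_rect B \<inter> UNIV \<times> {s0 - \<delta><..<s0 + \<delta>}" for \<delta>
  have W: "open (W \<delta>)" "W \<delta> \<subseteq> rect B" for \<delta>
    using open_open_rect[of B] open_rect_subset[of B] by (auto simp: W_def open_Times intro!: open_Int)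
  have zW: "z \<in> G ` W \<delta>" if "\<delta> > 0" for \<delta> using x0 Gz that by (auto simp: W_def)
  have iso: "\<exists>\<delta>>0. \<forall>s\<in>leafset B. \<bar>s - s0\<bar> < \<delta> \<longrightarrow> s = s0"
    if k: "k \<in> L" "p z \<in> k" "T' > 0" "\<And>u. dir k (u + T') = dir k u" for k T'
    by (rule periodic_leaf_isolated_in_box[OF M O k(1,3,4) \<N> OB x0 s0]) (use k(2) cz in auto)
  have atom: "p z \<in> \<Union>(closed_isolated_leaves M p S L) \<and> z \<in> jump_set v \<and>
     (\<exists>V. open V \<and> z \<in> V \<and> V \<inter> {z \<in> uhp. p z \<in> S} \<subseteq> jump_set v)" if pos: "emeasure (\<nu> B) {s0} \<noteq> 0"
  proof -
    obtain k where k: "k \<in> L" "p z \<in> k" using z(2) oriented_lamination_leaves(6)[OF O] by blast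
    have "chart B (t0, s0) \<in> k" using cz k(2) by simp
    then obtain T' where T': "T' > 0" "\<And>u. dir k (u + T') = dir k u"
      using atom_imp_periodic[OF M O \<nu> k(1) OB x0 s0 _ pos] by blast
    obtain \<delta> where \<delta>: "\<delta> > 0" "\<And>s. s \<in> leafset B \<Longrightarrow> \<bar>s - s0\<bar> < \<delta> \<Longrightarrow> s = s0"
      using iso[OF k T'] by blast
    have "k \<in> closed_isolated_leaves M p S L" by (rule periodic_leaf_isolated[OF M O k(1) T' \<N>])
    moreover have "w \<in> jump_set v" if w: "w \<in> G ` W \<delta>" "p w \<in> S" for w
    proof -
      obtain t s where ts: "(t, s) \<in> W \<delta>" "w = G (t, s)" using w(1) by auto
      have r: "(t, s) \<in> rect B" "(t, s) \<in> open_rect B"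
        using W(2)[of \<delta>] ts(1) by (blast, simp add: W_def)
      have "s \<in> leafset B" using lift_in_lamination[OF A r(1)] w(2) ts(2) by simp
      moreover have "\<bar>s - s0\<bar> < \<delta>" using ts(1) by (auto simp: W_def abs_less_iff)
      ultimately have "s = s0" by (rule \<delta>(2))
      then have "(t, s0) \<in> open_rect B" using r(2) by simp
      then show ?thesis using jump_at_isolated_atom[OF A _ pos \<delta> s0] ts(2) \<open>s = s0\<close> by simp
    qed
    then have "G ` W \<delta> \<inter> {z \<in> uhp. p z \<in> S} \<subseteq> jump_set v" by blast
    ultimately show ?thesis
      using k(2) zW[OF \<delta>(1)] z sub_box_image(1)[OF A W] by blast
  qed
  have null: "z \<notin> jump_set v" if "emeasure (\<nu> B) {s0} = 0"
    using not_jump_of_null_leaf[OF A x0 that] Gz by simp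
  show "z \<in> jump_set v \<longrightarrow> p z \<in> \<Union>(closed_isolated_leaves M p S L)" using atom null by blast
  show "z \<in> jump_set v \<longrightarrow> (\<exists>V. open V \<and> z \<in> V \<and> V \<inter> {z \<in> uhp. p z \<in> S} \<subseteq> jump_set v)" using atom null by blast
  show "z \<notin> jump_set v \<and> l \<in> L \<and> p z \<in> l \<and> closed_leaf p l \<longrightarrow>
      (\<exists>V. open V \<and> z \<in> V \<and> V \<subseteq> uhp \<and>
        (\<forall>\<psi>. test_form \<psi> \<and> closure {z. \<psi> z \<noteq> 0} \<subseteq> V \<longrightarrow> d_current v \<psi> = 0))"
  proof
    assume a: "z \<notin> jump_set v \<and> l \<in> L \<and> p z \<in> l \<and> closed_leaf p l"
    then have zero: "emeasure (\<nu> B) {s0} = 0" using atom by blast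
    obtain T' where T': "T' > 0" "\<And>u. dir l (u + T') = dir l u" using closed_leaf_periodic[OF M O] a by blast
    obtain \<delta> where \<delta>: "\<delta> > 0" "\<And>s. s \<in> leafset B \<Longrightarrow> \<bar>s - s0\<bar> < \<delta> \<Longrightarrow> s = s0"
      using iso[OF _ _ T'] a by blast
    show "\<exists>V. open V \<and> z \<in> V \<and> V \<subseteq> uhp \<and>
        (\<forall>\<psi>. test_form \<psi> \<and> closure {z. \<psi> z \<noteq> 0} \<subseteq> V \<longrightarrow> d_current v \<psi> = 0)"
      using sub_box_image(1,2)[OF A W, of \<delta>] zW[OF \<delta>(1)]
        current_zero_near_null_isolated[OF A zero \<delta>(2)] unfolding W_def by blast
  qed
qed

text \<open>
  The jump set is open in \<open>P\<close>.  Countable additivity of the singular part is available only on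
  Borel sets, so this is needed to restrict it to the complement of the jump set.
\<close>
lemma jump_set_borel:
  assumes \<N>: "finite \<N>" "disjoint \<N>" "\<And>N. N \<in> \<N> \<Longrightarrow> minimal_lamination M p N" "\<Union>\<N> = S"
  shows "jump_set v \<in> sets borel"
proof -
  let ?P = "{z \<in> uhp. p z \<in> S}"
  let ?U = "\<Union>{V. open V \<and> V \<inter> ?P \<subseteq> jump_set v}"
  have J: "jump_set v \<subseteq> ?P" using not_jump_off_lamination by (auto simp: jump_set_def)
  have eq: "jump_set v = ?P \<inter> ?U"
  proof
    show "jump_set v \<subseteq> ?P \<inter> ?U" using J jump_classification(2)[OF \<N>] by blast
  qed blast
  have "?P = uhp - {z \<in> uhp. p z \<notin> S}" by auto
  then have P: "?P \<in> sets borel" using open_uhp open_off_lamination by (simp add: sets.Diff)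
  have U: "?U \<in> sets borel" by (rule borel_open) blast
  show ?thesis by (rule ssubst[where P = "\<lambda>A. A \<in> sets borel", OF eq]) (rule sets.Int[OF P U])
qed

lemma total_variation_zero_near:
  assumes \<mu>: "sets \<mu> = sets borel" "\<And>C. compact C \<Longrightarrow> C \<subseteq> uhp \<Longrightarrow> emeasure \<mu> C < \<infinity>"
    "\<sigma> \<in> borel_measurable borel" "\<And>z. z \<in> uhp \<Longrightarrow> cmod (\<sigma> z) = 1"
    "\<And>\<psi>. test_form \<psi> \<Longrightarrow> d_current v \<psi> = (LINT z:uhp|\<mu>. \<psi> z \<bullet> \<sigma> z)"
    and V: "open V" "V \<subseteq> uhp" "\<And>\<psi>. test_form \<psi> \<Longrightarrow> closure {z. \<psi> z \<noteq> 0} \<subseteq> V \<Longrightarrow> d_current v \<psi> = 0"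
  shows "AE z in \<mu>. z \<notin> V"
  by (rule measure_zero_of_test_forms[OF \<mu>(1-4) V(1,2)]) (use V(3) \<mu>(5) in auto)

end

text \<open>
Negligibility is a local property, for arbitrary sets.
\<close>
lemma AE_not_in_of_local:
  fixes Z :: "complex set"
  assumes "\<And>z. z \<in> Z \<Longrightarrow> \<exists>V. open V \<and> z \<in> V \<and> (AE w in \<mu>. w \<notin> V)"
  shows "AE w in \<mu>. w \<notin> Z"
proof -
  let ?U = "\<Union>{V. open V \<and> (AE w in \<mu>. w \<notin> V)}"
  have "open ?U" by blast
  then have "AE w in \<mu>. w \<in> ?U \<longrightarrow> False" by (rule AE_open_of_local) auto
  moreover have "Z \<subseteq> ?U" using assms by blast
  ultimately show ?thesis by (auto elim!: eventually_mono)
qed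

theorem corollary8p7:
  fixes M S :: "'m::metric_space set" and p :: "complex \<Rightarrow> 'm"
    and L :: "'m set set" and dir :: "'m set \<Rightarrow> real \<Rightarrow> 'm"
    and \<nu> :: "'m flow_box \<Rightarrow> real measure"
    and T :: "(complex \<Rightarrow> complex) \<Rightarrow> real" and v :: "complex \<Rightarrow> real"
    and D D_ac D_jump D_cantor :: "complex set \<Rightarrow> complex"
  assumes "closed_hyperbolic_surface M p"
    and "oriented_lamination M p S L dir"
    and "transverse_measure M p S \<nu>"
    and "\<exists>\<N>. finite \<N> \<and> disjoint \<N> \<and> (\<forall>N\<in>\<N>. minimal_lamination M p N) \<and> \<Union>\<N> = S"
    and "ruelle_sullivan_current M p S L dir \<nu> T"
    and "primitive p T v"
    and "canonical_decomposition v D D_ac D_jump D_cantor"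
  shows "(\<forall>B\<in>rc_borel. D_ac B = 0) \<and>
    concentrated_on D_jump {z \<in> uhp. p z \<in> \<Union>(closed_isolated_leaves M p S L)} \<and>
    concentrated_on D_cantor {z \<in> uhp. p z \<in>
      \<Union>{N. N \<subseteq> S \<and> minimal_lamination M p N \<and> N \<notin> closed_isolated_leaves M p S L}}"
proof -
  note M = assms(1) and O = assms(2) and ctx = assms(1,2,3,5,6)
  let ?P = "{z \<in> uhp. p z \<in> S}" and ?J = "jump_set v"
  obtain \<N> where \<N>: "finite \<N>" "disjoint \<N>" "\<And>N. N \<in> \<N> \<Longrightarrow> minimal_lamination M p N" "\<Union>\<N> = S"
    using assms(4) by blast
  obtain D_sing where dm: "differential_measure v D"
    and ac: "vector_measure D_ac" "abs_continuous_vm D_ac" and sing: "singular_vm D_sing"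
    and dec: "\<And>B. B \<in> rc_borel \<Longrightarrow> D B = D_ac B + D_sing B \<and>
           D_jump B = D_sing (B \<inter> ?J) \<and> D_cantor B = D_sing (B - ?J)"
    using assms(7) unfolding canonical_decomposition_def by blast
  obtain \<mu> \<sigma> where \<mu>: "sets \<mu> = sets borel" "\<And>C. compact C \<Longrightarrow> C \<subseteq> uhp \<Longrightarrow> emeasure \<mu> C < \<infinity>"
    "\<sigma> \<in> borel_measurable borel" "\<And>z. z \<in> uhp \<Longrightarrow> cmod (\<sigma> z) = 1"
    "\<And>\<psi>. test_form \<psi> \<Longrightarrow> d_current v \<psi> = (LINT z:uhp|\<mu>. \<psi> z \<bullet> \<sigma> z)"
    and D: "\<And>B. B \<in> rc_borel \<Longrightarrow> D B = (LINT z:B|\<mu>. \<sigma> z)"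
    using dm unfolding differential_measure_def by metis
  note near = total_variation_zero_near[OF ctx, of \<mu> \<sigma>]
  have sub: "B' \<in> rc_borel" if "B \<in> rc_borel" "B' \<in> sets borel" "B' \<subseteq> B" for B B'
    using that unfolding rc_borel_def by blast
  have uhp: "B \<subseteq> uhp" if "B \<in> rc_borel" for B using that unfolding rc_borel_def by blast
  have bor: "B \<in> sets borel" if "B \<in> rc_borel" for B using that unfolding rc_borel_def by blast
  have Dnull: "D B = 0" if B: "B \<in> rc_borel"
    and nbhd: "\<And>z. z \<in> B \<Longrightarrow> \<exists>V. open V \<and> z \<in> V \<and> V \<subseteq> uhp \<and>
        (\<forall>\<psi>. test_form \<psi> \<and> closure {z. \<psi> z \<noteq> 0} \<subseteq> V \<longrightarrow> d_current v \<psi> = 0)" for B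
  proof -
    have "AE z in \<mu>. z \<notin> B"
    proof (rule AE_not_in_of_local)
      fix z assume "z \<in> B"
      then obtain V where V: "open V" "z \<in> V" "V \<subseteq> uhp"
        "\<And>\<psi>. test_form \<psi> \<Longrightarrow> closure {z. \<psi> z \<noteq> 0} \<subseteq> V \<Longrightarrow> d_current v \<psi> = 0" using nbhd by meson
      have "AE w in \<mu>. w \<notin> V" by (rule near[OF \<mu> V(1,3,4)])
      then show "\<exists>V. open V \<and> z \<in> V \<and> (AE w in \<mu>. w \<notin> V)" using V by blast
    qed
    then have "AE z in \<mu>. indicator B z *\<^sub>R \<sigma> z = 0" by (auto elim!: eventually_mono)
    then show ?thesis unfolding D[OF B] set_lebesgue_integral_def by (rule integral_eq_zero_AE)
  qed
  have off: "\<exists>V. open V \<and> z \<in> V \<and> V \<subseteq> uhp \<and>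
        (\<forall>\<psi>. test_form \<psi> \<and> closure {z. \<psi> z \<noteq> 0} \<subseteq> V \<longrightarrow> d_current v \<psi> = 0)"
    if z: "z \<in> uhp" "p z \<notin> S" for z
  proof -
    obtain V where V: "open V" "z \<in> V" "V \<subseteq> uhp" "inj_on p V" "\<forall>w\<in>V. p w \<notin> S"
      using off_lamination_nbhd[OF ctx z] by blast
    have "d_current v \<psi> = 0" if "test_form \<psi>" "closure {z. \<psi> z \<noteq> 0} \<subseteq> V" for \<psi>
      by (rule d_current_zero_off[OF ctx V(1,3,4) _ that]) (use V(5) in blast)
    then show ?thesis using V by (intro exI[of _ V]) simp
  qed
  have Pb: "?P \<in> sets borel"
  proof -
    have "?P = uhp - {z \<in> uhp. p z \<notin> S}" by auto
    then show ?thesis using open_uhp open_off_lamination[OF ctx] by (simp add: sets.Diff)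
  qed
  have Pnull: "emeasure lborel ?P = 0"
    using lamination_preimage_negligible[OF M O] Pb by (simp add: negligible_iff_null_sets null_sets_def)
  have empty: "{} \<in> rc_borel" unfolding rc_borel_def by blast
  have ac0: "D_ac B = 0" if B: "B \<in> rc_borel" for B
  proof -
    obtain N1 where N1: "N1 \<in> sets borel" "emeasure lborel N1 = 0" "concentrated_on D_sing N1"
      using sing unfolding singular_vm_def by blast
    \<comment> \<open>Off \<open>P\<close> the measure \<open>D\<close> vanishes and off \<open>N1\<close> its singular part does; the union of both sets is null.\<close>
    let ?N = "?P \<union> N1"
    let ?A = "\<lambda>i::nat. if i = 0 then B \<inter> ?N else if i = 1 then B - ?N else {}"
    have r: "B \<inter> ?N \<in> rc_borel" "B - ?N \<in> rc_borel" by (rule sub[OF B]; use bor[OF B] Pb N1(1) in auto)+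
    have "emeasure lborel (B \<inter> ?N) = 0"
    proof -
      have "?N \<in> null_sets lborel" using Pb Pnull N1 by (intro null_sets.Un) (auto simp: null_sets_def)
      then have "B \<inter> ?N \<in> null_sets lborel" using bor[OF B] by (simp add: null_set_Int1)
      then show ?thesis by auto
    qed
    then have z1: "D_ac (B \<inter> ?N) = 0" 
      by (rule ac(2)[unfolded abs_continuous_vm_def, rule_format, OF r(1)])
    have "D (B - ?N) = 0" by (rule Dnull[OF r(2)], rule off) (use uhp[OF B] in auto)
    moreover have "D_sing (B - ?N) = 0"
      by (rule N1(3)[unfolded concentrated_on_def, rule_format, OF r(2)]) auto
    ultimately have z2: "D_ac (B - ?N) = 0" using dec[OF r(2)] by simp
    have z3: "D_ac {} = 0" using ac(2) empty unfolding abs_continuous_vm_def by simp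
    have U: "(\<Union>i. ?A i) = B"
    proof
      show "(\<Union>i. ?A i) \<subseteq> B" by (rule UN_least) simp
      have "B \<inter> ?N \<subseteq> (\<Union>i. ?A i)" using UN_upper[of 0 UNIV ?A] by simp
      moreover have "B - ?N \<subseteq> (\<Union>i. ?A i)" using UN_upper[of 1 UNIV ?A] by simp
      ultimately show "B \<subseteq> (\<Union>i. ?A i)" by blast
    qed
    have "disjoint_family ?A" by (auto simp: disjoint_family_on_def)
    moreover have "range ?A \<subseteq> rc_borel" using r empty by auto
    ultimately have "(\<lambda>i. D_ac (?A i)) sums D_ac B"
      using ac(1)[unfolded vector_measure_def, rule_format, of ?A] B unfolding U by blast
    moreover have "(\<lambda>i. D_ac (?A i)) = (\<lambda>i. 0)" using z1 z2 z3 by auto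
    ultimately show ?thesis by (simp add: sums_unique2[OF _ sums_zero])
  qed
  have sD: "D_sing B = D B" if "B \<in> rc_borel" for B using dec[OF that] ac0[OF that] by simp
  have Jsub: "?J \<subseteq> {z \<in> uhp. p z \<in> \<Union>(closed_isolated_leaves M p S L)}"
  proof
    fix z assume z: "z \<in> ?J"
    then have zu: "z \<in> uhp" by (simp add: jump_set_def)
    moreover have "p z \<in> S" using not_jump_off_lamination[OF ctx zu] z by blast
    ultimately show "z \<in> {z \<in> uhp. p z \<in> \<Union>(closed_isolated_leaves M p S L)}"
      using jump_classification(1)[OF ctx \<N>] z by blast
  qed
  have "concentrated_on D_jump {z \<in> uhp. p z \<in> \<Union>(closed_isolated_leaves M p S L)}"
    unfolding concentrated_on_def
  proof (intro ballI impI)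
    fix B assume B: "B \<in> rc_borel" "B \<inter> {z \<in> uhp. p z \<in> \<Union>(closed_isolated_leaves M p S L)} = {}"
    have "B \<inter> ?J = {}" using Int_mono[OF subset_refl Jsub, of B] unfolding B(2) by simp
    then have "D_jump B = D {}" using dec[OF B(1)] sD[OF empty] by simp
    then show "D_jump B = 0" using Dnull[OF empty] by simp
  qed
  moreover have "concentrated_on D_cantor {z \<in> uhp. p z \<in>
      \<Union>{N. N \<subseteq> S \<and> minimal_lamination M p N \<and> N \<notin> closed_isolated_leaves M p S L}}"
    unfolding concentrated_on_def
  proof (intro ballI impI)
    fix B assume B: "B \<in> rc_borel" "B \<inter> {z \<in> uhp. p z \<in>
      \<Union>{N. N \<subseteq> S \<and> minimal_lamination M p N \<and> N \<notin> closed_isolated_leaves M p S L}} = {}"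
    have BJ: "B - ?J \<in> rc_borel"
      by (rule sub[OF B(1)]) (use bor[OF B(1)] jump_set_borel[OF ctx \<N>] in auto)
    have "D (B - ?J) = 0"
    proof (rule Dnull[OF BJ])
      fix z assume z: "z \<in> B - ?J"
      then have zu: "z \<in> uhp" using uhp[OF B(1)] by blast
      show "\<exists>V. open V \<and> z \<in> V \<and> V \<subseteq> uhp \<and>
        (\<forall>\<psi>. test_form \<psi> \<and> closure {z. \<psi> z \<noteq> 0} \<subseteq> V \<longrightarrow> d_current v \<psi> = 0)"
      proof (cases "p z \<in> S")
        case False
        then show ?thesis by (rule off[OF zu])
      next
        case True
        then obtain N where N: "N \<in> \<N>" "p z \<in> N" using \<N>(4) by blast
        have "N \<in> closed_isolated_leaves M p S L"
        proof (rule ccontr)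
          assume "N \<notin> closed_isolated_leaves M p S L"
          moreover have "N \<subseteq> S" using N(1) \<N>(4) by blast
          ultimately have "z \<in> {z \<in> uhp. p z \<in>
            \<Union>{N. N \<subseteq> S \<and> minimal_lamination M p N \<and> N \<notin> closed_isolated_leaves M p S L}}"
            using zu N \<N>(3) by blast
          then show False using B(2) z by blast
        qed
        then have "N \<in> L" "closed_leaf p N" by (auto simp: closed_isolated_leaves_def)
        then show ?thesis using jump_classification(3)[OF ctx \<N> zu True, of N] z N(2) by blast
      qed
    qed
    then show "D_cantor B = 0" using dec[OF B(1)] sD[OF BJ] by simp
  qed
  ultimately show ?thesis using ac0 by blast
qed

end
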